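(* Let $p>1$, and let $(X_n)_{n\in\mathbb{Z}}$ be an adapted stationary sequence in $\mathbb{L}^p(\mathcal{H})$. Assume that $$\sum_{n\ge1}\frac{\|\mathbb{E}_0(S_n)\|_{p,\mathcal{H}}}{n^{1+1/p''}}<\infty .$$ Then $\sum_{n\ge1}\bigl|\sum_{k\ge n} k^{-1}\mathcal{P}_0(X_{k-1})\bigr|_{\mathcal{H}}$ converges in $\mathbb{L}^p$, and, setting $M_n=\sum_{k=1}^{n}D\circ\theta^k$ where $$D=\sum_{n\geq0}\sum_{k\geq n}\frac{\mathcal{P}_0(X_k)}{k+1},$$ one has $$\|S_n-M_n\|_{p,\mathcal{H}}\ll n^{1/p'}\sum_{k\ge[n^{q}]}\frac{\|\mathbb{E}_0(S_k)\|_{p,\mathcal{H}}}{k^{1+1/p''}} .$$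
   Context: Setting. $(\Omega,\mathcal{A},\mathbb{P})$ is a probability space and $\theta:\Omega\to\Omega$ is a bijective bi-measurable transformation preserving $\mathbb{P}$. $\mathcal{F}_0\subseteq\mathcal{A}$ is a $\sigma$-algebra with $\mathcal{F}_0\subseteq\theta^{-1}(\mathcal{F}_0)$, and $\mathcal{F}_i=\theta^{-i}(\mathcal{F}_0)$ for $i\in\mathbb{Z}$ (a nondecreasing filtration). $\mathcal{H}$ is a real separable Hilbert space with norm $|\cdot|_{\mathcal{H}}$, and $\|X\|_{p,\mathcal{H}}=(\mathbb{E}(|X|_{\mathcal{H}}^p))^{1/p}$ is the norm of $\mathbb{L}^p(\mathcal{H})$; $\mathbb{L}^p=\mathbb{L}^p(\mathbb{R})$. An adapted stationary sequence in $\mathbb{L}^p(\mathcal{H})$ is a sequence $X_i=X_0\circ\theta^i$, $i\in\mathbb{Z}$, where $X_0\in\mathbb{L}^p(\mathcal{H})$ is centered and $\mathcal{F}_0$-measurable. Notation: $S_n=X_1+\cdots+X_n$; $\mathbb{E}_k(X)=\mathbb{E}(X|\mathcal{F}_k)$; $\mathcal{P}_k(X)=\mathbb{E}_k(X)-\mathbb{E}_{k-1}(X)$; $p'=\min(2,p)$, $p''=\max(2,p)$, $q=p''/p'$; $[x]$ is the integer part of $x$. $a_n\ll b_n$ means that there is a constant $C$ not depending on $n$ such that $a_n\le Cb_n$ for all positive integers $n$. *)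

theory Defs
  imports "HOL-Probability.Probability"
begin

definition bimeasurable_mpt :: "'a measure \<Rightarrow> ('a \<Rightarrow> 'a) \<Rightarrow> bool" where
  "bimeasurable_mpt M \<theta> \<longleftrightarrow>
     bij_betw \<theta> (space M) (space M) \<and>
     \<theta> \<in> measurable M M \<and>
     the_inv_into (space M) \<theta> \<in> measurable M M \<and>
     distr M M \<theta> = M"

text \<open>Only meaningful on \<open>space M\<close>, where \<open>\<theta>\<close> is bijective; the values elsewhere are never used.\<close>

definition int_iterate :: "'a measure \<Rightarrow> ('a \<Rightarrow> 'a) \<Rightarrow> int \<Rightarrow> 'a \<Rightarrow> 'a" where
  "int_iterate M \<theta> i =
     (if 0 \<le> i then \<theta> ^^ nat i else the_inv_into (space M) \<theta> ^^ nat (- i))"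

definition filt :: "'a measure \<Rightarrow> ('a \<Rightarrow> 'a) \<Rightarrow> 'a measure \<Rightarrow> int \<Rightarrow> 'a measure" where
  "filt M \<theta> F0 i = vimage_algebra (space M) (int_iterate M \<theta> i) F0"

text \<open>The library's \<open>real_cond_exp\<close> covers real-valued functions only; here the values lie in a
  separable Banach space (separability being \<open>second_countable_topology\<close>). Versions are determined up to almost sure equality.\<close>

definition has_cond_exp ::
  "'a measure \<Rightarrow> 'a measure \<Rightarrow> ('a \<Rightarrow> 'b) \<Rightarrow> ('a \<Rightarrow> 'b::{banach, second_countable_topology}) \<Rightarrow> bool"
where
  "has_cond_exp M F f g \<longleftrightarrow>
     integrable M f \<and> integrable M g \<and> g \<in> borel_measurable F \<and>
     (\<forall>A\<in>sets F. set_lebesgue_integral M A g = set_lebesgue_integral M A f)"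

definition cond_exp ::
  "'a measure \<Rightarrow> 'a measure \<Rightarrow> ('a \<Rightarrow> 'b) \<Rightarrow> 'a \<Rightarrow> 'b::{banach, second_countable_topology}"
where
  "cond_exp M F f = (SOME g. has_cond_exp M F f g)"

definition proj_op ::
  "'a measure \<Rightarrow> ('a \<Rightarrow> 'a) \<Rightarrow> 'a measure \<Rightarrow> int \<Rightarrow> ('a \<Rightarrow> 'b) \<Rightarrow>
   'a \<Rightarrow> 'b::{banach, second_countable_topology}"
where
  "proj_op M \<theta> F0 k f =
     (\<lambda>\<omega>. cond_exp M (filt M \<theta> F0 k) f \<omega> - cond_exp M (filt M \<theta> F0 (k - 1)) f \<omega>)"

definition Lp_space :: "'a measure \<Rightarrow> real \<Rightarrow> ('a \<Rightarrow> 'b::real_normed_vector) set" where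
  "Lp_space M p = {f \<in> borel_measurable M. integrable M (\<lambda>\<omega>. norm (f \<omega>) powr p)}"

text \<open>Only meaningful for members of \<open>Lp_space M p\<close>: outside it the Bochner integral
  defaults to 0.\<close>

definition Lp_norm :: "'a measure \<Rightarrow> real \<Rightarrow> ('a \<Rightarrow> 'b::real_normed_vector) \<Rightarrow> real" where
  "Lp_norm M p f = (\<integral>\<omega>. norm (f \<omega>) powr p \<partial>M) powr (1 / p)"

definition Lp_sums ::
  "'a measure \<Rightarrow> real \<Rightarrow> (nat \<Rightarrow> 'a \<Rightarrow> 'b) \<Rightarrow> ('a \<Rightarrow> 'b::real_normed_vector) \<Rightarrow> bool"
where
  "Lp_sums M p f g \<longleftrightarrow>
     (\<forall>n. f n \<in> Lp_space M p) \<and> g \<in> Lp_space M p \<and>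
     (\<lambda>n. Lp_norm M p (\<lambda>\<omega>. (\<Sum>i<n. f i \<omega>) - g \<omega>)) \<longlonglongrightarrow> 0"

definition Lp_summable ::
  "'a measure \<Rightarrow> real \<Rightarrow> (nat \<Rightarrow> 'a \<Rightarrow> 'b::real_normed_vector) \<Rightarrow> bool"
where
  "Lp_summable M p f \<longleftrightarrow> (\<exists>g. Lp_sums M p f g)"

text \<open>A representative of the limit, which is unique up to almost sure equality.\<close>

definition Lp_suminf ::
  "'a measure \<Rightarrow> real \<Rightarrow> (nat \<Rightarrow> 'a \<Rightarrow> 'b) \<Rightarrow> 'a \<Rightarrow> 'b::real_normed_vector"
where
  "Lp_suminf M p f = (SOME g. Lp_sums M p f g)"

definition adapted_stationary ::
  "'a measure \<Rightarrow> ('a \<Rightarrow> 'a) \<Rightarrow> 'a measure \<Rightarrow> real \<Rightarrow>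
   (int \<Rightarrow> 'a \<Rightarrow> 'b::{banach, second_countable_topology}) \<Rightarrow> bool"
where
  "adapted_stationary M \<theta> F0 p X \<longleftrightarrow>
     X 0 \<in> Lp_space M p \<and>
     (\<integral>\<omega>. X 0 \<omega> \<partial>M) = 0 \<and>
     X 0 \<in> borel_measurable F0 \<and>
     (\<forall>i. \<forall>\<omega>\<in>space M. X i \<omega> = X 0 (int_iterate M \<theta> i \<omega>))"

end

theory Submission
  imports Defs
begin

text \<open>
  Write \<open>s n = \<parallel>E\<^sub>0(S\<^sub>n)\<parallel>\<^sub>p\<close>, \<open>P = max 2 p\<close>, \<open>x\<^sub>k = P\<^sub>0(X\<^sub>k)\<close> and
  \<open>B j n = x\<^sub>j + \<dots> + x\<^sub>j\<^sub>+\<^sub>n\<^sub>-\<^sub>1\<close>. The space \<open>L\<^sup>p\<close> is uniformly convex of power type \<open>P\<close>, so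
  projecting \<open>E\<^sub>0(S\<^sub>n)\<close> onto the successive pasts gives \<open>\<Sum>j\<ge>1. \<parallel>B j n\<parallel>\<^sup>P \<le> C (s n)\<^sup>P\<close>. Abel
  summation expresses the tails \<open>u\<^sub>n = \<Sum>k\<ge>n. x\<^sub>k / (k + 1)\<close> through
  \<open>\<Sum>i. B n i / (n + i)\<^sup>2\<close>, and Hoelder's inequality in \<open>n\<close> bounds \<open>\<Sum>n>N. \<parallel>u\<^sub>n\<parallel>\<close> by
  \<open>\<Sum>i. s i (N + i) powr -(1 + 1/P)\<close>. As \<open>s i \<le> s (i + k) + s k\<close>, this is at most a constant
  times \<open>tail N = \<Sum>k\<ge>N. s k / k powr (1 + 1/P)\<close>.

  For the rate, compare \<open>D\<close> with the average of \<open>B 0 i\<close> over \<open>N < i \<le> 2N\<close>. Replacing \<open>X\<^sub>0\<close> by this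
  average changes \<open>S\<^sub>n\<close> by a coboundary and a small remainder, controlled by
  \<open>max {s i | i \<le> 2N}\<close> for \<open>n \<le> N\<close>; and \<open>L\<^sup>p\<close> being uniformly smooth of power type
  \<open>p' = min 2 p\<close>, the martingale with increment \<open>D\<close> minus the average has norm at most
  \<open>C n powr (1/p') tail N\<close>. The choice \<open>N = [n powr (P/p')]\<close> balances the two errors.
\<close>

section \<open>Two-point inequalities\<close>

text \<open>The exponent \<open>1 + 1/P\<close> of the hypothesis is forced by Hoelder's inequality:
  with \<open>r\<close> conjugate to \<open>P\<close>, the \<open>r\<close>-norm of
  \<open>1 / (n + i)\<^sup>2\<close> over \<open>n > N\<close> is of order
  \<open>(N + i) powr -(2 - 1/r)\<close>, and \<open>2 - 1/r = 1 + 1/P\<close>. The obstacle for p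
  other than 2 is the lack of orthogonality. It is met by inequalities for the pair x + y, x - y,
  proved for numbers, lifted to Hilbert space and integrated; each use concerns a single projection
  or a single martingale difference. Another obstacle is that \<open>s\<close> need not be monotone.
  Averaging its subadditivity over k in [N, 2N) gives
  \<open>s i \<le> 16 * N powr (1/P) * tail N\<close> for i up to 2N, which brings the coboundary
  error into the same shape as the martingale error. The double series for D is a summation method
  for the formal series of all \<open>P\<^sub>0(X\<^sub>k)\<close>, whose convergence is not
  assumed: the term \<open>P\<^sub>0(X\<^sub>k) / (k + 1)\<close> occurs in exactly the k + 1 tails
  \<open>u\<^sub>0\<close>, ..., \<open>u\<^sub>k\<close>.\<close>

lemma powr_le_tangent:
  fixes r x :: real
  assumes "0 < r" "r \<le> 1" "0 \<le> x"
  shows "x powr r \<le> 1 + r * (x - 1)"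
proof (cases "x = 0")
  case False
  then show ?thesis
    using Youngs_inequality_0[of r "1 - r" x 1] assms by (simp add: algebra_simps)
qed (use assms in simp)

text \<open>Bernoulli's inequality from the concave case: for the exponent \<open>1/r\<close>, the
  tangent at 1 takes the value x at the point \<open>1 + r * (x - 1)\<close>.\<close>

lemma powr_ge_tangent:
  fixes r x :: real
  assumes "1 \<le> r" "0 \<le> x"
  shows "1 + r * (x - 1) \<le> x powr r"
proof (cases "1 + r * (x - 1) \<le> 0")
  case True
  then show ?thesis
    by (meson order_trans powr_ge_zero)
next
  case False
  define y where "y = 1 + r * (x - 1)"
  have y: "y > 0"
    using False by (simp add: y_def)
  have "y powr (1 / r) \<le> 1 + (1 / r) * (y - 1)"
    using assms y by (intro powr_le_tangent) auto
  also have "\<dots> = x"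
    using assms by (simp add: y_def)
  finally have "(y powr (1 / r)) powr r \<le> x powr r"
    using assms by (intro powr_mono2) auto
  then show ?thesis
    using y assms by (simp add: powr_powr y_def)
qed

text \<open>Jensen's inequality for two points. Both are divided by their mean m, so that the two
  tangents at 1 average to exactly 1.\<close>

lemma powr_convex_comb:
  fixes r x y u v :: real
  assumes "1 \<le> r" "0 \<le> x" "0 \<le> y" "0 \<le> u" "0 \<le> v" "u + v = 1"
  shows "(u * x + v * y) powr r \<le> u * x powr r + v * y powr r"
proof -
  define m where "m = u * x + v * y"
  show ?thesis
  proof (cases "m = 0")
    case False
    then have m: "m > 0"
      using assms by (simp add: m_def order_less_le)
    have "1 + r * (x / m - 1) \<le> (x / m) powr r" "1 + r * (y / m - 1) \<le> (y / m) powr r"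
      using assms m by (intro powr_ge_tangent; simp)+
    then have "u * (1 + r * (x / m - 1)) + v * (1 + r * (y / m - 1))
        \<le> u * (x / m) powr r + v * (y / m) powr r"
      using assms by (intro add_mono mult_left_mono)
    moreover have "u * (1 + r * (x / m - 1)) + v * (1 + r * (y / m - 1))
        = (u + v) + r * ((u * x + v * y) / m - (u + v))"
      by (simp add: add_divide_distrib algebra_simps)
    moreover have "\<dots> = 1"
      using m assms(6) by (simp flip: m_def)
    ultimately have "1 \<le> (u * x powr r + v * y powr r) / m powr r"
      using assms m by (simp add: powr_divide add_divide_distrib)
    then show ?thesis
      using m by (simp flip: m_def)
  qed (use assms in \<open>simp flip: m_def\<close>)
qed

lemma powr_concave_comb:
  fixes r x y u v :: real
  assumes "0 < r" "r \<le> 1" "0 \<le> x" "0 \<le> y" "0 \<le> u" "0 \<le> v" "u + v = 1"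
  shows "u * x powr r + v * y powr r \<le> (u * x + v * y) powr r"
proof -
  define m where "m = u * x + v * y"
  show ?thesis
  proof (cases "m = 0")
    case False
    then have m: "m > 0"
      using assms by (simp add: m_def order_less_le)
    have "(x / m) powr r \<le> 1 + r * (x / m - 1)" "(y / m) powr r \<le> 1 + r * (y / m - 1)"
      using assms m by (intro powr_le_tangent; simp)+
    then have "u * (x / m) powr r + v * (y / m) powr r
        \<le> u * (1 + r * (x / m - 1)) + v * (1 + r * (y / m - 1))"
      using assms by (intro add_mono mult_left_mono)
    moreover have "u * (1 + r * (x / m - 1)) + v * (1 + r * (y / m - 1))
        = (u + v) + r * ((u * x + v * y) / m - (u + v))"
      by (simp add: add_divide_distrib algebra_simps)
    moreover have "\<dots> = 1"
      using m assms(7) by (simp flip: m_def)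
    ultimately have "(u * x powr r + v * y powr r) / m powr r \<le> 1"
      using assms m by (simp add: powr_divide add_divide_distrib)
    then show ?thesis
      using m by (simp flip: m_def)
  next
    case True
    then have "u * x = 0" "v * y = 0"
      using assms by (simp_all add: m_def add_nonneg_eq_0_iff)
    then show ?thesis
      by auto
  qed
qed

text \<open>On [0, 1] a power with exponent at least 1 lies below the identity; this is applied to
  the shares x / (x + y) and y / (x + y).\<close>

lemma powr_superadditive:
  fixes r x y :: real
  assumes "1 \<le> r" "0 \<le> x" "0 \<le> y"
  shows "x powr r + y powr r \<le> (x + y) powr r"
proof (cases "x + y = 0")
  case False
  then have m: "x + y > 0"
    using assms by simp
  have le: "(z / (x + y)) powr r \<le> z / (x + y)" if "0 \<le> z" "z \<le> x + y" for z
    using powr_mono'[of 1 r "z / (x + y)"] that m assms(1) by (cases "z = 0") auto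
  have "(x / (x + y)) powr r + (y / (x + y)) powr r \<le> x / (x + y) + y / (x + y)"
    using assms by (intro add_mono le) auto
  also have "\<dots> = 1"
    using m by (simp flip: add_divide_distrib)
  finally have "(x powr r + y powr r) / (x + y) powr r \<le> 1"
    using assms m by (simp add: powr_divide add_divide_distrib)
  then show ?thesis
    using m by simp
qed (use assms in \<open>simp add: add_nonneg_eq_0_iff\<close>)

text \<open>Superadditivity for the exponent \<open>1/r\<close>, applied to \<open>x powr r\<close>
  and \<open>y powr r\<close>.\<close>

lemma powr_subadditive:
  fixes r x y :: real
  assumes "0 < r" "r \<le> 1" "0 \<le> x" "0 \<le> y"
  shows "(x + y) powr r \<le> x powr r + y powr r"
proof -
  have "(x powr r) powr (1 / r) + (y powr r) powr (1 / r) \<le> (x powr r + y powr r) powr (1 / r)"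
    using assms by (intro powr_superadditive) auto
  then have "x + y \<le> (x powr r + y powr r) powr (1 / r)"
    using assms by (simp add: powr_powr)
  then have "(x + y) powr r \<le> ((x powr r + y powr r) powr (1 / r)) powr r"
    using assms by (intro powr_mono2) auto
  then show ?thesis
    using assms by (simp add: powr_powr)
qed

text \<open>The points a + b and a - b are convex combinations of a + B and a - B with weights u, v
  and v, u; adding Jensen's inequality for both leaves the factor u + v = 1. Later a is a sum of two
  squared norms, b twice an inner product and B the Cauchy-Schwarz bound for b.\<close>

lemma two_point_powr_convex:
  fixes a b B r :: real
  assumes "1 \<le> r" "\<bar>b\<bar> \<le> B" "B \<le> a"
  shows "(a + b) powr r + (a - b) powr r \<le> (a + B) powr r + (a - B) powr r"
proof (cases "B = 0")
  case False
  then have B: "B > 0"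
    using assms by linarith
  define u v where "u = (B + b) / (2 * B)" and "v = (B - b) / (2 * B)"
  have uv: "0 \<le> u" "0 \<le> v" "u + v = 1"
    using assms B by (auto simp: u_def v_def field_simps)
  have "a + b = u * (a + B) + v * (a - B)" "a - b = v * (a + B) + u * (a - B)"
    using B by (auto simp: u_def v_def field_simps)
  moreover have "(u * (a + B) + v * (a - B)) powr r + (v * (a + B) + u * (a - B)) powr r
      \<le> (u * (a + B) powr r + v * (a - B) powr r) + (v * (a + B) powr r + u * (a - B) powr r)"
    using assms B uv by (intro add_mono powr_convex_comb) auto
  moreover have "\<dots> = (u + v) * ((a + B) powr r + (a - B) powr r)"
    by (simp add: algebra_simps)
  ultimately show ?thesis
    using uv by simp
qed (use assms in auto)

lemma two_point_powr_concave:
  fixes a b B r :: real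
  assumes "0 < r" "r \<le> 1" "\<bar>b\<bar> \<le> B" "B \<le> a"
  shows "(a + B) powr r + (a - B) powr r \<le> (a + b) powr r + (a - b) powr r"
proof (cases "B = 0")
  case False
  then have B: "B > 0"
    using assms by linarith
  define u v where "u = (B + b) / (2 * B)" and "v = (B - b) / (2 * B)"
  have uv: "0 \<le> u" "0 \<le> v" "u + v = 1"
    using assms B by (auto simp: u_def v_def field_simps)
  have "a + b = u * (a + B) + v * (a - B)" "a - b = v * (a + B) + u * (a - B)"
    using B by (auto simp: u_def v_def field_simps)
  moreover have "(u * (a + B) powr r + v * (a - B) powr r) + (v * (a + B) powr r + u * (a - B) powr r)
      \<le> (u * (a + B) + v * (a - B)) powr r + (v * (a + B) + u * (a - B)) powr r"
    using assms B uv by (intro add_mono powr_concave_comb) auto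
  moreover have "(u * (a + B) powr r + v * (a - B) powr r) + (v * (a + B) powr r + u * (a - B) powr r)
      = (u + v) * ((a + B) powr r + (a - B) powr r)"
    by (simp add: algebra_simps)
  ultimately show ?thesis
    using uv by simp
qed (use assms in auto)

text \<open>The difference g is increasing. Its derivative is handled by the crude bound 1 below
  \<open>(1 + s) powr (p - 1)\<close> and the tangent above \<open>(1 - s) powr (p - 1)\<close>,
  which is why the constant is half the true Taylor coefficient \<open>p * (p - 1)\<close>.\<close>

lemma two_point_taylor_lower:
  fixes p t :: real
  assumes "1 < p" "p \<le> 2" "0 \<le> t" "t \<le> 1"
  shows "2 + p * (p - 1) / 2 * t\<^sup>2 \<le> (1 + t) powr p + (1 - t) powr p"
proof -
  define g where "g = (\<lambda>s::real. (1 + s) powr p + (1 - s) powr p - 2 - p * (p - 1) / 2 * s\<^sup>2)"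
  have "g 0 \<le> g t"
  proof (rule DERIV_nonneg_imp_increasing_open[where f = g])
    fix s assume s: "0 < s" "s < t"
    have der: "(g has_real_derivative (p * (1 + s) powr (p - 1) - p * (1 - s) powr (p - 1) - p * (p - 1) * s)) (at s)"
      unfolding g_def using s assms by (auto intro!: derivative_eq_intros simp: field_simps)
    have "(1 - s) powr (p - 1) \<le> 1 + (p - 1) * ((1 - s) - 1)"
      using s assms by (intro powr_le_tangent) auto
    moreover have "1 \<le> (1 + s) powr (p - 1)"
      using s assms by (intro ge_one_powr_ge_zero) auto
    ultimately have "0 \<le> p * ((1 + s) powr (p - 1) - (1 - s) powr (p - 1) - (p - 1) * s)"
      using assms by (intro mult_nonneg_nonneg) auto
    then have "0 \<le> p * (1 + s) powr (p - 1) - p * (1 - s) powr (p - 1) - p * (p - 1) * s"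
      by (simp add: algebra_simps)
    then show "\<exists>y. (g has_real_derivative y) (at s) \<and> 0 \<le> y"
      using der by blast
  next
    show "continuous_on {0..t} g"
      unfolding g_def using assms by (intro continuous_intros continuous_on_powr') auto
  qed (use assms in auto)
  then show ?thesis
    by (simp add: g_def)
qed

text \<open>In the derivative, \<open>(1 + s) powr (p - 1)\<close> lies below the chord of the
  convex power between 1 and 2, whose slope is less than \<open>2 powr p\<close>, and the tangent
  bound for \<open>(1 - s) powr (p - 1)\<close> costs at most p more. The constant is generous; it
  only has to depend on p alone.\<close>

lemma two_point_taylor_upper:
  fixes p t :: real
  assumes "2 \<le> p" "0 \<le> t" "t \<le> 1"
  shows "(1 + t) powr p + (1 - t) powr p \<le> 2 + p * (2 powr p + p) * t\<^sup>2"
proof -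
  define g where "g = (\<lambda>s::real. 2 + p * (2 powr p + p) * s\<^sup>2 - (1 + s) powr p - (1 - s) powr p)"
  have "g 0 \<le> g t"
  proof (rule DERIV_nonneg_imp_increasing_open[where f = g])
    fix s assume s: "0 < s" "s < t"
    have der: "(g has_real_derivative (2 * p * (2 powr p + p) * s - p * (1 + s) powr (p - 1) + p * (1 - s) powr (p - 1))) (at s)"
      unfolding g_def using s assms by (auto intro!: derivative_eq_intros simp: field_simps)
    have "1 + (p - 1) * ((1 - s) - 1) \<le> (1 - s) powr (p - 1)"
      using s assms by (intro powr_ge_tangent) auto
    moreover have "(1 + s) powr (p - 1) \<le> 1 - s + s * 2 powr (p - 1)"
      using powr_convex_comb[of "p - 1" 1 2 "1 - s" s] s assms by (simp add: add.commute)
    moreover have "s * 2 powr (p - 1) \<le> s * 2 powr p"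
      using s by (intro mult_left_mono powr_mono) auto
    moreover have "0 \<le> s * (2 powr p) + p * s + s"
      using s assms by simp
    moreover have "(p - 1) * ((1 - s) - 1) = s - p * s"
      "2 * (2 powr p + p) * s = 2 * (s * 2 powr p) + 2 * (p * s)"
      by (simp_all add: algebra_simps)
    ultimately have "0 \<le> 2 * (2 powr p + p) * s - (1 + s) powr (p - 1) + (1 - s) powr (p - 1)"
      using s by linarith
    then have "0 \<le> p * (2 * (2 powr p + p) * s - (1 + s) powr (p - 1) + (1 - s) powr (p - 1))"
      using assms by (intro mult_nonneg_nonneg) auto
    then have "0 \<le> 2 * p * (2 powr p + p) * s - p * (1 + s) powr (p - 1) + p * (1 - s) powr (p - 1)"
      by (simp add: algebra_simps)
    then show "\<exists>y. (g has_real_derivative y) (at s) \<and> 0 \<le> y"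
      using der by blast
  next
    show "continuous_on {0..t} g"
      unfolding g_def using assms by (intro continuous_intros continuous_on_powr') auto
  qed (use assms in auto)
  then show ?thesis
    by (simp add: g_def)
qed

text \<open>By homogeneity only the ratio z = t / s in [0, 1] counts. If t exceeds s, the two are
  exchanged: the coefficient of the square of t is at most 1, so the exchange can only increase the
  left side.\<close>

lemma two_point_scalar_lower:
  fixes p s t :: real
  assumes p: "1 < p" "p \<le> 2" and st: "0 \<le> s" "0 \<le> t"
  shows "2 * (s\<^sup>2 + (p - 1) / 2 * t\<^sup>2) powr (p / 2) \<le> (s + t) powr p + \<bar>s - t\<bar> powr p"
proof -
  have *: "2 * (s\<^sup>2 + (p - 1) / 2 * t\<^sup>2) powr (p / 2) \<le> (s + t) powr p + \<bar>s - t\<bar> powr p"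
    if st: "0 \<le> t" "t \<le> s" for s t :: real
  proof (cases "s = 0")
    case False
    then have s: "s > 0"
      using st by simp
    define z where "z = t / s"
    have z: "0 \<le> z" "z \<le> 1" and t: "t = z * s"
      using s st by (auto simp: z_def)
    have "(1 + (p - 1) / 2 * z\<^sup>2) powr (p / 2) \<le> 1 + (p / 2) * ((1 + (p - 1) / 2 * z\<^sup>2) - 1)"
      using p by (intro powr_le_tangent) auto
    then have "2 * (1 + (p - 1) / 2 * z\<^sup>2) powr (p / 2) \<le> 2 + p * (p - 1) / 2 * z\<^sup>2"
      by (simp add: field_simps)
    also have "\<dots> \<le> (1 + z) powr p + (1 - z) powr p"
      using p z by (intro two_point_taylor_lower)
    finally have "s powr p * (2 * (1 + (p - 1) / 2 * z\<^sup>2) powr (p / 2))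
        \<le> s powr p * ((1 + z) powr p + (1 - z) powr p)"
      by (intro mult_left_mono) auto
    moreover have "s powr p = (s\<^sup>2) powr (p / 2)"
      using s by (simp add: powr_powr flip: powr_numeral)
    then have "s powr p * (2 * (1 + (p - 1) / 2 * z\<^sup>2) powr (p / 2))
        = 2 * (s\<^sup>2 * (1 + (p - 1) / 2 * z\<^sup>2)) powr (p / 2)"
      using p by (simp add: powr_mult)
    moreover have "s\<^sup>2 * (1 + (p - 1) / 2 * z\<^sup>2) = s\<^sup>2 + (p - 1) / 2 * t\<^sup>2"
      by (simp add: t algebra_simps power2_eq_square)
    moreover have "s powr p * ((1 + z) powr p + (1 - z) powr p) = (s * (1 + z)) powr p + (s * (1 - z)) powr p"
      by (simp only: powr_mult distrib_left[of "s powr p"])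
    moreover have "s * (1 + z) = s + t" "s * (1 - z) = \<bar>s - t\<bar>"
      using s z by (auto simp: t algebra_simps mult_left_le_one_le)
    ultimately show ?thesis
      by simp
  qed (use st in auto)
  show ?thesis
  proof (cases "t \<le> s")
    case True
    then show ?thesis
      using * st by simp
  next
    case False
    have "(1 - (p - 1) / 2) * s\<^sup>2 \<le> (1 - (p - 1) / 2) * t\<^sup>2"
      using p st False by (intro mult_left_mono power_mono) auto
    then have "s\<^sup>2 + (p - 1) / 2 * t\<^sup>2 \<le> t\<^sup>2 + (p - 1) / 2 * s\<^sup>2"
      by (simp add: algebra_simps)
    then have "(s\<^sup>2 + (p - 1) / 2 * t\<^sup>2) powr (p / 2) \<le> (t\<^sup>2 + (p - 1) / 2 * s\<^sup>2) powr (p / 2)"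
      using p by (intro powr_mono2) auto
    then show ?thesis
      using *[of s t] False st by (simp add: abs_minus_commute add.commute)
  qed
qed

lemma two_point_scalar_upper:
  fixes p s t :: real
  assumes p: "2 \<le> p" and st: "0 \<le> s" "0 \<le> t"
  shows "(s + t) powr p + \<bar>s - t\<bar> powr p \<le> 2 * (s\<^sup>2 + (2 powr p + p) * t\<^sup>2) powr (p / 2)"
proof -
  define K where "K = 2 powr p + p"
  have K: "K \<ge> 1"
    using p by (simp add: K_def add_increasing)
  have *: "(s + t) powr p + \<bar>s - t\<bar> powr p \<le> 2 * (s\<^sup>2 + K * t\<^sup>2) powr (p / 2)"
    if st: "0 \<le> t" "t \<le> s" for s t :: real
  proof (cases "s = 0")
    case False
    then have s: "s > 0"
      using st by simp
    define z where "z = t / s"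
    have z: "0 \<le> z" "z \<le> 1" and t: "t = z * s"
      using s st by (auto simp: z_def)
    have "(1 + z) powr p + (1 - z) powr p \<le> 2 + p * K * z\<^sup>2"
      unfolding K_def using p z by (intro two_point_taylor_upper)
    also have "1 + (p / 2) * ((1 + K * z\<^sup>2) - 1) \<le> (1 + K * z\<^sup>2) powr (p / 2)"
      using p K by (intro powr_ge_tangent) auto
    then have "2 + p * K * z\<^sup>2 \<le> 2 * (1 + K * z\<^sup>2) powr (p / 2)"
      by (simp add: algebra_simps)
    finally have "s powr p * ((1 + z) powr p + (1 - z) powr p)
        \<le> s powr p * (2 * (1 + K * z\<^sup>2) powr (p / 2))"
      by (intro mult_left_mono) auto
    moreover have "s powr p = (s\<^sup>2) powr (p / 2)"
      using s by (simp add: powr_powr flip: powr_numeral)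
    then have "s powr p * (2 * (1 + K * z\<^sup>2) powr (p / 2)) = 2 * (s\<^sup>2 * (1 + K * z\<^sup>2)) powr (p / 2)"
      using K by (simp add: powr_mult)
    moreover have "s\<^sup>2 * (1 + K * z\<^sup>2) = s\<^sup>2 + K * t\<^sup>2"
      by (simp add: t algebra_simps power2_eq_square)
    moreover have "s powr p * ((1 + z) powr p + (1 - z) powr p) = (s * (1 + z)) powr p + (s * (1 - z)) powr p"
      by (simp only: powr_mult distrib_left[of "s powr p"])
    moreover have "s * (1 + z) = s + t" "s * (1 - z) = \<bar>s - t\<bar>"
      using s z by (auto simp: t algebra_simps mult_left_le_one_le)
    ultimately show ?thesis
      by simp
  qed (use st in auto)
  show ?thesis
    unfolding K_def[symmetric]
  proof (cases "t \<le> s")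
    case True
    then show "(s + t) powr p + \<bar>s - t\<bar> powr p \<le> 2 * (s\<^sup>2 + K * t\<^sup>2) powr (p / 2)"
      using * st by simp
  next
    case False
    have "(K - 1) * s\<^sup>2 \<le> (K - 1) * t\<^sup>2"
      using K st False by (intro mult_left_mono power_mono) auto
    then have "t\<^sup>2 + K * s\<^sup>2 \<le> s\<^sup>2 + K * t\<^sup>2"
      by (simp add: algebra_simps)
    then have "(t\<^sup>2 + K * s\<^sup>2) powr (p / 2) \<le> (s\<^sup>2 + K * t\<^sup>2) powr (p / 2)"
      using p K by (intro powr_mono2) auto
    then show "(s + t) powr p + \<bar>s - t\<bar> powr p \<le> 2 * (s\<^sup>2 + K * t\<^sup>2) powr (p / 2)"
      using *[of s t] False st by (simp add: abs_minus_commute add.commute)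
  qed
qed

section \<open>Two-point inequalities for vectors of a Hilbert space\<close>

lemma norm_powr_as_square:
  fixes x :: "'h::real_normed_vector"
  shows "norm x powr p = ((norm x)\<^sup>2) powr (p / 2)"
  by (cases "x = 0") (simp_all add: powr_powr flip: powr_numeral)

text \<open>For fixed norms the right side is a symmetric concave function of the inner product,
  hence least when u and v are parallel; there it is the scalar inequality for the norms.\<close>

lemma norm_two_point_lower:
  fixes u v :: "'h::real_inner"
  assumes p: "1 < p" "p \<le> 2"
  shows "2 * ((norm u)\<^sup>2 + (p - 1) / 2 * (norm v)\<^sup>2) powr (p / 2)
    \<le> norm (u + v) powr p + norm (u - v) powr p"
proof -
  define a b B where "a = (norm u)\<^sup>2 + (norm v)\<^sup>2" and "b = 2 * (u \<bullet> v)" and "B = 2 * (norm u * norm v)"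
  have sq: "(norm (u + v))\<^sup>2 = a + b" "(norm (u - v))\<^sup>2 = a - b"
    by (simp_all add: a_def b_def power2_norm_eq_inner inner_commute algebra_simps)
  have "\<bar>b\<bar> \<le> B"
    using Cauchy_Schwarz_ineq2[of u v] by (simp add: b_def B_def abs_mult)
  moreover have "B \<le> a"
    using sum_squares_bound[of "norm u" "norm v"] by (simp add: a_def B_def)
  ultimately have "(a + B) powr (p / 2) + (a - B) powr (p / 2) \<le> (a + b) powr (p / 2) + (a - b) powr (p / 2)"
    using p by (intro two_point_powr_concave) auto
  moreover have "a + B = (norm u + norm v)\<^sup>2" "a - B = \<bar>norm u - norm v\<bar>\<^sup>2"
    by (simp_all add: a_def B_def power2_sum power2_diff)
  moreover have "((norm u + norm v)\<^sup>2) powr (p / 2) = (norm u + norm v) powr p"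
    "(\<bar>norm u - norm v\<bar>\<^sup>2) powr (p / 2) = \<bar>norm u - norm v\<bar> powr p"
    using norm_powr_as_square[of "norm u + norm v" p] norm_powr_as_square[of "norm u - norm v" p] by auto
  ultimately show ?thesis
    using two_point_scalar_lower[OF p, of "norm u" "norm v"]
      norm_powr_as_square[of "u + v" p] norm_powr_as_square[of "u - v" p] sq by simp
qed

text \<open>Now \<open>p / 2\<close> is at least 1, so the left side is convex in the inner product
  and greatest for parallel vectors.\<close>

lemma norm_two_point_upper:
  fixes u v :: "'h::real_inner"
  assumes p: "2 \<le> p"
  shows "norm (u + v) powr p + norm (u - v) powr p
    \<le> 2 * ((norm u)\<^sup>2 + (2 powr p + p) * (norm v)\<^sup>2) powr (p / 2)"
proof -
  define a b B where "a = (norm u)\<^sup>2 + (norm v)\<^sup>2" and "b = 2 * (u \<bullet> v)" and "B = 2 * (norm u * norm v)"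
  have sq: "(norm (u + v))\<^sup>2 = a + b" "(norm (u - v))\<^sup>2 = a - b"
    by (simp_all add: a_def b_def power2_norm_eq_inner inner_commute algebra_simps)
  have "\<bar>b\<bar> \<le> B"
    using Cauchy_Schwarz_ineq2[of u v] by (simp add: b_def B_def abs_mult)
  moreover have "B \<le> a"
    using sum_squares_bound[of "norm u" "norm v"] by (simp add: a_def B_def)
  ultimately have "(a + b) powr (p / 2) + (a - b) powr (p / 2) \<le> (a + B) powr (p / 2) + (a - B) powr (p / 2)"
    using p by (intro two_point_powr_convex) auto
  moreover have "a + B = (norm u + norm v)\<^sup>2" "a - B = \<bar>norm u - norm v\<bar>\<^sup>2"
    by (simp_all add: a_def B_def power2_sum power2_diff)
  moreover have "((norm u + norm v)\<^sup>2) powr (p / 2) = (norm u + norm v) powr p"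
    "(\<bar>norm u - norm v\<bar>\<^sup>2) powr (p / 2) = \<bar>norm u - norm v\<bar> powr p"
    using norm_powr_as_square[of "norm u + norm v" p] norm_powr_as_square[of "norm u - norm v" p] by auto
  ultimately show ?thesis
    using two_point_scalar_upper[OF p, of "norm u" "norm v"]
      norm_powr_as_square[of "u + v" p] norm_powr_as_square[of "u - v" p] sq by simp
qed

lemma norm_two_point_sum:
  fixes u v :: "'h::real_inner"
  shows "(norm (u + v))\<^sup>2 + (norm (u - v))\<^sup>2 = 2 * ((norm u)\<^sup>2 + (norm v)\<^sup>2)"
  by (simp add: power2_norm_eq_inner inner_commute algebra_simps)

text \<open>Superadditivity of the power \<open>p / 2\<close>, the parallelogram law and Jensen's
  inequality. Both inequalities reverse for p at most 2, which gives the next lemma.\<close>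

lemma norm_clarkson_lower:
  fixes u v :: "'h::real_inner"
  assumes p: "2 \<le> p"
  shows "2 * (norm u powr p + norm v powr p) \<le> norm (u + v) powr p + norm (u - v) powr p"
proof -
  have "norm u powr p + norm v powr p \<le> ((norm u)\<^sup>2 + (norm v)\<^sup>2) powr (p / 2)"
    unfolding norm_powr_as_square[of u p] norm_powr_as_square[of v p]
    using p by (intro powr_superadditive) auto
  also have "(norm u)\<^sup>2 + (norm v)\<^sup>2 = (1/2) * (norm (u + v))\<^sup>2 + (1/2) * (norm (u - v))\<^sup>2"
    using norm_two_point_sum[of u v] by simp
  also have "\<dots> powr (p / 2) \<le> (1/2) * ((norm (u + v))\<^sup>2) powr (p / 2) + (1/2) * ((norm (u - v))\<^sup>2) powr (p / 2)"
    using p by (intro powr_convex_comb) auto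
  finally show ?thesis
    unfolding norm_powr_as_square[of "u + v" p] norm_powr_as_square[of "u - v" p] by simp
qed

lemma norm_clarkson_upper:
  fixes u v :: "'h::real_inner"
  assumes p: "0 < p" "p \<le> 2"
  shows "norm (u + v) powr p + norm (u - v) powr p \<le> 2 * (norm u powr p + norm v powr p)"
proof -
  have "(1/2) * ((norm (u + v))\<^sup>2) powr (p / 2) + (1/2) * ((norm (u - v))\<^sup>2) powr (p / 2)
      \<le> ((1/2) * (norm (u + v))\<^sup>2 + (1/2) * (norm (u - v))\<^sup>2) powr (p / 2)"
    using p by (intro powr_concave_comb) auto
  also have "(1/2) * (norm (u + v))\<^sup>2 + (1/2) * (norm (u - v))\<^sup>2 = (norm u)\<^sup>2 + (norm v)\<^sup>2"
    using norm_two_point_sum[of u v] by simp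
  also have "\<dots> powr (p / 2) \<le> norm u powr p + norm v powr p"
    unfolding norm_powr_as_square[of u p] norm_powr_as_square[of v p]
    using p by (intro powr_subadditive) auto
  finally show ?thesis
    unfolding norm_powr_as_square[of "u + v" p] norm_powr_as_square[of "u - v" p] by simp
qed

section \<open>The spaces \<open>L\<^sup>p\<close>\<close>

lemma Lp_spaceI:
  "f \<in> borel_measurable M \<Longrightarrow> integrable M (\<lambda>\<omega>. norm (f \<omega>) powr p) \<Longrightarrow> f \<in> Lp_space M p"
  by (simp add: Lp_space_def)

lemma Lp_space_measurable [measurable_dest]: "f \<in> Lp_space M p \<Longrightarrow> f \<in> borel_measurable M"
  by (simp add: Lp_space_def)

lemma Lp_space_integrable: "f \<in> Lp_space M p \<Longrightarrow> integrable M (\<lambda>\<omega>. norm (f \<omega>) powr p)"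
  by (simp add: Lp_space_def)

lemma Lp_norm_nonneg [simp]: "0 \<le> Lp_norm M p f"
  by (simp add: Lp_norm_def)

lemma powr_le_powr_iff:
  fixes x y p :: real
  assumes "p > 0" "x \<ge> 0" "y \<ge> 0"
  shows "x powr p \<le> y powr p \<longleftrightarrow> x \<le> y"
  using powr_mono2[of p x y] powr_less_mono2[of p y x] assms by linarith

lemma Lp_norm_powr:
  assumes "p > 0"
  shows "Lp_norm M p f powr p = (\<integral>\<omega>. norm (f \<omega>) powr p \<partial>M)"
proof -
  have "0 \<le> (\<integral>\<omega>. norm (f \<omega>) powr p \<partial>M)"
    by (rule Bochner_Integration.integral_nonneg) simp
  then show ?thesis
    using assms by (simp add: Lp_norm_def powr_powr)
qed

lemma Lp_norm_le_iff:
  assumes "p > 0" "C \<ge> 0"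
  shows "Lp_norm M p f \<le> C \<longleftrightarrow> (\<integral>\<omega>. norm (f \<omega>) powr p \<partial>M) \<le> C powr p"
  using assms powr_le_powr_iff[of p "Lp_norm M p f" C]
  by (simp flip: Lp_norm_powr)

lemma Lp_norm_cong_AE:
  assumes "f \<in> borel_measurable M" "g \<in> borel_measurable M" "AE \<omega> in M. norm (f \<omega>) = norm (g \<omega>)"
  shows "Lp_norm M p f = Lp_norm M p g"
  unfolding Lp_norm_def
proof (intro arg_cong2[where f = "(powr)"] integral_cong_AE)
  show "AE \<omega> in M. norm (f \<omega>) powr p = norm (g \<omega>) powr p"
    using assms(3) by eventually_elim simp
qed (use assms(1,2) in measurable)

lemma Lp_norm_cong:
  assumes "\<And>\<omega>. \<omega> \<in> space M \<Longrightarrow> norm (f \<omega>) = norm (g \<omega>)"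
  shows "Lp_norm M p f = Lp_norm M p g"
  unfolding Lp_norm_def using assms by (intro arg_cong2[where f = "(powr)"] Bochner_Integration.integral_cong) auto

lemma Lp_norm_zero [simp]: "Lp_norm M p (\<lambda>_. 0) = 0"
  by (simp add: Lp_norm_def)

lemma Lp_space_zero [simp]: "(\<lambda>_. 0) \<in> Lp_space M p"
  by (simp add: Lp_space_def)

lemma Lp_space_norm: "f \<in> Lp_space M p \<Longrightarrow> (\<lambda>\<omega>. norm (f \<omega>)) \<in> Lp_space M p"
  by (auto simp: Lp_space_def intro: borel_measurable_norm)

lemma Lp_norm_norm: "Lp_norm M p (\<lambda>\<omega>. norm (f \<omega>)) = Lp_norm M p f"
  by (simp add: Lp_norm_def)

text \<open>Minkowski's inequality. For a and b beyond the two norms, convexity with weights a / (a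
  + b) and b / (a + b) applies to f / a and g / b; strictness keeps the denominators positive even
  for null functions. A function h that is merely dominated covers sums and differences at
  once.\<close>

lemma Lp_triangle:
  assumes p: "p \<ge> 1" and f: "f \<in> Lp_space M p" and g: "g \<in> Lp_space M p"
    and h: "h \<in> borel_measurable M" "AE \<omega> in M. norm (h \<omega>) \<le> norm (f \<omega>) + norm (g \<omega>)"
  shows "h \<in> Lp_space M p" "Lp_norm M p h \<le> Lp_norm M p f + Lp_norm M p g"
proof -
  note [measurable] = Lp_space_measurable[OF f] Lp_space_measurable[OF g] h(1)
  have *: "integrable M (\<lambda>\<omega>. norm (h \<omega>) powr p) \<and> Lp_norm M p h \<le> a + b"
    if a: "a > Lp_norm M p f" and b: "b > Lp_norm M p g" for a b
  proof -
    have ab: "a > 0" "b > 0"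
      using a b Lp_norm_nonneg[of M p f] Lp_norm_nonneg[of M p g] by linarith+
    define R where "R = (\<lambda>\<omega>. (a + b) powr p * (a / (a + b) * (norm (f \<omega>) powr p / a powr p)
        + b / (a + b) * (norm (g \<omega>) powr p / b powr p)))"
    have R: "integrable M R"
      unfolding R_def using f g by (intro integrable_mult_right integrable_divide Bochner_Integration.integrable_add Lp_space_integrable)
    have bound: "AE \<omega> in M. norm (h \<omega>) powr p \<le> R \<omega>"
      using h(2)
    proof eventually_elim
      case (elim \<omega>)
      have "norm (h \<omega>) powr p \<le> (norm (f \<omega>) + norm (g \<omega>)) powr p"
        using elim p by (intro powr_mono2) auto
      also have "norm (f \<omega>) + norm (g \<omega>) = (a + b) * (a / (a + b) * (norm (f \<omega>) / a) + b / (a + b) * (norm (g \<omega>) / b))"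
        using ab by (simp flip: add_divide_distrib)
      also have "\<dots> powr p = (a + b) powr p * (a / (a + b) * (norm (f \<omega>) / a) + b / (a + b) * (norm (g \<omega>) / b)) powr p"
        by (simp only: powr_mult)
      also have "\<dots> \<le> (a + b) powr p * (a / (a + b) * (norm (f \<omega>) / a) powr p + b / (a + b) * (norm (g \<omega>) / b) powr p)"
        using ab p by (intro mult_left_mono powr_convex_comb) (auto simp flip: add_divide_distrib)
      also have "\<dots> = R \<omega>"
        using ab by (simp add: R_def powr_divide)
      finally show ?case .
    qed
    have int: "integrable M (\<lambda>\<omega>. norm (h \<omega>) powr p)"
    proof (rule Bochner_Integration.integrable_bound[OF R])
      show "AE \<omega> in M. norm (norm (h \<omega>) powr p) \<le> norm (R \<omega>)"
        using bound by eventually_elim simp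
    qed measurable
    have "(\<integral>\<omega>. norm (h \<omega>) powr p \<partial>M) \<le> (\<integral>\<omega>. R \<omega> \<partial>M)"
      using int R bound by (rule integral_mono_AE)
    also have "\<dots> = (a + b) powr p * (a / (a + b) * ((\<integral>\<omega>. norm (f \<omega>) powr p \<partial>M) / a powr p)
        + b / (a + b) * ((\<integral>\<omega>. norm (g \<omega>) powr p \<partial>M) / b powr p))"
      unfolding R_def using Lp_space_integrable[OF f] Lp_space_integrable[OF g] by simp
    also have "\<dots> \<le> (a + b) powr p * (a / (a + b) * 1 + b / (a + b) * 1)"
      using a b ab p Lp_norm_le_iff[of p a M f] Lp_norm_le_iff[of p b M g]
      by (intro mult_left_mono add_mono) auto
    also have "\<dots> = (a + b) powr p"
      using ab by (simp flip: add_divide_distrib)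
    finally show ?thesis
      using int ab p by (simp add: Lp_norm_le_iff)
  qed
  show "h \<in> Lp_space M p"
    using *[of "Lp_norm M p f + 1" "Lp_norm M p g + 1"] h(1) by (intro Lp_spaceI) auto
  show "Lp_norm M p h \<le> Lp_norm M p f + Lp_norm M p g"
  proof (rule field_le_epsilon)
    fix e :: real assume "e > 0"
    then show "Lp_norm M p h \<le> Lp_norm M p f + Lp_norm M p g + e"
      using *[of "Lp_norm M p f + e / 2" "Lp_norm M p g + e / 2"] by simp
  qed
qed

section \<open>Linear structure of the spaces\<close>

lemma Lp_space_add:
  fixes f g :: "'a \<Rightarrow> 'b::{banach, second_countable_topology}"
  assumes p: "p \<ge> 1" and f: "f \<in> Lp_space M p" and g: "g \<in> Lp_space M p"
  shows "(\<lambda>\<omega>. f \<omega> + g \<omega>) \<in> Lp_space M p"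
    "Lp_norm M p (\<lambda>\<omega>. f \<omega> + g \<omega>) \<le> Lp_norm M p f + Lp_norm M p g"
  using Lp_triangle[OF p f g, of "\<lambda>\<omega>. f \<omega> + g \<omega>"] f g by (auto simp: norm_triangle_ineq)

lemma Lp_space_diff:
  fixes f g :: "'a \<Rightarrow> 'b::{banach, second_countable_topology}"
  assumes p: "p \<ge> 1" and f: "f \<in> Lp_space M p" and g: "g \<in> Lp_space M p"
  shows "(\<lambda>\<omega>. f \<omega> - g \<omega>) \<in> Lp_space M p"
    "Lp_norm M p (\<lambda>\<omega>. f \<omega> - g \<omega>) \<le> Lp_norm M p f + Lp_norm M p g"
  using Lp_triangle[OF p f g, of "\<lambda>\<omega>. f \<omega> - g \<omega>"] f g by (auto simp: norm_triangle_ineq4)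

lemma Lp_norm_diff_triangle:
  fixes f g h :: "'a \<Rightarrow> 'b::{banach, second_countable_topology}"
  assumes p: "p \<ge> 1" and f: "f \<in> Lp_space M p" and g: "g \<in> Lp_space M p" and h: "h \<in> Lp_space M p"
  shows "Lp_norm M p (\<lambda>\<omega>. f \<omega> - h \<omega>)
    \<le> Lp_norm M p (\<lambda>\<omega>. f \<omega> - g \<omega>) + Lp_norm M p (\<lambda>\<omega>. g \<omega> - h \<omega>)"
  using Lp_space_add(2)[OF p Lp_space_diff(1)[OF p f g] Lp_space_diff(1)[OF p g h]] by simp

lemma Lp_norm_diff_commute:
  "Lp_norm M p (\<lambda>\<omega>. f \<omega> - g \<omega>) = Lp_norm M p (\<lambda>\<omega>. g \<omega> - f \<omega>)"
  by (rule Lp_norm_cong) (rule norm_minus_commute)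

lemma Lp_norm_triangle_sub:
  fixes f g :: "'a \<Rightarrow> 'b::{banach, second_countable_topology}"
  assumes p: "p \<ge> 1" and f: "f \<in> Lp_space M p" and g: "g \<in> Lp_space M p"
  shows "Lp_norm M p f \<le> Lp_norm M p g + Lp_norm M p (\<lambda>\<omega>. f \<omega> - g \<omega>)"
  using Lp_space_add(2)[OF p g Lp_space_diff(1)[OF p f g]] by simp

lemma Lp_space_sum:
  fixes f :: "'i \<Rightarrow> 'a \<Rightarrow> 'b::{banach, second_countable_topology}"
  assumes p: "p \<ge> 1" and f: "\<And>i. i \<in> I \<Longrightarrow> f i \<in> Lp_space M p"
  shows "(\<lambda>\<omega>. \<Sum>i\<in>I. f i \<omega>) \<in> Lp_space M p"
    "Lp_norm M p (\<lambda>\<omega>. \<Sum>i\<in>I. f i \<omega>) \<le> (\<Sum>i\<in>I. Lp_norm M p (f i))"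
proof (atomize (full), insert f, induction I rule: infinite_finite_induct)
  case (insert x I)
  then show ?case
    using Lp_space_add[OF p, of "f x" M "\<lambda>\<omega>. \<Sum>i\<in>I. f i \<omega>"] by auto
qed auto

lemma Lp_space_scaleR:
  fixes f :: "'a \<Rightarrow> 'b::{banach, second_countable_topology}"
  assumes f: "f \<in> Lp_space M p"
  shows "(\<lambda>\<omega>. c *\<^sub>R f \<omega>) \<in> Lp_space M p"
  using f by (auto simp: Lp_space_def powr_mult)

lemma Lp_norm_scaleR:
  assumes "p > 0"
  shows "Lp_norm M p (\<lambda>\<omega>. c *\<^sub>R f \<omega>) = \<bar>c\<bar> * Lp_norm M p f"
  using assms by (simp add: Lp_norm_def powr_mult powr_powr)

text \<open>Fatou's lemma is used for the extended nonnegative integral, since integrability of the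
  limit is part of the claim.\<close>

lemma Lp_Fatou:
  fixes f :: "nat \<Rightarrow> 'a \<Rightarrow> 'b::real_normed_vector"
  assumes p: "p > 0" and f: "\<And>n. f n \<in> Lp_space M p" and g [measurable]: "g \<in> borel_measurable M"
    and lim: "AE \<omega> in M. (\<lambda>n. f n \<omega>) \<longlonglongrightarrow> g \<omega>"
    and C: "C \<ge> 0" "eventually (\<lambda>n. Lp_norm M p (f n) \<le> C) sequentially"
  shows "g \<in> Lp_space M p" "Lp_norm M p g \<le> C"
proof -
  note [measurable] = Lp_space_measurable[OF f]
  have "(\<integral>\<^sup>+\<omega>. ennreal (norm (g \<omega>) powr p) \<partial>M) = (\<integral>\<^sup>+\<omega>. liminf (\<lambda>n. ennreal (norm (f n \<omega>) powr p)) \<partial>M)"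
  proof (rule nn_integral_cong_AE, use lim in eventually_elim)
    case (elim \<omega>)
    then have "(\<lambda>n. ennreal (norm (f n \<omega>) powr p)) \<longlonglongrightarrow> ennreal (norm (g \<omega>) powr p)"
      using p by (intro tendsto_ennrealI tendsto_powr' tendsto_norm tendsto_const) auto
    then show ?case
      by (rule lim_imp_Liminf[OF trivial_limit_sequentially, symmetric])
  qed
  also have "\<dots> \<le> liminf (\<lambda>n. \<integral>\<^sup>+\<omega>. ennreal (norm (f n \<omega>) powr p) \<partial>M)"
    by (rule nn_integral_liminf) measurable
  also have "\<dots> \<le> ennreal (C powr p)"
  proof (rule Liminf_le)
    show "eventually (\<lambda>n. (\<integral>\<^sup>+\<omega>. ennreal (norm (f n \<omega>) powr p) \<partial>M) \<le> ennreal (C powr p)) sequentially"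
      using C(2)
    proof eventually_elim
      case (elim n)
      then show ?case
        using p C(1) Lp_space_integrable[OF f]
        by (subst nn_integral_eq_integral) (auto simp: Lp_norm_le_iff)
    qed
  qed simp
  finally have le: "(\<integral>\<^sup>+\<omega>. ennreal (norm (g \<omega>) powr p) \<partial>M) \<le> ennreal (C powr p)" .
  then have int: "integrable M (\<lambda>\<omega>. norm (g \<omega>) powr p)"
    by (intro integrableI_bounded) (auto simp: le_less_trans)
  then show "g \<in> Lp_space M p"
    by (intro Lp_spaceI) auto
  show "Lp_norm M p g \<le> C"
    using le int p C(1) by (subst (asm) nn_integral_eq_integral) (auto simp: Lp_norm_le_iff)
qed

text \<open>Minkowski's inequality turns around for exponents up to 1 and nonnegative functions,
  because the power is then concave. It is needed for the exponent \<open>p / 2\<close> and squared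
  norms.\<close>

lemma Lp_norm_reverse_triangle:
  fixes f g :: "'a \<Rightarrow> real"
  assumes r: "0 < r" "r \<le> 1" and f: "f \<in> Lp_space M r" and g: "g \<in> Lp_space M r"
    and nonneg: "\<And>\<omega>. 0 \<le> f \<omega>" "\<And>\<omega>. 0 \<le> g \<omega>"
  shows "(\<lambda>\<omega>. f \<omega> + g \<omega>) \<in> Lp_space M r"
    "Lp_norm M r f + Lp_norm M r g \<le> Lp_norm M r (\<lambda>\<omega>. f \<omega> + g \<omega>)"
proof -
  note [measurable] = Lp_space_measurable[OF f] Lp_space_measurable[OF g]
  have int: "integrable M (\<lambda>\<omega>. f \<omega> powr r)" "integrable M (\<lambda>\<omega>. g \<omega> powr r)"
    using Lp_space_integrable[OF f] Lp_space_integrable[OF g] nonneg by simp_all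
  have int2: "integrable M (\<lambda>\<omega>. (f \<omega> + g \<omega>) powr r)"
    using Bochner_Integration.integrable_add[OF int]
    by (rule Bochner_Integration.integrable_bound) (use r nonneg in \<open>auto simp: powr_subadditive\<close>)
  then show "(\<lambda>\<omega>. f \<omega> + g \<omega>) \<in> Lp_space M r"
    using nonneg by (intro Lp_spaceI) auto
  have mono: "Lp_norm M r f \<le> Lp_norm M r (\<lambda>\<omega>. f \<omega> + g \<omega>)" "Lp_norm M r g \<le> Lp_norm M r (\<lambda>\<omega>. f \<omega> + g \<omega>)"
    unfolding Lp_norm_def using int int2 r nonneg
    by (intro powr_mono2 integral_mono Bochner_Integration.integral_nonneg; simp)+
  define a b where "a = Lp_norm M r f" and "b = Lp_norm M r g"
  \<comment> \<open>If one of the norms is 0, normalisation is impossible, but monotonicity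
    suffices.\<close>
  consider "a = 0 \<or> b = 0" | "a > 0" "b > 0"
    using Lp_norm_nonneg[of M r f] Lp_norm_nonneg[of M r g] unfolding a_def b_def by linarith
  then show "Lp_norm M r f + Lp_norm M r g \<le> Lp_norm M r (\<lambda>\<omega>. f \<omega> + g \<omega>)"
  proof cases
    case 1
    then show ?thesis
      using mono by (auto simp: a_def b_def)
  next
    case ab: 2
    define R where "R = (\<lambda>\<omega>. (a + b) powr r * (a / (a + b) * (f \<omega> powr r / a powr r)
        + b / (a + b) * (g \<omega> powr r / b powr r)))"
    have R: "integrable M R"
      unfolding R_def using int by (intro integrable_mult_right integrable_divide Bochner_Integration.integrable_add)
    have bound: "R \<omega> \<le> (f \<omega> + g \<omega>) powr r" for \<omega>
    proof -
      have "R \<omega> = (a + b) powr r * (a / (a + b) * (f \<omega> / a) powr r + b / (a + b) * (g \<omega> / b) powr r)"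
        using ab nonneg by (simp add: R_def powr_divide)
      also have "\<dots> \<le> (a + b) powr r * (a / (a + b) * (f \<omega> / a) + b / (a + b) * (g \<omega> / b)) powr r"
        using ab r nonneg by (intro mult_left_mono powr_concave_comb) (auto simp flip: add_divide_distrib)
      also have "\<dots> = ((a + b) * (a / (a + b) * (f \<omega> / a) + b / (a + b) * (g \<omega> / b))) powr r"
        by (simp only: powr_mult)
      also have "(a + b) * (a / (a + b) * (f \<omega> / a) + b / (a + b) * (g \<omega> / b)) = f \<omega> + g \<omega>"
        using ab by (simp flip: add_divide_distrib)
      finally show ?thesis .
    qed
    have "(a + b) powr r = (a + b) powr r * (a / (a + b) * 1 + b / (a + b) * 1)"
      using ab by (simp flip: add_divide_distrib)
    also have "\<dots> = (a + b) powr r * (a / (a + b) * ((\<integral>\<omega>. f \<omega> powr r \<partial>M) / a powr r)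
        + b / (a + b) * ((\<integral>\<omega>. g \<omega> powr r \<partial>M) / b powr r))"
    proof -
      have "(\<integral>\<omega>. f \<omega> powr r \<partial>M) = a powr r" "(\<integral>\<omega>. g \<omega> powr r \<partial>M) = b powr r"
        using r Lp_norm_powr[of r M f] Lp_norm_powr[of r M g] nonneg by (simp_all add: a_def b_def)
      then show ?thesis
        using ab by simp
    qed
    also have "\<dots> = (\<integral>\<omega>. R \<omega> \<partial>M)"
      unfolding R_def using int by simp
    also have "\<dots> \<le> (\<integral>\<omega>. (f \<omega> + g \<omega>) powr r \<partial>M)"
      using R int2 bound by (intro integral_mono) auto
    also have "\<dots> = Lp_norm M r (\<lambda>\<omega>. f \<omega> + g \<omega>) powr r"
      using r nonneg by (subst Lp_norm_powr) auto
    finally show ?thesis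
      using r ab powr_le_powr_iff[of r "a + b" "Lp_norm M r (\<lambda>\<omega>. f \<omega> + g \<omega>)"]
      by (simp add: a_def b_def)
  qed
qed

text \<open>The tangent to the p-th power at c bounds \<open>norm (f \<omega>)\<close> by an affine
  function of \<open>norm (f \<omega>) powr p\<close>. As the total mass is 1, the integral of that
  function is at most c once c exceeds the norm.\<close>

lemma (in prob_space) Lp_imp_L1:
  fixes f :: "'a \<Rightarrow> 'b::{banach, second_countable_topology}"
  assumes p: "p \<ge> 1" and f: "f \<in> Lp_space M p"
  shows "integrable M f" "(\<integral>\<omega>. norm (f \<omega>) \<partial>M) \<le> Lp_norm M p f"
proof -
  note [measurable] = Lp_space_measurable[OF f]
  have *: "integrable M (\<lambda>\<omega>. norm (f \<omega>)) \<and> (\<integral>\<omega>. norm (f \<omega>) \<partial>M) \<le> c" if c: "c > Lp_norm M p f" for c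
  proof -
    have c0: "c > 0"
      using c Lp_norm_nonneg[of M p f] by linarith
    define R where "R = (\<lambda>\<omega>. c * (1 + (norm (f \<omega>) powr p / c powr p - 1) / p))"
    have R: "integrable M R"
      unfolding R_def using Lp_space_integrable[OF f]
      by (intro integrable_mult_right Bochner_Integration.integrable_add integrable_divide
          Bochner_Integration.integrable_diff integrable_const)
    have bound: "norm (f \<omega>) \<le> R \<omega>" for \<omega>
    proof -
      have "1 + p * (norm (f \<omega>) / c - 1) \<le> (norm (f \<omega>) / c) powr p"
        using p c0 by (intro powr_ge_tangent) auto
      then have "norm (f \<omega>) / c \<le> 1 + (norm (f \<omega>) powr p / c powr p - 1) / p"
        using p c0 by (simp add: powr_divide field_simps)
      then show ?thesis
        using c0 by (simp add: R_def pos_divide_le_eq mult.commute)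
    qed
    have int: "integrable M (\<lambda>\<omega>. norm (f \<omega>))"
    proof (rule Bochner_Integration.integrable_bound[OF R])
      show "AE \<omega> in M. norm (norm (f \<omega>)) \<le> norm (R \<omega>)"
        using order_trans[OF bound abs_ge_self] by simp
    qed measurable
    have "(\<integral>\<omega>. norm (f \<omega>) \<partial>M) \<le> (\<integral>\<omega>. R \<omega> \<partial>M)"
      using int R bound by (intro integral_mono) auto
    also have "\<dots> = c * (1 + ((\<integral>\<omega>. norm (f \<omega>) powr p \<partial>M) / c powr p - 1) / p)"
      unfolding R_def using Lp_space_integrable[OF f] by (simp add: prob_space)
    also have "\<dots> \<le> c * (1 + 0)"
      using c c0 p Lp_norm_le_iff[of p c M f]
      by (intro mult_left_mono add_left_mono) (auto intro!: divide_nonpos_pos)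
    finally show ?thesis
      using int by simp
  qed
  show "integrable M f"
    using *[of "Lp_norm M p f + 1"] by (simp add: integrable_norm_iff)
  show "(\<integral>\<omega>. norm (f \<omega>) \<partial>M) \<le> Lp_norm M p f"
    by (rule field_le_epsilon) (use * in auto)
qed

text \<open>The Riesz-Fischer argument: along a fast subsequence the increments are summable in
  \<open>L\<^sup>1\<close>, hence almost surely, and Fatou's lemma turns the pointwise limit into a
  limit in norm.\<close>

lemma (in prob_space) Lp_complete:
  fixes f :: "nat \<Rightarrow> 'a \<Rightarrow> 'b::{banach, second_countable_topology}"
  assumes p: "p \<ge> 1" and f: "\<And>n. f n \<in> Lp_space M p"
    and Cauchy: "\<And>e. e > 0 \<Longrightarrow> \<exists>N. \<forall>m\<ge>N. \<forall>n\<ge>N. Lp_norm M p (\<lambda>\<omega>. f m \<omega> - f n \<omega>) < e"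
  shows "\<exists>g\<in>Lp_space M p. (\<lambda>n. Lp_norm M p (\<lambda>\<omega>. f n \<omega> - g \<omega>)) \<longlonglongrightarrow> 0"
proof -
  note [measurable] = Lp_space_measurable[OF f]
  have "\<exists>N. \<forall>k. \<forall>m\<ge>N k. \<forall>n\<ge>N k. Lp_norm M p (\<lambda>\<omega>. f m \<omega> - f n \<omega>) < (1/2)^k"
    by (rule choice) (use Cauchy in auto)
  then obtain N where N: "\<And>k m n. m \<ge> N k \<Longrightarrow> n \<ge> N k \<Longrightarrow> Lp_norm M p (\<lambda>\<omega>. f m \<omega> - f n \<omega>) < (1/2)^k"
    by blast
  \<comment> \<open>The thresholds N need not increase with k. Adding them up makes r nondecreasing
    and unbounded, with \<open>r k \<ge> N k\<close>.\<close>
  define r where "r = (\<lambda>k. k + (\<Sum>i\<le>k. N i))"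
  have r: "r k \<ge> N k" "r k \<ge> k" "r (Suc k) \<ge> r k" for k
    using member_le_sum[of k "{..k}" N] by (auto simp: r_def)
  define d where "d = (\<lambda>k \<omega>. f (r (Suc k)) \<omega> - f (r k) \<omega>)"
  have d: "d k \<in> Lp_space M p" for k
    unfolding d_def by (intro Lp_space_diff(1) p f)
  have d_le: "(\<integral>\<omega>. norm (d k \<omega>) \<partial>M) \<le> (1/2)^k" for k
    using Lp_imp_L1(2)[OF p d, of k] N[of k "r (Suc k)" "r k"] r(1)[of k] r(3)[of k]
    unfolding d_def by linarith
  have "AE \<omega> in M. summable (\<lambda>k. norm (d k \<omega>))"
  proof -
    have [measurable]: "d k \<in> borel_measurable M" for k
      using d by (rule Lp_space_measurable)
    have "(\<integral>\<^sup>+\<omega>. (\<Sum>k. ennreal (norm (d k \<omega>))) \<partial>M) = (\<Sum>k. \<integral>\<^sup>+\<omega>. ennreal (norm (d k \<omega>)) \<partial>M)"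
      by (rule nn_integral_suminf) measurable
    also have "\<dots> = (\<Sum>k. ennreal (\<integral>\<omega>. norm (d k \<omega>) \<partial>M))"
      using Lp_imp_L1(1)[OF p d] by (intro suminf_cong nn_integral_eq_integral) auto
    also have "\<dots> \<le> (\<Sum>k. ennreal ((1/2)^k))"
      by (intro suminf_le ennreal_leI d_le) auto
    also have "\<dots> = ennreal (\<Sum>k. (1/2)^k)"
      by (rule suminf_ennreal2) (auto intro: summable_geometric)
    finally have "(\<integral>\<^sup>+\<omega>. (\<Sum>k. ennreal (norm (d k \<omega>))) \<partial>M) \<noteq> \<infinity>"
      by (auto simp: top_unique)
    then have "AE \<omega> in M. (\<Sum>k. ennreal (norm (d k \<omega>))) \<noteq> \<infinity>"
      by (intro nn_integral_noteq_infinite) auto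
    then show ?thesis
      by eventually_elim (auto intro!: summable_suminf_not_top)
  qed
  then have conv: "AE \<omega> in M. convergent (\<lambda>k. f (r k) \<omega>)"
  proof eventually_elim
    case (elim \<omega>)
    then have "convergent (\<lambda>n. \<Sum>k<n. d k \<omega>)"
      using summable_norm_cancel[OF elim] by (simp add: summable_iff_convergent)
    moreover have "(\<Sum>k<n. d k \<omega>) = f (r n) \<omega> - f (r 0) \<omega>" for n
      unfolding d_def by (rule sum_lessThan_telescope)
    ultimately have "convergent (\<lambda>n. (f (r n) \<omega> - f (r 0) \<omega>) + f (r 0) \<omega>)"
      using convergent_add[of "\<lambda>n. f (r n) \<omega> - f (r 0) \<omega>", OF _ convergent_const[of "f (r 0) \<omega>"]] by simp
    then show ?case
      by simp
  qed
  define g where "g = (\<lambda>\<omega>. lim (\<lambda>k. f (r k) \<omega>))"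
  have [measurable]: "g \<in> borel_measurable M"
    unfolding g_def by measurable
  have lim: "AE \<omega> in M. (\<lambda>k. f (r k) \<omega>) \<longlonglongrightarrow> g \<omega>"
    using conv unfolding g_def convergent_LIMSEQ_iff .
  \<comment> \<open>Fatou's lemma in j for fixed n; that the difference lies in the space is what
    later gives membership of g.\<close>
  have close: "(\<lambda>\<omega>. f n \<omega> - g \<omega>) \<in> Lp_space M p \<and> Lp_norm M p (\<lambda>\<omega>. f n \<omega> - g \<omega>) \<le> (1/2)^k"
    if n: "n \<ge> N k" for n k
  proof -
    have 1: "(\<lambda>\<omega>. f n \<omega> - f (r j) \<omega>) \<in> Lp_space M p" for j
      by (intro Lp_space_diff(1) p f)
    have 2: "AE \<omega> in M. (\<lambda>j. f n \<omega> - f (r j) \<omega>) \<longlonglongrightarrow> f n \<omega> - g \<omega>"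
      using lim by eventually_elim (intro tendsto_intros)
    have "r j \<ge> N k" if "j \<ge> N k" for j
      using that r(2)[of j] by linarith
    then have 3: "eventually (\<lambda>j. Lp_norm M p (\<lambda>\<omega>. f n \<omega> - f (r j) \<omega>) \<le> (1/2)^k) sequentially"
      using N[of k n] n unfolding eventually_sequentially by (intro exI[of _ "N k"]) (auto intro: less_imp_le)
    show ?thesis
      using Lp_Fatou[OF _ 1 _ 2 _ 3] p by auto
  qed
  have "(\<lambda>\<omega>. f (N 0) \<omega> - (f (N 0) \<omega> - g \<omega>)) \<in> Lp_space M p"
    using Lp_space_diff(1)[OF p f[of "N 0"]] close[of 0 "N 0"] by blast
  then have "g \<in> Lp_space M p"
    by simp
  moreover have "(\<lambda>n. Lp_norm M p (\<lambda>\<omega>. f n \<omega> - g \<omega>)) \<longlonglongrightarrow> 0"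
  proof (rule LIMSEQ_I)
    fix e :: real assume "e > 0"
    then obtain k where "(1/2)^k < e"
      using real_arch_pow_inv[of e "1/2"] by auto
    then show "\<exists>no. \<forall>n\<ge>no. norm (Lp_norm M p (\<lambda>\<omega>. f n \<omega> - g \<omega>) - 0) < e"
      using close[of k] by (intro exI[of _ "N k"]) (auto intro: le_less_trans)
  qed
  ultimately show ?thesis
    by blast
qed

lemma (in prob_space) Lp_norm_eq_0_imp_AE:
  fixes f :: "'a \<Rightarrow> 'b::{banach, second_countable_topology}"
  assumes p: "p \<ge> 1" and f: "f \<in> Lp_space M p" and "Lp_norm M p f \<le> 0"
  shows "AE \<omega> in M. f \<omega> = 0"
proof -
  have "(\<integral>\<omega>. norm (f \<omega>) \<partial>M) \<le> 0"
    using Lp_imp_L1(2)[OF p f] assms(3) by linarith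
  moreover have "0 \<le> (\<integral>\<omega>. norm (f \<omega>) \<partial>M)"
    by (rule Bochner_Integration.integral_nonneg) simp
  ultimately have "(\<integral>\<omega>. norm (f \<omega>) \<partial>M) = 0"
    by simp
  then have "AE \<omega> in M. norm (f \<omega>) = 0"
    using Lp_imp_L1(1)[OF p f] by (subst (asm) integral_nonneg_eq_0_iff_AE) auto
  then show ?thesis
    by simp
qed

text \<open>Closed balls contain their limits, so a bound for eventually all partial sums passes to
  the sum. The centre h will be zero, a partial sum, or another candidate for the limit.\<close>

lemma Lp_sums_norm_diff_le:
  fixes f :: "nat \<Rightarrow> 'a \<Rightarrow> 'b::{banach, second_countable_topology}"
  assumes p: "p \<ge> 1" and sums: "Lp_sums M p f g" and h: "h \<in> Lp_space M p"
    and bound: "eventually (\<lambda>J. Lp_norm M p (\<lambda>\<omega>. (\<Sum>i<J. f i \<omega>) - h \<omega>) \<le> C) sequentially"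
  shows "Lp_norm M p (\<lambda>\<omega>. g \<omega> - h \<omega>) \<le> C"
proof -
  have f: "\<And>n. f n \<in> Lp_space M p" and g: "g \<in> Lp_space M p"
    and lim: "(\<lambda>n. Lp_norm M p (\<lambda>\<omega>. (\<Sum>i<n. f i \<omega>) - g \<omega>)) \<longlonglongrightarrow> 0"
    using sums by (auto simp: Lp_sums_def)
  have "eventually (\<lambda>J. Lp_norm M p (\<lambda>\<omega>. g \<omega> - h \<omega>) \<le> Lp_norm M p (\<lambda>\<omega>. (\<Sum>i<J. f i \<omega>) - g \<omega>) + C) sequentially"
    using bound
  proof eventually_elim
    case (elim J)
    then show ?case
      using Lp_norm_diff_triangle[OF p g Lp_space_sum(1)[where f = f, OF p f, where I = "{..<J}"] h]
      by (simp add: Lp_norm_diff_commute[of M p g])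
  qed
  then have "Lp_norm M p (\<lambda>\<omega>. g \<omega> - h \<omega>) \<le> 0 + C"
    by (intro tendsto_lowerbound[OF tendsto_add[OF lim tendsto_const]]) auto
  then show ?thesis
    by simp
qed

lemma (in prob_space) Lp_summable_norm:
  fixes f :: "nat \<Rightarrow> 'a \<Rightarrow> 'b::{banach, second_countable_topology}"
  assumes p: "p \<ge> 1" and f: "\<And>n. f n \<in> Lp_space M p" and sum: "summable (\<lambda>n. Lp_norm M p (f n))"
  shows "Lp_summable M p f"
proof -
  have S: "(\<lambda>\<omega>. \<Sum>i<n. f i \<omega>) \<in> Lp_space M p" for n
    by (intro Lp_space_sum(1) p f)
  have "\<exists>N. \<forall>m\<ge>N. \<forall>n\<ge>N. Lp_norm M p (\<lambda>\<omega>. (\<Sum>i<m. f i \<omega>) - (\<Sum>i<n. f i \<omega>)) < e" if e: "e > 0" for e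
  proof -
    from sum e have "\<exists>N. \<forall>m\<ge>N. \<forall>n. norm (\<Sum>i\<in>{m..<n}. Lp_norm M p (f i)) < e"
      unfolding summable_Cauchy by (elim allE[of _ e]) simp
    then obtain N where N: "\<forall>m\<ge>N. \<forall>n. norm (\<Sum>i\<in>{m..<n}. Lp_norm M p (f i)) < e" ..
    have *: "Lp_norm M p (\<lambda>\<omega>. (\<Sum>i<n. f i \<omega>) - (\<Sum>i<m. f i \<omega>)) < e" if "N \<le> m" "m \<le> n" for m n
    proof -
      have "(\<Sum>i<n. f i \<omega>) - (\<Sum>i<m. f i \<omega>) = (\<Sum>i\<in>{m..<n}. f i \<omega>)" for \<omega>
        using \<open>m \<le> n\<close> sum_diff_nat_ivl[of 0 m n "\<lambda>i. f i \<omega>"] by (simp add: lessThan_atLeast0)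
      then have "Lp_norm M p (\<lambda>\<omega>. (\<Sum>i<n. f i \<omega>) - (\<Sum>i<m. f i \<omega>)) \<le> (\<Sum>i\<in>{m..<n}. Lp_norm M p (f i))"
        using Lp_space_sum(2)[where f = f, OF p f, where I = "{m..<n}"] by simp
      then show ?thesis
        using N[rule_format, OF that(1), of n] by simp
    qed
    have "Lp_norm M p (\<lambda>\<omega>. (\<Sum>i<m. f i \<omega>) - (\<Sum>i<n. f i \<omega>)) < e" if "N \<le> m" "N \<le> n" for m n
    proof (cases "m \<le> n")
      case True
      then show ?thesis
        using *[OF that(1) True] by (subst Lp_norm_diff_commute)
    next
      case False
      then show ?thesis
        using *[of n m] that(2) by simp
    qed
    then show ?thesis
      by (intro exI[of _ N]) simp
  qed
  then obtain g where "g \<in> Lp_space M p" "(\<lambda>n. Lp_norm M p (\<lambda>\<omega>. (\<Sum>i<n. f i \<omega>) - g \<omega>)) \<longlonglongrightarrow> 0"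
    using Lp_complete[where f = "\<lambda>n \<omega>. \<Sum>i<n. f i \<omega>", OF p S] by blast
  then show ?thesis
    using f by (auto simp: Lp_summable_def Lp_sums_def)
qed

lemma Lp_sums_suminf: "Lp_summable M p f \<Longrightarrow> Lp_sums M p f (Lp_suminf M p f)"
  unfolding Lp_summable_def Lp_suminf_def by (erule someI_ex)

lemma Lp_sums_tail_le:
  fixes f :: "nat \<Rightarrow> 'a \<Rightarrow> 'b::{banach, second_countable_topology}"
  assumes p: "p \<ge> 1" and sums: "Lp_sums M p f g" and bound: "\<And>J. (\<Sum>i\<in>{N..<J}. Lp_norm M p (f i)) \<le> C"
  shows "Lp_norm M p (\<lambda>\<omega>. g \<omega> - (\<Sum>i<N. f i \<omega>)) \<le> C"
proof (rule Lp_sums_norm_diff_le[OF p sums])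
  have f: "f n \<in> Lp_space M p" for n
    using sums by (simp add: Lp_sums_def)
  show "(\<lambda>\<omega>. \<Sum>i<N. f i \<omega>) \<in> Lp_space M p"
    by (intro Lp_space_sum(1) p f)
  show "eventually (\<lambda>J. Lp_norm M p (\<lambda>\<omega>. (\<Sum>i<J. f i \<omega>) - (\<Sum>i<N. f i \<omega>)) \<le> C) sequentially"
    using eventually_ge_at_top[of N]
  proof eventually_elim
    case (elim J)
    have "(\<Sum>i<J. f i \<omega>) - (\<Sum>i<N. f i \<omega>) = (\<Sum>i\<in>{N..<J}. f i \<omega>)" for \<omega>
      using elim sum_diff_nat_ivl[of 0 N J "\<lambda>i. f i \<omega>"] by (simp add: lessThan_atLeast0)
    then show ?case
      using Lp_space_sum(2)[where f = f, OF p f, where I = "{N..<J}"] bound[of J] by simp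
  qed
qed

section \<open>Vector-valued conditional expectations\<close>

lemma has_cond_expD:
  assumes "has_cond_exp M F f g"
  shows "integrable M f" "integrable M g" "g \<in> borel_measurable F"
    "A \<in> sets F \<Longrightarrow> (\<integral>\<omega>. indicator A \<omega> *\<^sub>R g \<omega> \<partial>M) = (\<integral>\<omega>. indicator A \<omega> *\<^sub>R f \<omega> \<partial>M)"
  using assms by (auto simp: has_cond_exp_def set_lebesgue_integral_def)

lemma has_cond_expI:
  assumes "integrable M f" "integrable M g" "g \<in> borel_measurable F"
    "\<And>A. A \<in> sets F \<Longrightarrow> (\<integral>\<omega>. indicator A \<omega> *\<^sub>R g \<omega> \<partial>M) = (\<integral>\<omega>. indicator A \<omega> *\<^sub>R f \<omega> \<partial>M)"
  shows "has_cond_exp M F f g"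
  using assms by (auto simp: has_cond_exp_def set_lebesgue_integral_def)

lemma has_cond_exp_self:
  "integrable M f \<Longrightarrow> f \<in> borel_measurable F \<Longrightarrow> has_cond_exp M F f f"
  by (simp add: has_cond_exp_def)

lemma has_cond_exp_tower:
  assumes "sets F \<subseteq> sets G" "has_cond_exp M G f g" "has_cond_exp M F f h"
  shows "has_cond_exp M F g h"
  using assms by (auto simp: has_cond_exp_def)

section \<open>Linearity, contraction, uniqueness and existence for one sub-sigma-algebra\<close>

locale prob_subalgebra = prob_space +
  fixes F :: "'a measure"
  assumes subalg: "subalgebra M F"
begin

sublocale finite_measure_subalgebra M F
  using subalg by unfold_locales

lemma subalgebra_sets: "A \<in> sets F \<Longrightarrow> A \<in> sets M"
  using subalg by (auto simp: subalgebra_def)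

lemma integrable_indicator_scaleR:
  fixes f :: "'a \<Rightarrow> 'b::{banach, second_countable_topology}"
  assumes "A \<in> sets F" "integrable M f"
  shows "integrable M (\<lambda>\<omega>. indicator A \<omega> *\<^sub>R f \<omega>)"
  using assms subalgebra_sets by (intro integrable_mult_indicator) auto

lemma has_cond_exp_add:
  assumes f: "has_cond_exp M F f g" and f': "has_cond_exp M F f' g'"
  shows "has_cond_exp M F (\<lambda>\<omega>. f \<omega> + f' \<omega>) (\<lambda>\<omega>. g \<omega> + g' \<omega>)"
proof (rule has_cond_expI)
  fix A assume A: "A \<in> sets F"
  show "(\<integral>\<omega>. indicator A \<omega> *\<^sub>R (g \<omega> + g' \<omega>) \<partial>M) = (\<integral>\<omega>. indicator A \<omega> *\<^sub>R (f \<omega> + f' \<omega>) \<partial>M)"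
    using has_cond_expD[OF f] has_cond_expD[OF f'] A by (simp add: scaleR_add_right integrable_indicator_scaleR)
qed (use has_cond_expD[OF f] has_cond_expD[OF f'] in auto)

lemma has_cond_exp_scaleR:
  assumes f: "has_cond_exp M F f g"
  shows "has_cond_exp M F (\<lambda>\<omega>. c *\<^sub>R f \<omega>) (\<lambda>\<omega>. c *\<^sub>R g \<omega>)"
proof (rule has_cond_expI)
  fix A assume A: "A \<in> sets F"
  show "(\<integral>\<omega>. indicator A \<omega> *\<^sub>R (c *\<^sub>R g \<omega>) \<partial>M) = (\<integral>\<omega>. indicator A \<omega> *\<^sub>R (c *\<^sub>R f \<omega>) \<partial>M)"
    using has_cond_expD(4)[OF f A] by (simp only: scaleR_left_commute[of _ c] integral_scaleR_right)
qed (use has_cond_expD[OF f] in auto)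

lemma has_cond_exp_diff:
  assumes f: "has_cond_exp M F f g" and f': "has_cond_exp M F f' g'"
  shows "has_cond_exp M F (\<lambda>\<omega>. f \<omega> - f' \<omega>) (\<lambda>\<omega>. g \<omega> - g' \<omega>)"
  using has_cond_exp_add[OF f has_cond_exp_scaleR[OF f', of "-1"]] by simp

lemma has_cond_exp_zero: "has_cond_exp M F (\<lambda>_. 0) (\<lambda>_. 0)"
  by (intro has_cond_exp_self) auto

lemma has_cond_exp_sum:
  assumes "\<And>i. i \<in> I \<Longrightarrow> has_cond_exp M F (f i) (g i)"
  shows "has_cond_exp M F (\<lambda>\<omega>. \<Sum>i\<in>I. f i \<omega>) (\<lambda>\<omega>. \<Sum>i\<in>I. g i \<omega>)"
  using assms
proof (induction I rule: infinite_finite_induct)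
  case (insert x I)
  then show ?case
    using has_cond_exp_add[of "f x" "g x" "\<lambda>\<omega>. \<Sum>i\<in>I. f i \<omega>" "\<lambda>\<omega>. \<Sum>i\<in>I. g i \<omega>"] by auto
qed (auto intro: has_cond_exp_zero)

lemma has_cond_exp_cong_AE:
  assumes f: "has_cond_exp M F f g" and f': "f' \<in> borel_measurable M" "AE \<omega> in M. f \<omega> = f' \<omega>"
  shows "has_cond_exp M F f' g"
proof (rule has_cond_expI)
  have [measurable]: "f \<in> borel_measurable M"
    using has_cond_expD(1)[OF f] by auto
  note [measurable] = f'(1)
  show "integrable M f'"
    using integrable_cong_AE[of f M f'] f' has_cond_expD(1)[OF f] by auto
  fix A assume A: "A \<in> sets F"
  have [measurable]: "A \<in> sets M"
    using A by (rule subalgebra_sets)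
  have "(\<integral>\<omega>. indicator A \<omega> *\<^sub>R f \<omega> \<partial>M) = (\<integral>\<omega>. indicator A \<omega> *\<^sub>R f' \<omega> \<partial>M)"
  proof (rule integral_cong_AE)
    show "AE \<omega> in M. indicator A \<omega> *\<^sub>R f \<omega> = indicator A \<omega> *\<^sub>R f' \<omega>"
      using f'(2) by eventually_elim simp
  qed measurable
  then show "(\<integral>\<omega>. indicator A \<omega> *\<^sub>R g \<omega> \<partial>M) = (\<integral>\<omega>. indicator A \<omega> *\<^sub>R f' \<omega> \<partial>M)"
    using has_cond_expD(4)[OF f A] by simp
qed (use has_cond_expD[OF f] in auto)

text \<open>The inner product with a fixed h reduces to the real case, outside a null set that
  depends on h. A countable dense set of vectors h and continuity leave a single null set, and then
  \<open>h = g \<omega>\<close> may be inserted.\<close>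

lemma has_cond_exp_norm_le:
  fixes f g :: "'a \<Rightarrow> 'h::{real_inner, banach, second_countable_topology}"
  assumes fg: "has_cond_exp M F f g"
  shows "AE \<omega> in M. norm (g \<omega>) \<le> real_cond_exp M F (\<lambda>\<omega>. norm (f \<omega>)) \<omega>"
proof -
  note fgD = has_cond_expD[OF fg]
  note [measurable] = fgD(3)
  define r where "r = real_cond_exp M F (\<lambda>\<omega>. norm (f \<omega>))"
  obtain D :: "'h set" where D: "countable D" "\<And>X. open X \<Longrightarrow> X \<noteq> {} \<Longrightarrow> \<exists>d\<in>D. d \<in> X"
    using countable_dense_setE by blast
  have inner_le: "AE \<omega> in M. g \<omega> \<bullet> h \<le> norm h * r \<omega>" for h
  proof -
    have "AE \<omega> in M. real_cond_exp M F (\<lambda>\<omega>. f \<omega> \<bullet> h) \<omega> = g \<omega> \<bullet> h"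
    proof (rule real_cond_exp_charact)
      fix A assume A: "A \<in> sets F"
      have "(\<integral>\<omega>. (indicator A \<omega> *\<^sub>R f \<omega>) \<bullet> h \<partial>M) = (\<integral>\<omega>. (indicator A \<omega> *\<^sub>R g \<omega>) \<bullet> h \<partial>M)"
        using A fgD by (simp only: integral_inner_left integrable_indicator_scaleR)
      then show "(\<integral>\<omega>\<in>A. (f \<omega> \<bullet> h) \<partial>M) = (\<integral>\<omega>\<in>A. (g \<omega> \<bullet> h) \<partial>M)"
        by (simp add: set_lebesgue_integral_def)
    qed (use fgD in auto)
    moreover have "AE \<omega> in M. real_cond_exp M F (\<lambda>\<omega>. f \<omega> \<bullet> h) \<omega> \<le> real_cond_exp M F (\<lambda>\<omega>. norm h * norm (f \<omega>)) \<omega>"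
    proof (rule real_cond_exp_mono)
      show "AE \<omega> in M. f \<omega> \<bullet> h \<le> norm h * norm (f \<omega>)"
        by (intro AE_I2) (metis mult.commute norm_cauchy_schwarz)
    qed (use fgD in auto)
    moreover have "AE \<omega> in M. real_cond_exp M F (\<lambda>\<omega>. norm h * norm (f \<omega>)) \<omega> = norm h * r \<omega>"
      unfolding r_def using fgD by (intro real_cond_exp_cmult) auto
    ultimately show ?thesis
      by eventually_elim simp
  qed
  have "AE \<omega> in M. \<forall>h\<in>D. g \<omega> \<bullet> h \<le> norm h * r \<omega>"
    using D(1) inner_le by (subst AE_ball_countable) auto
  moreover have "AE \<omega> in M. 0 \<le> r \<omega>"
    unfolding r_def using fgD(1) by (intro real_cond_exp_pos) auto
  ultimately show ?thesis
    unfolding r_def[symmetric]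
  proof eventually_elim
    case (elim \<omega>)
    have "closed {h. g \<omega> \<bullet> h \<le> norm h * r \<omega>}"
      by (intro closed_Collect_le continuous_intros)
    then have "open (- {h. g \<omega> \<bullet> h \<le> norm h * r \<omega>})"
      by (rule open_Compl)
    with D(2)[of "- {h. g \<omega> \<bullet> h \<le> norm h * r \<omega>}"] elim(1)
    have "- {h. g \<omega> \<bullet> h \<le> norm h * r \<omega>} = {}"
      by auto
    then have "g \<omega> \<bullet> g \<omega> \<le> norm (g \<omega>) * r \<omega>"
      by blast
    then show ?case
      using elim(2) by (cases "g \<omega> = 0") (auto simp: dot_square_norm power2_eq_square)
  qed
qed

text \<open>With the absolute value the power is convex on the whole line, so the conditional Jensen
  inequality can be applied with \<open>UNIV\<close> as its interval.\<close>

lemma convex_on_abs_powr: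
  fixes p :: real
  assumes "p \<ge> 1"
  shows "convex_on UNIV (\<lambda>x::real. \<bar>x\<bar> powr p)"
proof (rule convex_onI)
  fix t x y :: real
  assume t: "0 < t" "t < 1"
  have "\<bar>(1 - t) * x + t * y\<bar> powr p \<le> ((1 - t) * \<bar>x\<bar> + t * \<bar>y\<bar>) powr p"
    using t assms abs_triangle_ineq[of "(1 - t) * x" "t * y"] by (intro powr_mono2) (auto simp: abs_mult)
  also have "\<dots> \<le> (1 - t) * \<bar>x\<bar> powr p + t * \<bar>y\<bar> powr p"
    using t assms by (intro powr_convex_comb) auto
  finally show "\<bar>(1 - t) *\<^sub>R x + t *\<^sub>R y\<bar> powr p \<le> (1 - t) * \<bar>x\<bar> powr p + t * \<bar>y\<bar> powr p"
    by simp
qed simp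

text \<open>Contraction: the pointwise norm bound, the conditional Jensen inequality, and then
  integration, which removes the conditional expectation.\<close>

lemma has_cond_exp_Lp:
  fixes f g :: "'a \<Rightarrow> 'h::{real_inner, banach, second_countable_topology}"
  assumes p: "p \<ge> 1" and fg: "has_cond_exp M F f g" and f: "f \<in> Lp_space M p"
  shows "g \<in> Lp_space M p" "Lp_norm M p g \<le> Lp_norm M p f"
proof -
  note fgD = has_cond_expD[OF fg]
  have [measurable]: "g \<in> borel_measurable M"
    using fgD(2) by auto
  define r where "r = real_cond_exp M F (\<lambda>\<omega>. norm (f \<omega>))"
  define s where "s = real_cond_exp M F (\<lambda>\<omega>. norm (f \<omega>) powr p)"
  have int: "integrable M (\<lambda>\<omega>. norm (f \<omega>) powr p)"
    using f by (rule Lp_space_integrable)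
  have s: "integrable M s" "(\<integral>\<omega>. s \<omega> \<partial>M) = (\<integral>\<omega>. norm (f \<omega>) powr p \<partial>M)"
    unfolding s_def using int by (auto intro: real_cond_exp_int)
  have "AE \<omega> in M. \<bar>r \<omega>\<bar> powr p \<le> real_cond_exp M F (\<lambda>\<omega>. \<bar>norm (f \<omega>)\<bar> powr p) \<omega>"
    unfolding r_def
    by (rule real_cond_exp_jensens_inequality(2)[where I = UNIV and q = "\<lambda>x. \<bar>x\<bar> powr p"])
      (use fgD(1) int p in \<open>auto intro: convex_on_abs_powr\<close>)
  moreover have "AE \<omega> in M. norm (g \<omega>) \<le> r \<omega>"
    unfolding r_def using fg by (rule has_cond_exp_norm_le)
  ultimately have le: "AE \<omega> in M. norm (g \<omega>) powr p \<le> s \<omega>"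
  proof eventually_elim
    case (elim \<omega>)
    have "norm (g \<omega>) powr p \<le> \<bar>r \<omega>\<bar> powr p"
      using elim(2) p by (intro powr_mono2) auto
    then show ?case
      using elim(1) by (simp add: s_def)
  qed
  have int_g: "integrable M (\<lambda>\<omega>. norm (g \<omega>) powr p)"
  proof (rule Bochner_Integration.integrable_bound[OF s(1)])
    show "AE \<omega> in M. norm (norm (g \<omega>) powr p) \<le> norm (s \<omega>)"
      using le by eventually_elim simp
  qed measurable
  then show "g \<in> Lp_space M p"
    by (intro Lp_spaceI) auto
  have "(\<integral>\<omega>. norm (g \<omega>) powr p \<partial>M) \<le> (\<integral>\<omega>. norm (f \<omega>) powr p \<partial>M)"
    using integral_mono_AE[OF int_g s(1) le] s(2) by simp
  then show "Lp_norm M p g \<le> Lp_norm M p f"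
    using p by (subst Lp_norm_le_iff) (auto simp: Lp_norm_powr)
qed

lemma Lp_norm_1: "Lp_norm M 1 f = (\<integral>\<omega>. norm (f \<omega>) \<partial>M)"
proof -
  have "0 \<le> (\<integral>\<omega>. norm (f \<omega>) \<partial>M)"
    by (rule Bochner_Integration.integral_nonneg) simp
  then show ?thesis
    by (simp add: Lp_norm_def)
qed

lemma Lp_space_1:
  fixes f :: "'a \<Rightarrow> 'b::{banach, second_countable_topology}"
  shows "f \<in> Lp_space M 1 \<longleftrightarrow> integrable M f"
  by (auto simp: Lp_space_def integrable_norm_iff)

text \<open>The difference of two versions is a conditional expectation of 0, and contraction makes
  its norm vanish.\<close>

lemma has_cond_exp_unique:
  fixes f g :: "'a \<Rightarrow> 'h::{real_inner, banach, second_countable_topology}"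
  assumes "has_cond_exp M F f g" "has_cond_exp M F f g'"
  shows "AE \<omega> in M. g \<omega> = g' \<omega>"
proof -
  have "has_cond_exp M F (\<lambda>_. 0) (\<lambda>\<omega>. g \<omega> - g' \<omega>)"
    using has_cond_exp_diff[OF assms] by simp
  from has_cond_exp_Lp[OF _ this, of 1] have "AE \<omega> in M. g \<omega> - g' \<omega> = 0"
    by (intro Lp_norm_eq_0_imp_AE[of 1]) auto
  then show ?thesis
    by simp
qed

text \<open>Multiples of indicators come from the real case; the limit step is the extension of a
  contraction from a dense subset of \<open>L\<^sup>1\<close>.\<close>

lemma has_cond_exp_exists:
  fixes f :: "'a \<Rightarrow> 'h::{real_inner, banach, second_countable_topology}"
  assumes "integrable M f"
  shows "\<exists>g. has_cond_exp M F f g"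
  using assms
proof (induction rule: integrable_induct)
  case (base A c)
  then have A: "integrable M (indicator A :: 'a \<Rightarrow> real)"
    by simp
  have int: "integrable M (real_cond_exp M F (indicator A))"
    using A by (rule real_cond_exp_int)
  have "has_cond_exp M F (\<lambda>\<omega>. indicator A \<omega> *\<^sub>R c) (\<lambda>\<omega>. real_cond_exp M F (indicator A) \<omega> *\<^sub>R c)"
  proof (rule has_cond_expI)
    fix B assume B: "B \<in> sets F"
    have "(\<integral>\<omega>. (indicator B \<omega> * real_cond_exp M F (indicator A) \<omega>) *\<^sub>R c \<partial>M)
        = (\<integral>\<omega>. (indicator B \<omega> * indicator A \<omega>) *\<^sub>R c \<partial>M)"
      using real_cond_exp_intA[OF A B] integrable_indicator_scaleR[OF B A] integrable_indicator_scaleR[OF B int]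
      by (simp add: set_lebesgue_integral_def)
    then show "(\<integral>\<omega>. indicator B \<omega> *\<^sub>R real_cond_exp M F (indicator A) \<omega> *\<^sub>R c \<partial>M)
        = (\<integral>\<omega>. indicator B \<omega> *\<^sub>R indicator A \<omega> *\<^sub>R c \<partial>M)"
      by simp
  qed (use A int in auto)
  then show ?case
    by blast
next
  case (add f g)
  then show ?case
    using has_cond_exp_add by blast
next
  case (lim f s)
  then obtain g where g: "\<And>i. has_cond_exp M F (s i) (g i)"
    by metis
  have s: "s i \<in> Lp_space M 1" and f: "f \<in> Lp_space M 1" for i
    using lim by (auto simp: Lp_space_1)
  have g_Lp: "g i \<in> Lp_space M 1" for i
    using has_cond_exp_Lp(1)[OF _ g s] by simp
  have "(\<lambda>i. \<integral>\<omega>. norm (s i \<omega> - f \<omega>) \<partial>M) \<longlonglongrightarrow> (\<integral>\<omega>. norm (0 :: 'h) \<partial>M)"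
  \<comment> \<open>The approximating functions are bounded by \<open>2 * norm (f \<omega>)\<close>,
    and f itself contributes one more.\<close>
  proof (rule integral_dominated_convergence[where w = "\<lambda>\<omega>. 3 * norm (f \<omega>)"])
    have "(\<lambda>i. norm (s i \<omega> - f \<omega>)) \<longlonglongrightarrow> norm (f \<omega> - f \<omega>)" if "\<omega> \<in> space M" for \<omega>
      using lim.hyps(2)[OF that] by (intro tendsto_intros)
    then show "AE \<omega> in M. (\<lambda>i. norm (s i \<omega> - f \<omega>)) \<longlonglongrightarrow> norm (0 :: 'h)"
      by simp
    have "norm (s i \<omega> - f \<omega>) \<le> 3 * norm (f \<omega>)" if "\<omega> \<in> space M" for i \<omega>
      using lim.hyps(3)[OF that, of i] norm_triangle_ineq4[of "s i \<omega>" "f \<omega>"] by linarith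
    then show "AE \<omega> in M. norm (norm (s i \<omega> - f \<omega>)) \<le> 3 * norm (f \<omega>)" for i
      by simp
  qed (use lim.hyps in auto)
  then have s_lim: "(\<lambda>i. Lp_norm M 1 (\<lambda>\<omega>. s i \<omega> - f \<omega>)) \<longlonglongrightarrow> 0"
    by (simp add: Lp_norm_1)
  have g_le: "Lp_norm M 1 (\<lambda>\<omega>. g i \<omega> - g j \<omega>)
      \<le> Lp_norm M 1 (\<lambda>\<omega>. s i \<omega> - f \<omega>) + Lp_norm M 1 (\<lambda>\<omega>. s j \<omega> - f \<omega>)" for i j
  proof -
    have "Lp_norm M 1 (\<lambda>\<omega>. g i \<omega> - g j \<omega>) \<le> Lp_norm M 1 (\<lambda>\<omega>. s i \<omega> - s j \<omega>)"
      using s by (intro has_cond_exp_Lp(2) has_cond_exp_diff g Lp_space_diff) auto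
    also have "\<dots> \<le> Lp_norm M 1 (\<lambda>\<omega>. s i \<omega> - f \<omega>) + Lp_norm M 1 (\<lambda>\<omega>. f \<omega> - s j \<omega>)"
      using s f by (intro Lp_norm_diff_triangle) auto
    finally show ?thesis
      by (simp add: Lp_norm_diff_commute[of M 1 f])
  qed
  \<comment> \<open>Completeness is used over the restricted measure, so that the limit is
    measurable for F itself and not merely almost everywhere equal to such a function.\<close>
  define N where "N = restr_to_subalg M F"
  interpret N: prob_space N
    unfolding N_def using subalg prob_space_axioms by (rule prob_space_restr_to_subalg)
  have N_eq: "Lp_norm N 1 h = Lp_norm M 1 h" if "h \<in> borel_measurable F" for h :: "'a \<Rightarrow> 'h"
    unfolding N_def Lp_norm_def using that subalg by (subst integral_subalgebra2) (auto simp: Lp_norm_def)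
  have gF: "g i \<in> borel_measurable F" for i
    using g by (rule has_cond_expD)
  have gN: "g i \<in> Lp_space N 1" for i
    unfolding N_def Lp_space_def using g_Lp[of i] gF[of i] subalg
    by (auto simp: Lp_space_def intro!: integrable_in_subalg measurable_in_subalg)
  have "\<exists>k\<in>Lp_space N 1. (\<lambda>i. Lp_norm N 1 (\<lambda>\<omega>. g i \<omega> - k \<omega>)) \<longlonglongrightarrow> 0"
  proof (rule N.Lp_complete[OF _ gN])
    fix e :: real assume "e > 0"
    then have "eventually (\<lambda>i. Lp_norm M 1 (\<lambda>\<omega>. s i \<omega> - f \<omega>) < e / 2) sequentially"
      using order_tendstoD(2)[OF s_lim, of "e / 2"] by simp
    then obtain K where K: "\<And>i. i \<ge> K \<Longrightarrow> Lp_norm M 1 (\<lambda>\<omega>. s i \<omega> - f \<omega>) < e / 2"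
      by (auto simp: eventually_sequentially)
    have "Lp_norm N 1 (\<lambda>\<omega>. g i \<omega> - g j \<omega>) < e" if "i \<ge> K" "j \<ge> K" for i j
      using g_le[of i j] K[OF that(1)] K[OF that(2)] gF[of i] gF[of j] by (subst N_eq) auto
    then show "\<exists>K. \<forall>i\<ge>K. \<forall>j\<ge>K. Lp_norm N 1 (\<lambda>\<omega>. g i \<omega> - g j \<omega>) < e"
      by blast
  qed simp
  then obtain k where k: "k \<in> Lp_space N 1" "(\<lambda>i. Lp_norm N 1 (\<lambda>\<omega>. g i \<omega> - k \<omega>)) \<longlonglongrightarrow> 0"
    by blast
  have kF: "k \<in> borel_measurable F"
    using Lp_space_measurable[OF k(1)] unfolding N_def by (rule measurable_in_subalg'[OF subalg])
  have kM: "integrable M k"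
    using k(1) subalg unfolding N_def by (auto simp: Lp_space_def integrable_norm_iff intro: integrable_from_subalg)
  have k_lim: "(\<lambda>i. \<integral>\<omega>. norm (g i \<omega> - k \<omega>) \<partial>M) \<longlonglongrightarrow> 0"
    using k(2) gF kF by (simp add: N_eq Lp_norm_1)
  \<comment> \<open>Used twice, for the conditional expectations and for the functions themselves;
    their integrals over A agree for every i, hence so do the limits.\<close>
  have set_lim: "(\<lambda>i. \<integral>\<omega>. indicator A \<omega> *\<^sub>R h i \<omega> \<partial>M) \<longlonglongrightarrow> (\<integral>\<omega>. indicator A \<omega> *\<^sub>R h' \<omega> \<partial>M)"
    if A: "A \<in> sets F" and h: "\<And>i. integrable M (h i)" "integrable M h'"
      and conv: "(\<lambda>i. \<integral>\<omega>. norm (h i \<omega> - h' \<omega>) \<partial>M) \<longlonglongrightarrow> 0"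
    for A and h :: "nat \<Rightarrow> 'a \<Rightarrow> 'h" and h'
  proof (rule Lim_null[THEN iffD2], rule Lim_null_comparison[OF always_eventually conv], rule allI)
    fix i
    have int: "integrable M (\<lambda>\<omega>. indicator A \<omega> *\<^sub>R (h i \<omega> - h' \<omega>))"
      using A h by (intro integrable_indicator_scaleR) auto
    have "norm ((\<integral>\<omega>. indicator A \<omega> *\<^sub>R h i \<omega> \<partial>M) - (\<integral>\<omega>. indicator A \<omega> *\<^sub>R h' \<omega> \<partial>M))
        = norm (\<integral>\<omega>. indicator A \<omega> *\<^sub>R (h i \<omega> - h' \<omega>) \<partial>M)"
      using A h by (simp add: scaleR_diff_right integrable_indicator_scaleR)
    also have "\<dots> \<le> (\<integral>\<omega>. norm (indicator A \<omega> *\<^sub>R (h i \<omega> - h' \<omega>)) \<partial>M)"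
      by (rule integral_norm_bound)
    also have "\<dots> \<le> (\<integral>\<omega>. norm (h i \<omega> - h' \<omega>) \<partial>M)"
      using int h by (intro integral_mono integrable_norm) (auto split: split_indicator)
    finally show "norm ((\<integral>\<omega>. indicator A \<omega> *\<^sub>R h i \<omega> \<partial>M) - (\<integral>\<omega>. indicator A \<omega> *\<^sub>R h' \<omega> \<partial>M))
        \<le> (\<integral>\<omega>. norm (h i \<omega> - h' \<omega>) \<partial>M)" .
  qed
  have "has_cond_exp M F f k"
  proof (rule has_cond_expI)
    fix A assume A: "A \<in> sets F"
    have "(\<lambda>i. \<integral>\<omega>. indicator A \<omega> *\<^sub>R g i \<omega> \<partial>M) \<longlonglongrightarrow> (\<integral>\<omega>. indicator A \<omega> *\<^sub>R k \<omega> \<partial>M)"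
      using A has_cond_expD(2)[OF g] kM k_lim by (rule set_lim)
    moreover have "(\<lambda>i. \<integral>\<omega>. indicator A \<omega> *\<^sub>R s i \<omega> \<partial>M) \<longlonglongrightarrow> (\<integral>\<omega>. indicator A \<omega> *\<^sub>R f \<omega> \<partial>M)"
      using A lim.hyps(1,4) s_lim unfolding Lp_norm_1 by (rule set_lim)
    ultimately show "(\<integral>\<omega>. indicator A \<omega> *\<^sub>R k \<omega> \<partial>M) = (\<integral>\<omega>. indicator A \<omega> *\<^sub>R f \<omega> \<partial>M)"
      using has_cond_expD(4)[OF g A] by (simp add: LIMSEQ_unique)
  qed (use lim.hyps(4) kM kF in auto)
  then show ?case
    by blast
qed

lemma has_cond_exp_cond_exp:
  fixes f :: "'a \<Rightarrow> 'h::{real_inner, banach, second_countable_topology}"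
  assumes "integrable M f"
  shows "has_cond_exp M F f (cond_exp M F f)"
  unfolding cond_exp_def using has_cond_exp_exists[OF assms] by (rule someI_ex)

end

section \<open>Uniform convexity and smoothness\<close>

lemma Lp_norm_half_square:
  fixes f :: "'a \<Rightarrow> 'b::real_normed_vector"
  assumes p: "p > 0"
  shows "Lp_norm M (p / 2) (\<lambda>\<omega>. (norm (f \<omega>))\<^sup>2) = (Lp_norm M p f)\<^sup>2"
proof -
  have "Lp_norm M (p / 2) (\<lambda>\<omega>. (norm (f \<omega>))\<^sup>2) = (Lp_norm M p f powr p) powr (2 / p)"
    using p norm_powr_as_square[of "f _" p] by (simp add: Lp_norm_powr) (simp add: Lp_norm_def)
  also have "\<dots> = Lp_norm M p f powr 2"
    using p by (simp add: powr_powr)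
  finally show ?thesis
    by (simp add: powr_numeral)
qed

lemma Lp_space_half_square:
  fixes f :: "'a \<Rightarrow> 'b::{banach, second_countable_topology}"
  assumes f: "f \<in> Lp_space M p"
  shows "(\<lambda>\<omega>. (norm (f \<omega>))\<^sup>2) \<in> Lp_space M (p / 2)"
proof (rule Lp_spaceI)
  have [measurable]: "f \<in> borel_measurable M"
    using f by (rule Lp_space_measurable)
  show "(\<lambda>\<omega>. (norm (f \<omega>))\<^sup>2) \<in> borel_measurable M"
    by measurable
  show "integrable M (\<lambda>\<omega>. norm ((norm (f \<omega>))\<^sup>2) powr (p / 2))"
    using Lp_space_integrable[OF f] norm_powr_as_square[of "f _" p] by simp
qed

context
  fixes M :: "'a measure" and p :: real
  assumes p: "p > 1"
begin

text \<open>For p at most 2: smoothness of power type p, convexity of power type 2. The first claim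
  integrates a pointwise inequality. For the second, squares of norms have to leave the integral;
  the reverse Minkowski inequality with exponent \<open>p / 2\<close> achieves this.\<close>

lemma Lp_two_point_le2:
  fixes u v :: "'a \<Rightarrow> 'h::{real_inner, banach, second_countable_topology}"
  assumes u: "u \<in> Lp_space M p" and v: "v \<in> Lp_space M p" and p2: "p \<le> 2"
  shows "Lp_norm M p (\<lambda>\<omega>. u \<omega> + v \<omega>) powr p + Lp_norm M p (\<lambda>\<omega>. u \<omega> - v \<omega>) powr p
      \<le> 2 * (Lp_norm M p u powr p + Lp_norm M p v powr p)"
    "2 * ((Lp_norm M p u)\<^sup>2 + (p - 1) / 2 * (Lp_norm M p v)\<^sup>2)
      \<le> (Lp_norm M p (\<lambda>\<omega>. u \<omega> + v \<omega>))\<^sup>2 + (Lp_norm M p (\<lambda>\<omega>. u \<omega> - v \<omega>))\<^sup>2"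
proof -
  have p1: "p \<ge> 1"
    using p by simp
  note uv = Lp_space_add(1)[OF p1 u v] Lp_space_diff(1)[OF p1 u v]
  note int = uv[THEN Lp_space_integrable] u[THEN Lp_space_integrable] v[THEN Lp_space_integrable]
  have "(\<integral>\<omega>. norm (u \<omega> + v \<omega>) powr p + norm (u \<omega> - v \<omega>) powr p \<partial>M)
      \<le> (\<integral>\<omega>. 2 * (norm (u \<omega>) powr p + norm (v \<omega>) powr p) \<partial>M)"
    using int p p2 by (intro integral_mono norm_clarkson_upper) auto
  then show "Lp_norm M p (\<lambda>\<omega>. u \<omega> + v \<omega>) powr p + Lp_norm M p (\<lambda>\<omega>. u \<omega> - v \<omega>) powr p
      \<le> 2 * (Lp_norm M p u powr p + Lp_norm M p v powr p)"
    using int p by (simp add: Lp_norm_powr)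
  define k where "k = (p - 1) / 2"
  \<comment> \<open>The factor k is moved into v, so that both summands are squared norms.\<close>
  define w where "w = (\<lambda>\<omega>. sqrt k *\<^sub>R v \<omega>)"
  have k: "k > 0"
    using p by (simp add: k_def)
  have w: "w \<in> Lp_space M p" "(Lp_norm M p w)\<^sup>2 = k * (Lp_norm M p v)\<^sup>2"
    using v k p by (auto simp: w_def Lp_space_scaleR Lp_norm_scaleR power_mult_distrib)
  have w_sq: "(norm (w \<omega>))\<^sup>2 = k * (norm (v \<omega>))\<^sup>2" for \<omega>
    using k by (simp add: w_def power_mult_distrib)
  define R where "R = Lp_norm M (p / 2) (\<lambda>\<omega>. (norm (u \<omega>))\<^sup>2 + (norm (w \<omega>))\<^sup>2)"
  define a b where "a = Lp_norm M p (\<lambda>\<omega>. u \<omega> + v \<omega>)" and "b = Lp_norm M p (\<lambda>\<omega>. u \<omega> - v \<omega>)"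
  have half: "0 < p / 2" "p / 2 \<le> 1"
    using p p2 by auto
  note rev = Lp_norm_reverse_triangle[OF half Lp_space_half_square[OF u] Lp_space_half_square[OF w(1)]]
  have "2 * R powr (p / 2) = (\<integral>\<omega>. 2 * ((norm (u \<omega>))\<^sup>2 + (norm (w \<omega>))\<^sup>2) powr (p / 2) \<partial>M)"
    using half by (simp add: R_def Lp_norm_powr)
  also have "\<dots> \<le> (\<integral>\<omega>. norm (u \<omega> + v \<omega>) powr p + norm (u \<omega> - v \<omega>) powr p \<partial>M)"
  proof (rule integral_mono)
    show "integrable M (\<lambda>\<omega>. 2 * ((norm (u \<omega>))\<^sup>2 + (norm (w \<omega>))\<^sup>2) powr (p / 2))"
      using Lp_space_integrable[OF rev(1)] by simp
    show "2 * ((norm (u \<omega>))\<^sup>2 + (norm (w \<omega>))\<^sup>2) powr (p / 2)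
        \<le> norm (u \<omega> + v \<omega>) powr p + norm (u \<omega> - v \<omega>) powr p" for \<omega>
      unfolding w_sq k_def using p p2 by (rule norm_two_point_lower)
  qed (use int in auto)
  also have "\<dots> = a powr p + b powr p"
    using int p by (simp add: Lp_norm_powr a_def b_def)
  finally have "R powr (p / 2) \<le> (1/2) * (a\<^sup>2) powr (p / 2) + (1/2) * (b\<^sup>2) powr (p / 2)"
    using norm_powr_as_square[of a p] norm_powr_as_square[of b p] by (simp add: a_def b_def)
  \<comment> \<open>Concavity replaces the mean of the p-th powers by a power of the mean of the
    squares; then the exponent \<open>p / 2\<close> can be cancelled.\<close>
  also have "\<dots> \<le> ((1/2) * a\<^sup>2 + (1/2) * b\<^sup>2) powr (p / 2)"
    using half by (intro powr_concave_comb) auto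
  finally have "R \<le> (1/2) * a\<^sup>2 + (1/2) * b\<^sup>2"
    using half by (subst (asm) powr_le_powr_iff) (auto simp: R_def)
  moreover have "(Lp_norm M p u)\<^sup>2 + k * (Lp_norm M p v)\<^sup>2 \<le> R"
    using rev(2) p w(2) by (simp add: R_def Lp_norm_half_square)
  ultimately have "2 * ((Lp_norm M p u)\<^sup>2 + k * (Lp_norm M p v)\<^sup>2) \<le> a\<^sup>2 + b\<^sup>2"
    by simp
  then show "2 * ((Lp_norm M p u)\<^sup>2 + (p - 1) / 2 * (Lp_norm M p v)\<^sup>2)
      \<le> (Lp_norm M p (\<lambda>\<omega>. u \<omega> + v \<omega>))\<^sup>2 + (Lp_norm M p (\<lambda>\<omega>. u \<omega> - v \<omega>))\<^sup>2"
    by (simp only: k_def a_def b_def)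
qed

text \<open>For p at least 2 the types are exchanged, p for convexity and 2 for smoothness, and the
  ordinary Minkowski inequality serves for the exponent \<open>p / 2\<close>.\<close>

lemma Lp_two_point_ge2:
  fixes u v :: "'a \<Rightarrow> 'h::{real_inner, banach, second_countable_topology}"
  assumes u: "u \<in> Lp_space M p" and v: "v \<in> Lp_space M p" and p2: "2 \<le> p"
  shows "2 * (Lp_norm M p u powr p + Lp_norm M p v powr p)
      \<le> Lp_norm M p (\<lambda>\<omega>. u \<omega> + v \<omega>) powr p + Lp_norm M p (\<lambda>\<omega>. u \<omega> - v \<omega>) powr p"
    "(Lp_norm M p (\<lambda>\<omega>. u \<omega> + v \<omega>))\<^sup>2 + (Lp_norm M p (\<lambda>\<omega>. u \<omega> - v \<omega>))\<^sup>2
      \<le> 2 * ((Lp_norm M p u)\<^sup>2 + (2 powr p + p) * (Lp_norm M p v)\<^sup>2)"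
proof -
  have p1: "p \<ge> 1"
    using p by simp
  note uv = Lp_space_add(1)[OF p1 u v] Lp_space_diff(1)[OF p1 u v]
  note int = uv[THEN Lp_space_integrable] u[THEN Lp_space_integrable] v[THEN Lp_space_integrable]
  have "(\<integral>\<omega>. 2 * (norm (u \<omega>) powr p + norm (v \<omega>) powr p) \<partial>M)
      \<le> (\<integral>\<omega>. norm (u \<omega> + v \<omega>) powr p + norm (u \<omega> - v \<omega>) powr p \<partial>M)"
    using int p2 by (intro integral_mono norm_clarkson_lower) auto
  then show "2 * (Lp_norm M p u powr p + Lp_norm M p v powr p)
      \<le> Lp_norm M p (\<lambda>\<omega>. u \<omega> + v \<omega>) powr p + Lp_norm M p (\<lambda>\<omega>. u \<omega> - v \<omega>) powr p"
    using int p by (simp add: Lp_norm_powr)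
  define k where "k = 2 powr p + p"
  define w where "w = (\<lambda>\<omega>. sqrt k *\<^sub>R v \<omega>)"
  have k: "k > 0"
    using p by (simp add: k_def add_pos_pos)
  have w: "w \<in> Lp_space M p" "(Lp_norm M p w)\<^sup>2 = k * (Lp_norm M p v)\<^sup>2"
    using v k p by (auto simp: w_def Lp_space_scaleR Lp_norm_scaleR power_mult_distrib)
  have w_sq: "(norm (w \<omega>))\<^sup>2 = k * (norm (v \<omega>))\<^sup>2" for \<omega>
    using k by (simp add: w_def power_mult_distrib)
  define R where "R = Lp_norm M (p / 2) (\<lambda>\<omega>. (norm (u \<omega>))\<^sup>2 + (norm (w \<omega>))\<^sup>2)"
  define a b where "a = Lp_norm M p (\<lambda>\<omega>. u \<omega> + v \<omega>)" and "b = Lp_norm M p (\<lambda>\<omega>. u \<omega> - v \<omega>)"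
  have half: "1 \<le> p / 2"
    using p2 by auto
  note tri = Lp_space_add[OF half Lp_space_half_square[OF u] Lp_space_half_square[OF w(1)]]
  have "((1/2) * a\<^sup>2 + (1/2) * b\<^sup>2) powr (p / 2) \<le> (1/2) * (a\<^sup>2) powr (p / 2) + (1/2) * (b\<^sup>2) powr (p / 2)"
    using half by (intro powr_convex_comb) auto
  also have "\<dots> = (1/2) * (a powr p + b powr p)"
    using norm_powr_as_square[of a p] norm_powr_as_square[of b p] by (simp add: a_def b_def)
  also have "a powr p + b powr p = (\<integral>\<omega>. norm (u \<omega> + v \<omega>) powr p + norm (u \<omega> - v \<omega>) powr p \<partial>M)"
    using int p by (simp add: Lp_norm_powr a_def b_def)
  also have "\<dots> \<le> (\<integral>\<omega>. 2 * ((norm (u \<omega>))\<^sup>2 + (norm (w \<omega>))\<^sup>2) powr (p / 2) \<partial>M)"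
  proof (rule integral_mono)
    show "integrable M (\<lambda>\<omega>. 2 * ((norm (u \<omega>))\<^sup>2 + (norm (w \<omega>))\<^sup>2) powr (p / 2))"
      using Lp_space_integrable[OF tri(1)] by simp
    show "norm (u \<omega> + v \<omega>) powr p + norm (u \<omega> - v \<omega>) powr p
        \<le> 2 * ((norm (u \<omega>))\<^sup>2 + (norm (w \<omega>))\<^sup>2) powr (p / 2)" for \<omega>
      unfolding w_sq k_def using p2 by (rule norm_two_point_upper)
  qed (use int in auto)
  also have "\<dots> = 2 * R powr (p / 2)"
    using half by (simp add: R_def Lp_norm_powr)
  finally have "(1/2) * a\<^sup>2 + (1/2) * b\<^sup>2 \<le> R"
    using half powr_le_powr_iff[of "p / 2" "(1/2) * a\<^sup>2 + (1/2) * b\<^sup>2" R] by (simp add: R_def)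
  moreover have "R \<le> (Lp_norm M p u)\<^sup>2 + k * (Lp_norm M p v)\<^sup>2"
    using tri(2) p w(2) by (simp add: R_def Lp_norm_half_square)
  ultimately have "a\<^sup>2 + b\<^sup>2 \<le> 2 * ((Lp_norm M p u)\<^sup>2 + k * (Lp_norm M p v)\<^sup>2)"
    by simp
  then show "(Lp_norm M p (\<lambda>\<omega>. u \<omega> + v \<omega>))\<^sup>2 + (Lp_norm M p (\<lambda>\<omega>. u \<omega> - v \<omega>))\<^sup>2
      \<le> 2 * ((Lp_norm M p u)\<^sup>2 + (2 powr p + p) * (Lp_norm M p v)\<^sup>2)"
    by (simp only: k_def a_def b_def)
qed

end

text \<open>Twice the coefficient of the second point in the two-point upper bounds: that
  coefficient is 1 in Clarkson's inequality and \<open>2 powr p + p\<close> in the bound for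
  squares.\<close>

definition smooth_const :: "real \<Rightarrow> real" where
  "smooth_const p = (if p \<le> 2 then 2 else 2 * (2 powr p + p))"

text \<open>The second point will be half of f - g. For p at most 2 this leaves
  \<open>2 * ((p - 1) / 2) * (1 / 2)\<^sup>2\<close>, for larger p the factor
  \<open>2 * (1 / 2) powr p\<close>.\<close>

definition convex_const :: "real \<Rightarrow> real" where
  "convex_const p = (if p \<le> 2 then (p - 1) / 4 else 2 * (1 / 2) powr p)"

lemma convex_const_pos: "p > 1 \<Longrightarrow> convex_const p > 0"
  by (simp add: convex_const_def)

section \<open>A single martingale step\<close>

context prob_subalgebra
begin

text \<open>Smoothness bounds \<open>\<parallel>x + d\<parallel> + \<parallel>x - d\<parallel>\<close> from above; conditional expectation being a
  contraction that maps \<open>x - d\<close> to \<open>x\<close>, the second summand is at least \<open>\<parallel>x\<parallel>\<close>.\<close>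

lemma martingale_difference_smooth:
  fixes x d :: "'a \<Rightarrow> 'h::{real_inner, banach, second_countable_topology}"
  assumes p: "p > 1" and x: "x \<in> Lp_space M p" and d: "d \<in> Lp_space M p"
    and xx: "has_cond_exp M F x x" and dd: "has_cond_exp M F d (\<lambda>_. 0)"
  shows "Lp_norm M p (\<lambda>\<omega>. x \<omega> + d \<omega>) powr min 2 p
    \<le> Lp_norm M p x powr min 2 p + smooth_const p * Lp_norm M p d powr min 2 p"
proof -
  have p1: "p \<ge> 1"
    using p by simp
  have "has_cond_exp M F (\<lambda>\<omega>. x \<omega> - d \<omega>) x"
    using has_cond_exp_diff[OF xx dd] by simp
  then have le: "Lp_norm M p x \<le> Lp_norm M p (\<lambda>\<omega>. x \<omega> - d \<omega>)"
    by (rule has_cond_exp_Lp(2)[OF p1]) (rule Lp_space_diff(1)[OF p1 x d])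
  show ?thesis
  proof (cases "p \<le> 2")
    case True
    have "Lp_norm M p x powr p \<le> Lp_norm M p (\<lambda>\<omega>. x \<omega> - d \<omega>) powr p"
      using le p by (intro powr_mono2) auto
    then show ?thesis
      using Lp_two_point_le2(1)[OF p x d True] True by (simp add: smooth_const_def min_def)
  next
    case False
    define k where "k = 2 powr p + p"
    have sq: "(Lp_norm M p x)\<^sup>2 \<le> (Lp_norm M p (\<lambda>\<omega>. x \<omega> - d \<omega>))\<^sup>2"
      using le by (intro power_mono) auto
    have "2 \<le> p"
      using False by simp
    from Lp_two_point_ge2(2)[OF p x d this, folded k_def] sq
    have "(Lp_norm M p (\<lambda>\<omega>. x \<omega> + d \<omega>))\<^sup>2 \<le> (Lp_norm M p x)\<^sup>2 + 2 * (k * (Lp_norm M p d)\<^sup>2)"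
      unfolding distrib_left by linarith
    then show ?thesis
      using False by (simp add: smooth_const_def min_def powr_numeral mult.assoc flip: k_def)
  qed
qed

text \<open>The two points are \<open>f\<close> and \<open>g\<close>, and conditional expectation maps their midpoint to \<open>g\<close>.\<close>

lemma cond_exp_convex:
  fixes f g :: "'a \<Rightarrow> 'h::{real_inner, banach, second_countable_topology}"
  assumes p: "p > 1" and f: "f \<in> Lp_space M p" and fg: "has_cond_exp M F f g"
  shows "Lp_norm M p g powr max 2 p + convex_const p * Lp_norm M p (\<lambda>\<omega>. f \<omega> - g \<omega>) powr max 2 p
    \<le> Lp_norm M p f powr max 2 p"
proof -
  have p1: "p \<ge> 1"
    using p by simp
  have g: "g \<in> Lp_space M p"
    using has_cond_exp_Lp(1)[OF p1 fg f] .
  have gg: "has_cond_exp M F g g"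
    using has_cond_expD[OF fg] by (intro has_cond_exp_self) auto
  define u v where "u = (\<lambda>\<omega>. (1/2) *\<^sub>R (f \<omega> + g \<omega>))" and "v = (\<lambda>\<omega>. (1/2) *\<^sub>R (f \<omega> - g \<omega>))"
  have u: "u \<in> Lp_space M p" and v: "v \<in> Lp_space M p"
    unfolding u_def v_def by (intro Lp_space_scaleR Lp_space_add(1) Lp_space_diff(1) p1 f g)+
  have v_norm: "Lp_norm M p v = 1 / 2 * Lp_norm M p (\<lambda>\<omega>. f \<omega> - g \<omega>)"
    using p unfolding v_def by (simp add: Lp_norm_scaleR)
  have uv: "(\<lambda>\<omega>. u \<omega> + v \<omega>) = f" "(\<lambda>\<omega>. u \<omega> - v \<omega>) = g"
    by (simp_all add: u_def v_def fun_eq_iff flip: scaleR_add_right scaleR_diff_right)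
  have "(\<lambda>\<omega>. (1/2) *\<^sub>R (g \<omega> + g \<omega>)) = g"
    by (simp add: fun_eq_iff flip: scaleR_2)
  then have "has_cond_exp M F u g"
    using has_cond_exp_scaleR[OF has_cond_exp_add[OF fg gg], of "1/2"] by (simp add: u_def)
  then have le: "Lp_norm M p g \<le> Lp_norm M p u"
    using u by (rule has_cond_exp_Lp(2)[OF p1])
  show ?thesis
  proof (cases "p \<le> 2")
    case True
    have "(Lp_norm M p g)\<^sup>2 \<le> (Lp_norm M p u)\<^sup>2"
      using le by (intro power_mono) auto
    moreover have "2 * (Lp_norm M p u)\<^sup>2 + (p - 1) / 4 * (Lp_norm M p (\<lambda>\<omega>. f \<omega> - g \<omega>))\<^sup>2
        \<le> (Lp_norm M p f)\<^sup>2 + (Lp_norm M p g)\<^sup>2"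
      using Lp_two_point_le2(2)[OF p u v True] by (simp add: uv v_norm power_divide)
    ultimately have "(Lp_norm M p g)\<^sup>2 + (p - 1) / 4 * (Lp_norm M p (\<lambda>\<omega>. f \<omega> - g \<omega>))\<^sup>2 \<le> (Lp_norm M p f)\<^sup>2"
      by linarith
    then show ?thesis
      using True by (simp add: convex_const_def max_absorb1 powr_numeral)
  next
    case False
    have "Lp_norm M p g powr p \<le> Lp_norm M p u powr p"
      using le p by (intro powr_mono2) auto
    moreover have "Lp_norm M p v powr p = (1 / 2) powr p * Lp_norm M p (\<lambda>\<omega>. f \<omega> - g \<omega>) powr p"
      unfolding v_norm by (rule powr_mult)
    ultimately show ?thesis
      using Lp_two_point_ge2(1)[OF p u v] False
      by (simp add: uv convex_const_def max_def)
  qed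
qed

end

section \<open>Stationary filtrations\<close>

locale stationary_filtration = prob_space M for M :: "'a measure" +
  fixes \<theta> :: "'a \<Rightarrow> 'a" and F0 :: "'a measure"
  assumes mpt: "bimeasurable_mpt M \<theta>"
    and subalgebra_F0: "subalgebra M F0"
    and F0_mono: "sets F0 \<subseteq> sets (vimage_algebra (space M) \<theta> F0)"
begin

abbreviation shift :: "int \<Rightarrow> 'a \<Rightarrow> 'a" where
  "shift \<equiv> int_iterate M \<theta>"

abbreviation past :: "int \<Rightarrow> 'a measure" where
  "past \<equiv> filt M \<theta> F0"

abbreviation unshift :: "'a \<Rightarrow> 'a" where
  "unshift \<equiv> the_inv_into (space M) \<theta>"

lemma space_F0: "space F0 = space M"
  using subalgebra_F0 by (simp add: subalgebra_def)

lemma sets_F0: "A \<in> sets F0 \<Longrightarrow> A \<in> sets M"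
  using subalgebra_F0 by (auto simp: subalgebra_def)

section \<open>The transformation and its integer iterates\<close>

lemma \<theta>_measurable [measurable]: "\<theta> \<in> measurable M M"
  and unshift_measurable [measurable]: "unshift \<in> measurable M M"
  and distr_\<theta>: "distr M M \<theta> = M"
  and bij_\<theta>: "bij_betw \<theta> (space M) (space M)"
  using mpt by (auto simp: bimeasurable_mpt_def)

lemma unshift_\<theta>: "\<omega> \<in> space M \<Longrightarrow> unshift (\<theta> \<omega>) = \<omega>"
  using bij_\<theta> by (auto simp: bij_betw_def intro: the_inv_into_f_f)

lemma \<theta>_unshift: "\<omega> \<in> space M \<Longrightarrow> \<theta> (unshift \<omega>) = \<omega>"
  using bij_\<theta> by (auto simp: bij_betw_def intro: f_the_inv_into_f)

lemma distr_unshift: "distr M M unshift = M"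
proof -
  have "distr M M unshift = distr (distr M M \<theta>) M unshift"
    by (simp add: distr_\<theta>)
  also have "\<dots> = distr M M (unshift \<circ> \<theta>)"
    by (rule distr_distr) auto
  also have "\<dots> = distr M M (\<lambda>\<omega>. \<omega>)"
    by (rule distr_cong) (auto simp: unshift_\<theta>)
  finally show ?thesis
    by simp
qed

lemma funpow_measure_preserving:
  assumes "f \<in> measurable M M" "distr M M f = M"
  shows "f ^^ n \<in> measurable M M \<and> distr M M (f ^^ n) = M"
proof (induction n)
  case 0
  then show ?case
    by (simp add: id_def)
next
  case (Suc n)
  have "distr M M (f \<circ> (f ^^ n)) = distr (distr M M (f ^^ n)) M f"
    using Suc assms by (subst distr_distr) auto
  moreover have "f \<circ> (f ^^ n) \<in> measurable M M"
    using Suc assms by (blast intro: measurable_comp)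
  ultimately show ?case
    using Suc assms(2) by (simp only: funpow.simps)
qed

lemma shift_measurable [measurable]: "shift i \<in> measurable M M"
  and distr_shift: "distr M M (shift i) = M"
  using funpow_measure_preserving[OF \<theta>_measurable distr_\<theta>]
    funpow_measure_preserving[OF unshift_measurable distr_unshift]
  by (auto simp: int_iterate_def)

lemma shift_space: "\<omega> \<in> space M \<Longrightarrow> shift i \<omega> \<in> space M"
  using measurable_space[OF shift_measurable] .

lemma shift_0 [simp]: "shift 0 \<omega> = \<omega>"
  by (simp add: int_iterate_def)

text \<open>Iterates are defined according to the sign of the index; the delicate passage is from -1
  to 0, where the definition changes branch.\<close>

lemma shift_Suc:
  assumes "\<omega> \<in> space M"
  shows "shift (i + 1) \<omega> = \<theta> (shift i \<omega>)"
proof (cases "0 \<le> i")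
  case True
  then show ?thesis
    by (simp add: int_iterate_def nat_add_distrib)
next
  case False
  define n where "n = nat (- i) - 1"
  have n: "nat (- i) = Suc n" "nat (- (i + 1)) = n"
    using False by (auto simp: n_def)
  have "(unshift ^^ n) \<omega> \<in> space M"
    using funpow_measure_preserving[OF unshift_measurable distr_unshift, of n] assms
    by (blast intro: measurable_space[of "unshift ^^ n" M M])
  then have "\<theta> (shift i \<omega>) = (unshift ^^ n) \<omega>"
    using False by (simp add: int_iterate_def n \<theta>_unshift)
  also have "\<dots> = shift (i + 1) \<omega>"
  proof (cases "n = 0")
    case True
    then have "i = -1"
      using False n by simp
    then show ?thesis
      using True by (simp add: int_iterate_def)
  next
    case nz: False
    then have "\<not> 0 \<le> i + 1"
      using n by linarith
    then show ?thesis
      using n by (simp add: int_iterate_def)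
  qed
  finally show ?thesis ..
qed

lemma shift_pred: "\<omega> \<in> space M \<Longrightarrow> shift (i - 1) \<omega> = unshift (shift i \<omega>)"
  using shift_Suc[of \<omega> "i - 1"] unshift_\<theta>[OF shift_space] by simp

lemma shift_add: "\<omega> \<in> space M \<Longrightarrow> shift (i + j) \<omega> = shift i (shift j \<omega>)"
proof (induction i rule: int_induct[where k = 0])
  case (step1 i)
  then show ?case
    using shift_Suc[of \<omega> "i + j"] shift_Suc[OF shift_space, of \<omega> i j] by (simp add: algebra_simps)
next
  case (step2 i)
  then show ?case
    using shift_pred[of \<omega> "i + j"] shift_pred[OF shift_space, of \<omega> i j] by (simp add: algebra_simps)
qed simp

section \<open>The filtration of pasts\<close>

lemma space_past [simp]: "space (past i) = space M"
  by (simp add: filt_def)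

lemma sets_past: "sets (past i) = {shift i -` A \<inter> space M | A. A \<in> sets F0}"
  unfolding filt_def using shift_space space_F0 by (intro sets_vimage_algebra2) auto

lemma sets_past_0: "sets (past 0) = sets F0"
proof -
  have "shift 0 -` A \<inter> space M = A" if "A \<in> sets F0" for A
    using sets.sets_into_space[OF that] space_F0 by auto
  then show ?thesis
    unfolding sets_past by auto
qed

lemma subalgebra_past: "subalgebra M (past i)"
  unfolding subalgebra_def sets_past using sets_F0 by auto

lemma past_Suc: "sets (past i) \<subseteq> sets (past (i + 1))"
proof
  fix A assume "A \<in> sets (past i)"
  then obtain B where B: "B \<in> sets F0" "A = shift i -` B \<inter> space M"
    by (auto simp: sets_past)
  have "sets (vimage_algebra (space M) \<theta> F0) = {\<theta> -` C \<inter> space M | C. C \<in> sets F0}"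
    using space_F0 measurable_space[OF \<theta>_measurable] by (intro sets_vimage_algebra2) auto
  then obtain C where C: "C \<in> sets F0" "B = \<theta> -` C \<inter> space M"
    using B(1) F0_mono by auto
  have "A = shift (i + 1) -` C \<inter> space M"
    using B(2) C(2) shift_Suc shift_space by auto
  then show "A \<in> sets (past (i + 1))"
    using C(1) by (auto simp: sets_past)
qed

lemma past_mono:
  assumes "i \<le> j"
  shows "sets (past i) \<subseteq> sets (past j)"
  using assms
proof (induction j rule: int_ge_induct)
  case (step j)
  then show ?case
    using past_Suc[of j] by simp
qed simp

lemma measurable_past_mono:
  assumes "f \<in> borel_measurable (past i)" "i \<le> j"
  shows "f \<in> borel_measurable (past j)"
  by (rule measurable_from_subalg[OF _ assms(1)]) (use past_mono[OF assms(2)] in \<open>simp add: subalgebra_def\<close>)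

text \<open>The algebra \<open>past (i + j)\<close> is generated by \<open>shift (i + j)\<close>,
  which is \<open>shift i\<close> after \<open>shift j\<close>; so it contains the preimages under
  \<open>shift j\<close> of events of \<open>past i\<close>.\<close>

lemma shift_past: "shift j \<in> measurable (past (i + j)) (past i)"
proof -
  have *: "shift (i + j) \<in> measurable (past (i + j)) F0"
    unfolding filt_def using shift_space space_F0 by (intro measurable_vimage_algebra1) auto
  have "shift (i + j) \<omega> = shift i (shift j \<omega>)" if "\<omega> \<in> space (past (i + j))" for \<omega>
    using that by (intro shift_add) simp
  then have "(\<lambda>\<omega>. shift i (shift j \<omega>)) \<in> measurable (past (i + j)) F0"
    using * measurable_cong[of "past (i + j)" "shift (i + j)" "\<lambda>\<omega>. shift i (shift j \<omega>)" F0] by blast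
  then show ?thesis
    unfolding filt_def[of M \<theta> F0 i] using shift_space by (intro measurable_vimage_algebra2) auto
qed

lemma prob_subalgebra_past: "prob_subalgebra M (past i)"
  by unfold_locales (rule subalgebra_past)

section \<open>Invariance under the shift\<close>

lemma AE_shift:
  assumes "AE \<omega> in M. P \<omega>"
  shows "AE \<omega> in M. P (shift i \<omega>)"
  by (rule AE_distrD[OF shift_measurable, unfolded distr_shift, OF assms])

lemma integrable_shift:
  fixes f :: "'a \<Rightarrow> 'b::{banach, second_countable_topology}"
  assumes "integrable M f"
  shows "integrable M (\<lambda>\<omega>. f (shift i \<omega>))"
  by (rule integrable_distr[OF shift_measurable]) (use assms in \<open>simp add: distr_shift\<close>)

lemma integral_shift:
  fixes f :: "'a \<Rightarrow> 'b::{banach, second_countable_topology}"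
  assumes "f \<in> borel_measurable M"
  shows "(\<integral>\<omega>. f (shift i \<omega>) \<partial>M) = (\<integral>\<omega>. f \<omega> \<partial>M)"
  using integral_distr[OF shift_measurable assms, of i] by (simp add: distr_shift)

lemma Lp_space_shift:
  fixes f :: "'a \<Rightarrow> 'b::{banach, second_countable_topology}"
  assumes "f \<in> Lp_space M p"
  shows "(\<lambda>\<omega>. f (shift i \<omega>)) \<in> Lp_space M p"
  using assms integrable_shift[of "\<lambda>\<omega>. norm (f \<omega>) powr p" i]
  by (auto simp: Lp_space_def intro: measurable_compose[OF shift_measurable])

lemma Lp_norm_shift:
  fixes f :: "'a \<Rightarrow> 'b::{banach, second_countable_topology}"
  assumes [measurable]: "f \<in> borel_measurable M"
  shows "Lp_norm M p (\<lambda>\<omega>. f (shift i \<omega>)) = Lp_norm M p f"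
  using integral_shift[of "\<lambda>\<omega>. norm (f \<omega>) powr p" i] by (simp add: Lp_norm_def)

text \<open>An event of \<open>past (k + i)\<close> is the preimage under \<open>shift i\<close> of
  an event of \<open>past k\<close>, and the shift preserves integrals, so the defining identity is
  transported.\<close>

lemma has_cond_exp_shift:
  assumes fg: "has_cond_exp M (past k) f g"
  shows "has_cond_exp M (past (k + i)) (\<lambda>\<omega>. f (shift i \<omega>)) (\<lambda>\<omega>. g (shift i \<omega>))"
proof (rule has_cond_expI)
  note D = has_cond_expD[OF fg]
  interpret prob_subalgebra M "past k"
    by (rule prob_subalgebra_past)
  show "integrable M (\<lambda>\<omega>. f (shift i \<omega>))" "integrable M (\<lambda>\<omega>. g (shift i \<omega>))"
    by (intro integrable_shift D)+
  show "(\<lambda>\<omega>. g (shift i \<omega>)) \<in> borel_measurable (past (k + i))"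
    by (rule measurable_compose[OF shift_past D(3)])
  fix A assume "A \<in> sets (past (k + i))"
  then obtain B where B: "B \<in> sets F0" "A = shift (k + i) -` B \<inter> space M"
    by (auto simp: sets_past)
  define C where "C = shift k -` B \<inter> space M"
  have C: "C \<in> sets (past k)"
    using B(1) by (auto simp: C_def sets_past)
  have ind: "indicator A \<omega> = (indicator C (shift i \<omega>) :: real)" if "\<omega> \<in> space M" for \<omega>
    using that shift_space[OF that] shift_add[OF that, of k i] by (auto simp: C_def B(2) indicator_def)
  have shift_eq: "(\<integral>\<omega>. indicator A \<omega> *\<^sub>R h (shift i \<omega>) \<partial>M) = (\<integral>\<omega>. indicator C \<omega> *\<^sub>R h \<omega> \<partial>M)"
    if h: "integrable M h" for h :: "'a \<Rightarrow> 'b"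
  proof -
    have "(\<integral>\<omega>. indicator A \<omega> *\<^sub>R h (shift i \<omega>) \<partial>M) = (\<integral>\<omega>. indicator C (shift i \<omega>) *\<^sub>R h (shift i \<omega>) \<partial>M)"
      by (rule Bochner_Integration.integral_cong) (auto simp: ind)
    also have "\<dots> = (\<integral>\<omega>. indicator C \<omega> *\<^sub>R h \<omega> \<partial>M)"
      using integrable_indicator_scaleR[OF C h]
      by (intro integral_shift[where f = "\<lambda>\<omega>. indicator C \<omega> *\<^sub>R h \<omega>"]) auto
    finally show ?thesis .
  qed
  show "(\<integral>\<omega>. indicator A \<omega> *\<^sub>R g (shift i \<omega>) \<partial>M) = (\<integral>\<omega>. indicator A \<omega> *\<^sub>R f (shift i \<omega>) \<partial>M)"
    using D(4)[OF C] by (simp add: shift_eq D)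
qed

text \<open>One function stands for a whole stationary sequence: its translates by
  \<open>shift k\<close> are martingale differences for the filtration of pasts.\<close>

definition martingale_difference :: "real \<Rightarrow> ('a \<Rightarrow> 'b::{banach, second_countable_topology}) \<Rightarrow> bool" where
  "martingale_difference p d \<longleftrightarrow>
     d \<in> Lp_space M p \<and> d \<in> borel_measurable (past 0) \<and> has_cond_exp M (past (- 1)) d (\<lambda>_. 0)"

text \<open>Given \<open>past n\<close>, the sum of n terms is measurable and the next term has
  conditional expectation 0, so one smooth step applies; by stationarity every step costs the same
  amount.\<close>

lemma stationary_martingale_bound:
  fixes d :: "'a \<Rightarrow> 'h::{real_inner, banach, second_countable_topology}"
  assumes p: "p > 1" and d: "martingale_difference p d"
  shows "Lp_norm M p (\<lambda>\<omega>. \<Sum>k=1..n. d (shift (int k) \<omega>)) powr min 2 p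
    \<le> real n * (smooth_const p * Lp_norm M p d powr min 2 p)"
proof (induction n)
  case (Suc n)
  interpret prob_subalgebra M "past (int n)"
    by (rule prob_subalgebra_past)
  have d': "d \<in> Lp_space M p" "d \<in> borel_measurable (past 0)" "has_cond_exp M (past (- 1)) d (\<lambda>_. 0)"
    using d by (auto simp: martingale_difference_def)
  define x where "x = (\<lambda>\<omega>. \<Sum>k=1..n. d (shift (int k) \<omega>))"
  have p1: "p \<ge> 1"
    using p by simp
  have x: "x \<in> Lp_space M p"
    unfolding x_def by (intro Lp_space_sum(1) Lp_space_shift d' p1)
  have "(\<lambda>\<omega>. d (shift (int k) \<omega>)) \<in> borel_measurable (past (int n))" if "k \<in> {1..n}" for k
    using measurable_compose[OF shift_past[of "int k" 0] d'(2)] that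
    by (auto intro: measurable_past_mono)
  then have "has_cond_exp M (past (int n)) x x"
    using Lp_imp_L1(1)[OF p1 x] by (intro has_cond_exp_self) (auto simp: x_def intro: borel_measurable_sum)
  moreover have "has_cond_exp M (past (int n)) (\<lambda>\<omega>. d (shift (int (Suc n)) \<omega>)) (\<lambda>_. 0)"
    using has_cond_exp_shift[OF d'(3), of "int (Suc n)"] by simp
  ultimately have "Lp_norm M p (\<lambda>\<omega>. x \<omega> + d (shift (int (Suc n)) \<omega>)) powr min 2 p
    \<le> Lp_norm M p x powr min 2 p + smooth_const p * Lp_norm M p (\<lambda>\<omega>. d (shift (int (Suc n)) \<omega>)) powr min 2 p"
    by (intro martingale_difference_smooth p x Lp_space_shift d')
  also have "Lp_norm M p (\<lambda>\<omega>. d (shift (int (Suc n)) \<omega>)) = Lp_norm M p d"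
    by (rule Lp_norm_shift[OF Lp_space_measurable[OF d'(1)]])
  also have "Lp_norm M p x powr min 2 p \<le> real n * (smooth_const p * Lp_norm M p d powr min 2 p)"
    unfolding x_def by (rule Suc.IH)
  finally show ?case
    by (simp add: x_def algebra_simps)
qed simp

lemma stationary_martingale_norm:
  fixes d :: "'a \<Rightarrow> 'h::{real_inner, banach, second_countable_topology}"
  assumes p: "p > 1" and d: "martingale_difference p d"
  shows "Lp_norm M p (\<lambda>\<omega>. \<Sum>k=1..n. d (shift (int k) \<omega>))
    \<le> smooth_const p powr (1 / min 2 p) * real n powr (1 / min 2 p) * Lp_norm M p d"
proof -
  define r where "r = min 2 p"
  have r: "r > 0"
    using p by (simp add: r_def)
  have "(Lp_norm M p (\<lambda>\<omega>. \<Sum>k=1..n. d (shift (int k) \<omega>)) powr r) powr (1 / r)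
      \<le> (real n * (smooth_const p * Lp_norm M p d powr r)) powr (1 / r)"
    using stationary_martingale_bound[OF p d, of n] r by (intro powr_mono2) (auto simp: r_def)
  then show ?thesis
    using r by (simp add: powr_powr powr_mult mult_ac flip: r_def)
qed

text \<open>The trivial bound, linear in the number of terms. It suffices where d may be chosen
  small, or where the sum is afterwards divided by a number at least as large.\<close>

lemma Lp_norm_sum_shift_le:
  fixes d :: "'a \<Rightarrow> 'h::{real_inner, banach, second_countable_topology}"
  assumes p: "p \<ge> 1" and d: "d \<in> Lp_space M p"
  shows "Lp_norm M p (\<lambda>\<omega>. \<Sum>k\<in>I. d (shift (int k) \<omega>)) \<le> real (card I) * Lp_norm M p d"
proof -
  have "Lp_norm M p (\<lambda>\<omega>. \<Sum>k\<in>I. d (shift (int k) \<omega>)) \<le> (\<Sum>k\<in>I. Lp_norm M p (\<lambda>\<omega>. d (shift (int k) \<omega>)))"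
    by (intro Lp_space_sum(2)[where f = "\<lambda>k \<omega>. d (shift (int k) \<omega>)"] Lp_space_shift d p)
  also have "\<dots> = (\<Sum>k\<in>I. Lp_norm M p d)"
    by (intro sum.cong refl Lp_norm_shift Lp_space_measurable[OF d])
  finally show ?thesis
    by simp
qed

text \<open>A limit in \<open>L\<^sup>p\<close> of martingale differences need not be measurable with respect to
  \<open>past 0\<close>, only almost surely equal to such a function.\<close>

lemma stationary_martingale_norm_approx:
  fixes d :: "'a \<Rightarrow> 'h::{real_inner, banach, second_countable_topology}"
  assumes p: "p > 1" and d: "d \<in> Lp_space M p"
    and approx: "\<And>\<epsilon>. \<epsilon> > 0 \<Longrightarrow> \<exists>e. martingale_difference p e \<and> Lp_norm M p (\<lambda>\<omega>. d \<omega> - e \<omega>) \<le> \<epsilon>"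
  shows "Lp_norm M p (\<lambda>\<omega>. \<Sum>k=1..n. d (shift (int k) \<omega>))
    \<le> smooth_const p powr (1 / min 2 p) * real n powr (1 / min 2 p) * Lp_norm M p d"
proof (rule field_le_epsilon)
  fix \<delta> :: real assume \<delta>: "\<delta> > 0"
  define K where "K = smooth_const p powr (1 / min 2 p) * real n powr (1 / min 2 p)"
  have K: "K \<ge> 0"
    by (simp add: K_def)
  \<comment> \<open>Since \<epsilon> is chosen after n, the trivial bound
    \<open>n * \<epsilon>\<close> for the sum of the errors is harmless.\<close>
  define \<epsilon> where "\<epsilon> = \<delta> / (K + real n + 1)"
  have \<epsilon>: "\<epsilon> > 0"
    using \<delta> K by (simp add: \<epsilon>_def add_nonneg_pos)
  then obtain e where e: "martingale_difference p e" "Lp_norm M p (\<lambda>\<omega>. d \<omega> - e \<omega>) \<le> \<epsilon>"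
    using approx by blast
  have p1: "p \<ge> 1"
    using p by simp
  have eL: "e \<in> Lp_space M p"
    using e(1) by (simp add: martingale_difference_def)
  have de: "(\<lambda>\<omega>. d \<omega> - e \<omega>) \<in> Lp_space M p"
    by (rule Lp_space_diff(1)[OF p1 d eL])
  have "Lp_norm M p (\<lambda>\<omega>. \<Sum>k=1..n. d (shift (int k) \<omega>)) \<le> Lp_norm M p (\<lambda>\<omega>. \<Sum>k=1..n. e (shift (int k) \<omega>))
      + Lp_norm M p (\<lambda>\<omega>. (\<Sum>k=1..n. d (shift (int k) \<omega>)) - (\<Sum>k=1..n. e (shift (int k) \<omega>)))"
    by (intro Lp_norm_triangle_sub Lp_space_sum(1) Lp_space_shift p1 d eL)
  moreover have "Lp_norm M p (\<lambda>\<omega>. \<Sum>k=1..n. e (shift (int k) \<omega>)) \<le> K * Lp_norm M p e"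
    unfolding K_def by (rule stationary_martingale_norm[OF p e(1)])
  moreover have "Lp_norm M p e \<le> Lp_norm M p d + \<epsilon>"
    using Lp_norm_triangle_sub[OF p1 eL d] e(2) by (simp add: Lp_norm_diff_commute[of M p e])
  then have "K * Lp_norm M p e \<le> K * (Lp_norm M p d + \<epsilon>)"
    using K by (rule mult_left_mono)
  moreover have "Lp_norm M p (\<lambda>\<omega>. (\<Sum>k=1..n. d (shift (int k) \<omega>)) - (\<Sum>k=1..n. e (shift (int k) \<omega>)))
      \<le> real n * \<epsilon>"
    using Lp_norm_sum_shift_le[OF p1 de, of "{1..n}"] mult_left_mono[OF e(2), of "real n"]
    by (simp add: sum_subtractf)
  ultimately have "Lp_norm M p (\<lambda>\<omega>. \<Sum>k=1..n. d (shift (int k) \<omega>)) \<le> K * Lp_norm M p d + (K + real n) * \<epsilon>"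
    unfolding distrib_left distrib_right by linarith
  also have "(K + real n) * \<epsilon> \<le> \<delta>"
    using \<delta> K by (simp add: \<epsilon>_def field_simps)
  finally show "Lp_norm M p (\<lambda>\<omega>. \<Sum>k=1..n. d (shift (int k) \<omega>))
      \<le> smooth_const p powr (1 / min 2 p) * real n powr (1 / min 2 p) * Lp_norm M p d + \<delta>"
    by (simp add: K_def)
qed

section \<open>Linear combinations of martingale differences\<close>

lemma martingale_difference_add:
  assumes p: "p \<ge> 1" and "martingale_difference p d" "martingale_difference p e"
  shows "martingale_difference p (\<lambda>\<omega>. d \<omega> + e \<omega>)"
proof -
  interpret prob_subalgebra M "past (- 1)"
    by (rule prob_subalgebra_past)
  show ?thesis
    using assms has_cond_exp_add[of d "\<lambda>_. 0" e "\<lambda>_. 0"]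
    by (auto simp: martingale_difference_def Lp_space_add)
qed

lemma martingale_difference_scaleR:
  assumes "martingale_difference p d"
  shows "martingale_difference p (\<lambda>\<omega>. c *\<^sub>R d \<omega>)"
proof -
  interpret prob_subalgebra M "past (- 1)"
    by (rule prob_subalgebra_past)
  show ?thesis
    using assms has_cond_exp_scaleR[of d "\<lambda>_. 0" c]
    by (auto simp: martingale_difference_def Lp_space_scaleR)
qed

lemma martingale_difference_zero: "martingale_difference p (\<lambda>_. 0)"
proof -
  interpret prob_subalgebra M "past (- 1)"
    by (rule prob_subalgebra_past)
  show ?thesis
    using has_cond_exp_zero by (simp add: martingale_difference_def)
qed

lemma martingale_difference_diff:
  assumes p: "p \<ge> 1" and "martingale_difference p d" "martingale_difference p e"
  shows "martingale_difference p (\<lambda>\<omega>. d \<omega> - e \<omega>)"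
  using martingale_difference_add[OF p assms(2) martingale_difference_scaleR[OF assms(3), of "-1"]] by simp

lemma martingale_difference_sum:
  assumes p: "p \<ge> 1" and "\<And>i. i \<in> I \<Longrightarrow> martingale_difference p (d i)"
  shows "martingale_difference p (\<lambda>\<omega>. \<Sum>i\<in>I. d i \<omega>)"
  using assms(2)
proof (induction I rule: infinite_finite_induct)
  case (insert x I)
  then show ?case
    using martingale_difference_add[OF p, of "d x" "\<lambda>\<omega>. \<Sum>i\<in>I. d i \<omega>"] by simp
qed (simp_all add: martingale_difference_zero)

end

section \<open>Estimates for subadditive sequences\<close>

text \<open>A substitute for monotonicity. The inequality \<open>s i \<le> s (i + k) + s k\<close>
  is averaged over the N values of k in [N, 2N); as i is at most 2N, both arguments lie in [N, 4N),
  a block on which \<open>s k\<close> is at most \<open>(4 * N) powr (1 + \<rho>)\<close> times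
  \<open>a k\<close>.\<close>

lemma subadditive_le_tail:
  fixes s a :: "nat \<Rightarrow> real" and \<rho> :: real
  assumes \<rho>: "0 < \<rho>" "\<rho> \<le> 1 / 2" and s: "\<And>n. 0 \<le> s n" and sub: "\<And>i k. s i \<le> s (i + k) + s k"
    and a: "\<And>n. a n = s n / real n powr (1 + \<rho>)" and summ: "summable a"
    and N: "N \<ge> 1" "i \<le> 2 * N"
  shows "s i \<le> 16 * real N powr \<rho> * (\<Sum>j. a (N + j))"
proof -
  define T where "T = (\<Sum>j. a (N + j))"
  have a_nonneg: "0 \<le> a n" for n
    by (simp add: a s)
  have summ': "summable (\<lambda>j. a (N + j))"
    using summ by (subst add.commute) (simp add: summable_iff_shift)
  have "(\<Sum>k\<in>{N..<4*N}. s k) \<le> (\<Sum>k\<in>{N..<4*N}. real (4 * N) powr (1 + \<rho>) * a k)"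
  proof (rule sum_mono)
    fix k assume k: "k \<in> {N..<4*N}"
    then have k0: "real k > 0"
      using N by auto
    have "real k powr (1 + \<rho>) \<le> real (4 * N) powr (1 + \<rho>)"
      using k \<rho> by (intro powr_mono2) auto
    then have "real k powr (1 + \<rho>) * a k \<le> real (4 * N) powr (1 + \<rho>) * a k"
      using a_nonneg by (rule mult_right_mono)
    then show "s k \<le> real (4 * N) powr (1 + \<rho>) * a k"
      using k0 by (simp add: a)
  qed
  also have "\<dots> = real (4 * N) powr (1 + \<rho>) * (\<Sum>k\<in>{N..<4*N}. a k)"
    by (simp add: sum_distrib_left)
  also have "(\<Sum>k\<in>{N..<4*N}. a k) = (\<Sum>j<3*N. a (N + j))"
    by (rule sum.reindex_bij_witness[of _ "\<lambda>j. N + j" "\<lambda>k. k - N"]) auto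
  also have "real (4 * N) powr (1 + \<rho>) * (\<Sum>j<3*N. a (N + j)) \<le> real (4 * N) powr (1 + \<rho>) * T"
    unfolding T_def using summ' a_nonneg by (intro mult_left_mono sum_le_suminf) auto
  also have "\<dots> \<le> (8 * real N powr (1 + \<rho>)) * T"
  proof (rule mult_right_mono)
    \<comment> \<open>The bound \<rho> \<le> 1/2 is used here: the block of length 3N costs the
      factor 8, and it is counted twice, whence 16.\<close>
    have "(4::real) powr (1 + \<rho>) \<le> 4 powr (3 / 2)"
      using \<rho> by (intro powr_mono) auto
    also have "(4::real) powr (3 / 2) = (2 powr 2) powr (3 / 2)"
      by (simp add: powr_numeral)
    also have "\<dots> = 8"
      unfolding powr_powr by (simp add: powr_numeral)
    finally have "4 powr (1 + \<rho>) * real N powr (1 + \<rho>) \<le> 8 * real N powr (1 + \<rho>)"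
      by (intro mult_right_mono) auto
    then show "real (4 * N) powr (1 + \<rho>) \<le> 8 * real N powr (1 + \<rho>)"
      by (simp add: powr_mult)
    show "0 \<le> T"
      unfolding T_def using summ' a_nonneg by (intro suminf_nonneg) auto
  qed
  finally have total: "(\<Sum>k\<in>{N..<4*N}. s k) \<le> 8 * real N powr (1 + \<rho>) * T" .
  have "real N * s i = (\<Sum>k\<in>{N..<2*N}. s i)"
    by simp
  also have "\<dots> \<le> (\<Sum>k\<in>{N..<2*N}. s (i + k) + s k)"
    by (intro sum_mono sub)
  also have "\<dots> = (\<Sum>k\<in>(+) i ` {N..<2*N}. s k) + (\<Sum>k\<in>{N..<2*N}. s k)"
    by (simp add: sum.distrib sum.reindex del: image_add_atLeastLessThan)
  also have "\<dots> \<le> (\<Sum>k\<in>{N..<4*N}. s k) + (\<Sum>k\<in>{N..<4*N}. s k)"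
    using N s by (intro add_mono sum_mono2) (auto simp del: image_add_atLeastLessThan)
  also have "\<dots> \<le> 16 * real N powr (1 + \<rho>) * T"
    using total by (simp add: mult_ac)
  also have "\<dots> = real N * (16 * real N powr \<rho> * T)"
    using N by (simp add: powr_add)
  finally show ?thesis
    using N by (simp add: T_def)
qed

text \<open>Telescoping against \<open>n powr (1 - 2 * r)\<close>. After division a step reads
  \<open>1 + 1/t \<le> (t / (t - 1)) powr (2 * r - 1)\<close> and follows from the exponent 1, so no
  constant depending on r appears.\<close>

lemma sum_powr_tail_le:
  fixes r :: real and K L :: nat
  assumes r: "r \<ge> 1" and K: "K \<ge> 1"
  shows "(\<Sum>n\<in>{K<..L}. real n powr (- (2 * r))) \<le> real K powr (1 - 2 * r)"
proof -
  have step: "real (Suc n) powr (- (2 * r)) + real (Suc n) powr (1 - 2 * r) \<le> real n powr (1 - 2 * r)"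
    if n: "n \<ge> 1" for n
  proof -
    define t where "t = real (Suc n)"
    have t: "t > 1" "t - 1 = real n"
      using n by (auto simp: t_def)
    have "1 + 1 / t \<le> t / (t - 1)"
      using t(1) by (simp add: field_simps)
    also have "\<dots> = (t / (t - 1)) powr 1"
      using t(1) by simp
    also have "\<dots> \<le> (t / (t - 1)) powr (2 * r - 1)"
      using t(1) r by (intro powr_mono) auto
    finally have "t powr (1 - 2 * r) * (1 + 1 / t) \<le> t powr (1 - 2 * r) * (t / (t - 1)) powr (2 * r - 1)"
      by (intro mult_left_mono) auto
    also have "(t / (t - 1)) powr (2 * r - 1) = t powr (2 * r - 1) * (t - 1) powr (1 - 2 * r)"
      using t(1) powr_minus[of "t - 1" "2 * r - 1"] by (simp only: powr_divide) (simp add: divide_inverse)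
    also have "t powr (1 - 2 * r) * (t powr (2 * r - 1) * (t - 1) powr (1 - 2 * r)) = (t - 1) powr (1 - 2 * r)"
      using t(1) by (simp flip: mult.assoc powr_add)
    also have "t powr (1 - 2 * r) * (1 + 1 / t) = t powr (1 - 2 * r) + t powr (- (2 * r))"
    proof -
      have "t powr (1 - 2 * r) = t * t powr (- (2 * r))"
        using t(1) powr_mult_base[of t "- (2 * r)"] by simp
      then show ?thesis
        using t(1) by (simp add: distrib_left)
    qed
    finally show ?thesis
      using t by (simp add: t_def add.commute)
  qed
  show ?thesis
  proof (cases "K \<le> L")
    case True
    then have "(\<Sum>n\<in>{K<..L}. real n powr (- (2 * r))) + real L powr (1 - 2 * r) \<le> real K powr (1 - 2 * r)"
    proof (induction L rule: dec_induct)
      case (step L)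
      have "{K<..Suc L} = insert (Suc L) {K<..L}"
        using step.hyps by auto
      then show ?case
        using step.IH \<open>\<And>n. n \<ge> 1 \<Longrightarrow> _\<close>[of L] step.hyps K by simp
    qed simp
    moreover have "0 \<le> real L powr (1 - 2 * r)"
      by simp
    ultimately show ?thesis
      by linarith
  qed simp
qed

text \<open>Hoelder's inequality, obtained by summing Young's inequality over normalised factors:
  \<beta> normalises b, and \<Omega> bounds the norm of the weights in the conjugate exponent
  r.\<close>

lemma weighted_sum_le:
  fixes b :: "nat \<Rightarrow> real" and P \<beta> :: real and N m :: nat
  assumes P: "P > 1" and b: "\<And>n. 0 \<le> b n" and \<beta>: "\<beta> \<ge> 0"
    and sum: "(\<Sum>n\<in>{N<..L}. b n powr P) \<le> \<beta> powr P" and m: "m \<ge> 1"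
  shows "(\<Sum>n\<in>{N<..L}. b n / real (n + m) ^ 2) \<le> \<beta> * real (N + m) powr (- (1 + 1 / P))"
\<comment> \<open>For \<beta> = 0 there is nothing to divide by, but then every \<open>b n\<close>
  in the range vanishes.\<close>
proof (cases "\<beta> = 0")
  case True
  have "b n = 0" if "n \<in> {N<..L}" for n
  proof -
    have "b n powr P \<le> (\<Sum>n\<in>{N<..L}. b n powr P)"
      using that by (intro member_le_sum) auto
    also have "\<dots> \<le> 0"
      using sum True by simp
    finally show ?thesis
      by simp
  qed
  then show ?thesis
    by (simp add: True)
next
  case False
  then have \<beta>: "\<beta> > 0"
    using \<beta> by simp
  define r where "r = P / (P - 1)"
  have r: "r > 1" "1 / P + 1 / r = 1"
    using P by (auto simp: r_def field_simps)
  have inv_r: "1 / r = 1 - 1 / P"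
    using r(2) by linarith
  define \<Omega> where "\<Omega> = real (N + m) powr (- (1 + 1 / P))"
  have \<Omega>: "\<Omega> > 0"
    using m by (simp add: \<Omega>_def)
  \<comment> \<open>The exponent in the hypothesis of the theorem comes from this identity.\<close>
  have exponent: "- (1 + 1 / P) * r = 1 - 2 * r"
  proof -
    have "- (1 + 1 / P) = 1 / r - 2"
      using inv_r by linarith
    moreover have "(1 / r - 2) * r = 1 - 2 * r"
      using r(1) by (simp add: left_diff_distrib)
    ultimately show ?thesis
      by (simp only:)
  qed
  have \<Omega>_r: "\<Omega> powr r = real (N + m) powr (1 - 2 * r)"
    by (simp only: \<Omega>_def powr_powr exponent)
  have young: "(b n / \<beta>) * ((1 / real (n + m) ^ 2) / \<Omega>)
      \<le> b n powr P / \<beta> powr P / P + real (n + m) powr (- (2 * r)) / \<Omega> powr r / r" for n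
  proof -
    have "(1 / real (n + m) ^ 2) powr r = real (n + m) powr (- (2 * r))"
      using m by (simp add: powr_divide powr_minus_divide powr_powr flip: powr_numeral)
    then have "((1 / real (n + m) ^ 2) / \<Omega>) powr r = real (n + m) powr (- (2 * r)) / \<Omega> powr r"
      by (simp only: powr_divide)
    then show ?thesis
      using Youngs_inequality[OF P r(1) r(2), of "b n / \<beta>" "(1 / real (n + m) ^ 2) / \<Omega>"] b \<beta> \<Omega>
      by (simp only: powr_divide) simp
  qed
  have "(\<Sum>n\<in>{N<..L}. b n / real (n + m) ^ 2) / (\<beta> * \<Omega>)
      = (\<Sum>n\<in>{N<..L}. (b n / \<beta>) * ((1 / real (n + m) ^ 2) / \<Omega>))"
    by (simp add: sum_divide_distrib mult_ac)
  also have "\<dots> \<le> (\<Sum>n\<in>{N<..L}. b n powr P / \<beta> powr P / P + real (n + m) powr (- (2 * r)) / \<Omega> powr r / r)"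
    by (intro sum_mono young)
  also have "\<dots> = (\<Sum>n\<in>{N<..L}. b n powr P) / \<beta> powr P / P
      + (\<Sum>n\<in>{N<..L}. real (n + m) powr (- (2 * r))) / \<Omega> powr r / r"
    by (simp add: sum.distrib sum_divide_distrib)
  also have "(\<Sum>n\<in>{N<..L}. real (n + m) powr (- (2 * r))) = (\<Sum>n\<in>{N+m<..L+m}. real n powr (- (2 * r)))"
    by (rule sum.reindex_bij_witness[of _ "\<lambda>k. k - m" "\<lambda>k. k + m"]) auto
  also have "(\<Sum>n\<in>{N<..L}. b n powr P) / \<beta> powr P / P
      + (\<Sum>n\<in>{N+m<..L+m}. real n powr (- (2 * r))) / \<Omega> powr r / r \<le> 1 / P + 1 / r"
  proof (intro add_mono divide_right_mono)
    show "(\<Sum>n\<in>{N<..L}. b n powr P) / \<beta> powr P \<le> 1"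
      using sum \<beta> by simp
    show "(\<Sum>n\<in>{N+m<..L+m}. real n powr (- (2 * r))) / \<Omega> powr r \<le> 1"
      using sum_powr_tail_le[of r "N + m" "L + m", folded \<Omega>_r] r(1) m \<Omega> by simp
  qed (use P r in auto)
  finally show ?thesis
    unfolding \<Omega>_def[symmetric] using r(2) \<beta> \<Omega> by simp
qed

text \<open>From i = N - 1 on, the terms are at most \<open>a (i + 1)\<close> and add up to at most
  the tail T. Each of the N - 1 earlier ones is at most \<open>16 * T / N\<close> by the substitute
  for monotonicity; hence 17. Summability is claimed for N = 0 as well, where there is no bound by
  the tail.\<close>

lemma suminf_shifted_weight_le:
  fixes s a :: "nat \<Rightarrow> real" and \<rho> :: real
  assumes \<rho>: "0 < \<rho>" "\<rho> \<le> 1 / 2" and s: "\<And>n. 0 \<le> s n" and sub: "\<And>i k. s i \<le> s (i + k) + s k"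
    and a: "\<And>n. a n = s n / real n powr (1 + \<rho>)" and summ: "summable a"
  shows "summable (\<lambda>i. s (i + 1) * real (N + i + 1) powr (- (1 + \<rho>)))"
    and "N \<ge> 1 \<Longrightarrow> (\<Sum>i. s (i + 1) * real (N + i + 1) powr (- (1 + \<rho>))) \<le> 17 * (\<Sum>j. a (N + j))"
proof -
  define h where "h = (\<lambda>i. s (i + 1) * real (N + i + 1) powr (- (1 + \<rho>)))"
  have a_nonneg: "0 \<le> a n" for n
    by (simp add: a s)
  have le: "s n * real (N + n) powr (- (1 + \<rho>)) \<le> a n" if "n \<ge> 1" for n
  proof -
    have "real (N + n) powr (- (1 + \<rho>)) \<le> real n powr (- (1 + \<rho>))"
      using that \<rho> by (intro powr_mono2') auto
    then have "s n * real (N + n) powr (- (1 + \<rho>)) \<le> s n * real n powr (- (1 + \<rho>))"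
      using s by (intro mult_left_mono)
    then show ?thesis
      using that by (simp only: a powr_minus divide_inverse)
  qed
  have h_le: "h i \<le> a (i + 1)" and h_nonneg: "0 \<le> h i" for i
    using le[of "i + 1"] s by (simp_all add: h_def add.assoc)
  have "summable (\<lambda>i. a (i + 1))"
    using summ by (simp only: summable_iff_shift)
  then have h: "summable h"
    by (rule summable_comparison_test'[where N = 0]) (use h_le h_nonneg in auto)
  then show "summable (\<lambda>i. s (i + 1) * real (N + i + 1) powr (- (1 + \<rho>)))"
    by (simp add: h_def)
  assume N: "N \<ge> 1"
  define T where "T = (\<Sum>j. a (N + j))"
  have summ': "summable (\<lambda>j. a (N + j))"
    using summ by (subst add.commute) (simp add: summable_iff_shift)
  have T: "T \<ge> 0"
    unfolding T_def using summ' a_nonneg by (intro suminf_nonneg) auto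
  have "(\<Sum>i. h i) = (\<Sum>i. h (i + (N - 1))) + (\<Sum>i<N-1. h i)"
    using h by (rule suminf_split_initial_segment)
  also have "(\<Sum>i. h (i + (N - 1))) \<le> T"
    unfolding T_def
  proof (rule suminf_le)
    show "h (i + (N - 1)) \<le> a (N + i)" for i
      using h_le[of "i + (N - 1)"] N by (simp add: add.commute)
    show "summable (\<lambda>i. h (i + (N - 1)))"
      using h by (simp only: summable_iff_shift)
  qed (rule summ')
  also have "(\<Sum>i<N-1. h i) \<le> (\<Sum>i<N-1. 16 * T / real N)"
  proof (rule sum_mono)
    fix i assume i: "i \<in> {..<N-1}"
    have "h i \<le> (16 * real N powr \<rho> * T) * real N powr (- (1 + \<rho>))"
      unfolding h_def
    proof (rule mult_mono)
      show "s (i + 1) \<le> 16 * real N powr \<rho> * T"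
        unfolding T_def using i N by (intro subadditive_le_tail[OF \<rho> s sub a summ]) auto
      show "real (N + i + 1) powr (- (1 + \<rho>)) \<le> real N powr (- (1 + \<rho>))"
        using N \<rho> by (intro powr_mono2') auto
    qed (use T in auto)
    also have "\<dots> = 16 * T * (real N powr \<rho> * real N powr (- (1 + \<rho>)))"
      by simp
    also have "real N powr \<rho> * real N powr (- (1 + \<rho>)) = real N powr (-1)"
      by (simp flip: powr_add)
    also have "\<dots> = 1 / real N"
      using N by (simp add: powr_minus_divide)
    finally show "h i \<le> 16 * T / real N"
      by simp
  qed
  also have "(\<Sum>i<N-1. 16 * T / real N) = (real (N - 1) / real N) * (16 * T)"
    by simp
  also have "\<dots> \<le> 1 * (16 * T)"
    using N T by (intro mult_right_mono) auto
  finally show "(\<Sum>i. s (i + 1) * real (N + i + 1) powr (- (1 + \<rho>))) \<le> 17 * (\<Sum>j. a (N + j))"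
    by (simp add: h_def T_def)
qed

section \<open>Adapted stationary sequences\<close>

lemma Lp_space_cong:
  assumes "\<And>\<omega>. \<omega> \<in> space M \<Longrightarrow> f \<omega> = g \<omega>"
  shows "f \<in> Lp_space M p \<longleftrightarrow> g \<in> Lp_space M p"
proof -
  have "f \<in> borel_measurable M \<longleftrightarrow> g \<in> borel_measurable M"
    using assms by (rule measurable_cong)
  moreover have "integrable M (\<lambda>\<omega>. norm (f \<omega>) powr p) \<longleftrightarrow> integrable M (\<lambda>\<omega>. norm (g \<omega>) powr p)"
    using assms by (intro Bochner_Integration.integrable_cong) auto
  ultimately show ?thesis
    by (simp add: Lp_space_def)
qed

text \<open>Serves both for the recursion between consecutive tails and for the tail that starts at
  0, which the norm estimates do not reach.\<close>

lemma Lp_sums_Suc: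
  fixes f :: "nat \<Rightarrow> 'a \<Rightarrow> 'b::{banach, second_countable_topology}"
  assumes p: "p \<ge> 1" and sums: "Lp_sums M p (\<lambda>n. f (Suc n)) g" and f0: "f 0 \<in> Lp_space M p"
  shows "Lp_sums M p f (\<lambda>\<omega>. f 0 \<omega> + g \<omega>)"
proof -
  have f: "f n \<in> Lp_space M p" for n
    using sums f0 by (cases n) (auto simp: Lp_sums_def)
  have "(\<lambda>n. Lp_norm M p (\<lambda>\<omega>. (\<Sum>i<Suc n. f i \<omega>) - (f 0 \<omega> + g \<omega>))) \<longlonglongrightarrow> 0"
    using sums by (simp add: Lp_sums_def sum.lessThan_Suc_shift del: sum.lessThan_Suc)
  then have "(\<lambda>n. Lp_norm M p (\<lambda>\<omega>. (\<Sum>i<n. f i \<omega>) - (f 0 \<omega> + g \<omega>))) \<longlonglongrightarrow> 0"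
    by (rule LIMSEQ_imp_Suc)
  then show ?thesis
    using f sums f0 p by (auto simp: Lp_sums_def intro: Lp_space_add(1))
qed

lemma (in prob_space) Lp_sums_unique:
  fixes f :: "nat \<Rightarrow> 'a \<Rightarrow> 'b::{banach, second_countable_topology}"
  assumes p: "p \<ge> 1" and "Lp_sums M p f g" "Lp_sums M p f h"
  shows "AE \<omega> in M. g \<omega> = h \<omega>"
proof -
  have g: "g \<in> Lp_space M p" and h: "h \<in> Lp_space M p"
    and lim: "(\<lambda>n. Lp_norm M p (\<lambda>\<omega>. (\<Sum>i<n. f i \<omega>) - h \<omega>)) \<longlonglongrightarrow> 0"
    using assms by (auto simp: Lp_sums_def)
  have "Lp_norm M p (\<lambda>\<omega>. g \<omega> - h \<omega>) \<le> 0"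
  proof (rule field_le_epsilon)
    fix e :: real assume "e > 0"
    then have "eventually (\<lambda>n. Lp_norm M p (\<lambda>\<omega>. (\<Sum>i<n. f i \<omega>) - h \<omega>) < e) sequentially"
      by (rule order_tendstoD(2)[OF lim])
    then have "eventually (\<lambda>n. Lp_norm M p (\<lambda>\<omega>. (\<Sum>i<n. f i \<omega>) - h \<omega>) \<le> e) sequentially"
      by (rule eventually_mono) simp
    then show "Lp_norm M p (\<lambda>\<omega>. g \<omega> - h \<omega>) \<le> 0 + e"
      using Lp_sums_norm_diff_le[OF p assms(2) h] by simp
  qed
  then have "AE \<omega> in M. g \<omega> - h \<omega> = 0"
    by (intro Lp_norm_eq_0_imp_AE[OF p] Lp_space_diff(1) p g h)
  then show ?thesis
    by simp
qed

text \<open>Meant for summation by parts: the series of f' need not converge absolutely, but its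
  partial sums approach those of a series that does, and so it inherits limit and bound.\<close>

lemma (in prob_space) Lp_summable_perturb:
  fixes f f' :: "nat \<Rightarrow> 'a \<Rightarrow> 'b::{banach, second_countable_topology}"
  assumes p: "p \<ge> 1" and f: "\<And>n. f n \<in> Lp_space M p" and f': "\<And>n. f' n \<in> Lp_space M p"
    and summ: "summable (\<lambda>n. Lp_norm M p (f n))"
    and diff: "(\<lambda>n. Lp_norm M p (\<lambda>\<omega>. (\<Sum>i<n. f' i \<omega>) - (\<Sum>i<n. f i \<omega>))) \<longlonglongrightarrow> 0"
  shows "Lp_summable M p f'" "Lp_norm M p (Lp_suminf M p f') \<le> (\<Sum>n. Lp_norm M p (f n))"
proof -
  have S: "(\<lambda>\<omega>. \<Sum>i<n. f i \<omega>) \<in> Lp_space M p" "(\<lambda>\<omega>. \<Sum>i<n. f' i \<omega>) \<in> Lp_space M p" for n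
    by (intro Lp_space_sum(1) p f f')+
  obtain g where g: "g \<in> Lp_space M p" "(\<lambda>n. Lp_norm M p (\<lambda>\<omega>. (\<Sum>i<n. f i \<omega>) - g \<omega>)) \<longlonglongrightarrow> 0"
    using Lp_summable_norm[OF p f summ] by (auto simp: Lp_summable_def Lp_sums_def)
  have "(\<lambda>n. Lp_norm M p (\<lambda>\<omega>. (\<Sum>i<n. f' i \<omega>) - g \<omega>)) \<longlonglongrightarrow> 0"
  proof (rule tendsto_sandwich[OF _ _ tendsto_const])
    show "(\<lambda>n. Lp_norm M p (\<lambda>\<omega>. (\<Sum>i<n. f' i \<omega>) - (\<Sum>i<n. f i \<omega>))
        + Lp_norm M p (\<lambda>\<omega>. (\<Sum>i<n. f i \<omega>) - g \<omega>)) \<longlonglongrightarrow> 0"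
      using tendsto_add[OF diff g(2)] by simp
    show "eventually (\<lambda>n. Lp_norm M p (\<lambda>\<omega>. (\<Sum>i<n. f' i \<omega>) - g \<omega>)
      \<le> Lp_norm M p (\<lambda>\<omega>. (\<Sum>i<n. f' i \<omega>) - (\<Sum>i<n. f i \<omega>))
        + Lp_norm M p (\<lambda>\<omega>. (\<Sum>i<n. f i \<omega>) - g \<omega>)) sequentially"
      by (intro always_eventually allI Lp_norm_diff_triangle p S g)
  qed simp
  then have sums': "Lp_sums M p f' g"
    using f' g(1) by (simp add: Lp_sums_def)
  then show summ': "Lp_summable M p f'"
    by (auto simp: Lp_summable_def)
  have suminf': "Lp_sums M p f' (Lp_suminf M p f')"
    using summ' by (rule Lp_sums_suminf)
  have "Lp_norm M p (\<lambda>\<omega>. Lp_suminf M p f' \<omega> - 0) \<le> (\<Sum>n. Lp_norm M p (f n))"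
  proof (rule field_le_epsilon)
    fix e :: real assume "e > 0"
    then have "eventually (\<lambda>n. Lp_norm M p (\<lambda>\<omega>. (\<Sum>i<n. f' i \<omega>) - (\<Sum>i<n. f i \<omega>)) < e) sequentially"
      by (rule order_tendstoD(2)[OF diff])
    then have "eventually (\<lambda>n. Lp_norm M p (\<lambda>\<omega>. (\<Sum>i<n. f' i \<omega>) - 0) \<le> (\<Sum>n. Lp_norm M p (f n)) + e) sequentially"
    proof eventually_elim
      case (elim n)
      have "Lp_norm M p (\<lambda>\<omega>. \<Sum>i<n. f i \<omega>) \<le> (\<Sum>i<n. Lp_norm M p (f i))"
        by (intro Lp_space_sum(2) p f)
      also have "\<dots> \<le> (\<Sum>n. Lp_norm M p (f n))"
        using summ by (intro sum_le_suminf) auto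
      finally show ?case
        using elim Lp_norm_triangle_sub[OF p S(2)[of n] S(1)[of n]] by simp
    qed
    then show "Lp_norm M p (\<lambda>\<omega>. Lp_suminf M p f' \<omega> - 0) \<le> (\<Sum>n. Lp_norm M p (f n)) + e"
      by (rule Lp_sums_norm_diff_le[OF p suminf' Lp_space_zero])
  qed
  then show "Lp_norm M p (Lp_suminf M p f') \<le> (\<Sum>n. Lp_norm M p (f n))"
    by simp
qed

locale adapted_sequence = stationary_filtration M \<theta> F0
  for M :: "'a measure" and \<theta> :: "'a \<Rightarrow> 'a" and F0 :: "'a measure" +
  fixes p :: real and X :: "int \<Rightarrow> 'a \<Rightarrow> 'h::{real_inner, banach, second_countable_topology}"
  assumes p: "p > 1" and X: "adapted_stationary M \<theta> F0 p X"
begin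

lemma p1: "p \<ge> 1"
  using p by simp

section \<open>Projections on two successive pasts\<close>

definition Y :: "nat \<Rightarrow> 'a \<Rightarrow> 'h" where
  "Y k = cond_exp M (past 0) (X (int k))"

definition Z :: "nat \<Rightarrow> 'a \<Rightarrow> 'h" where
  "Z k = cond_exp M (past (- 1)) (X (int k))"

definition increment :: "nat \<Rightarrow> 'a \<Rightarrow> 'h" where
  "increment k = proj_op M \<theta> F0 0 (X (int k))"

lemma increment_eq: "increment k \<omega> = Y k \<omega> - Z k \<omega>"
  by (simp add: increment_def proj_op_def Y_def Z_def)

lemma X_shift: "\<omega> \<in> space M \<Longrightarrow> X i \<omega> = X 0 (shift i \<omega>)"
  using X by (simp add: adapted_stationary_def)

lemma X_Lp: "X i \<in> Lp_space M p"
proof -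
  have "X 0 \<in> Lp_space M p"
    using X by (simp add: adapted_stationary_def)
  then have "(\<lambda>\<omega>. X 0 (shift i \<omega>)) \<in> Lp_space M p"
    by (rule Lp_space_shift)
  then show ?thesis
    using Lp_space_cong[of M "X i" "\<lambda>\<omega>. X 0 (shift i \<omega>)" p] X_shift by blast
qed

lemma X_integrable: "integrable M (X i)"
  using Lp_imp_L1(1)[OF p1 X_Lp] .

lemma Y_cond_exp: "has_cond_exp M (past 0) (X (int k)) (Y k)"
  unfolding Y_def using X_integrable by (rule prob_subalgebra.has_cond_exp_cond_exp[OF prob_subalgebra_past])

lemma Z_cond_exp: "has_cond_exp M (past (- 1)) (X (int k)) (Z k)"
  unfolding Z_def using X_integrable by (rule prob_subalgebra.has_cond_exp_cond_exp[OF prob_subalgebra_past])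

lemma Y_Lp: "Y k \<in> Lp_space M p"
  using prob_subalgebra.has_cond_exp_Lp(1)[OF prob_subalgebra_past p1 Y_cond_exp X_Lp] .

lemma Z_Lp: "Z k \<in> Lp_space M p"
  using prob_subalgebra.has_cond_exp_Lp(1)[OF prob_subalgebra_past p1 Z_cond_exp X_Lp] .

lemma Y_Z_cond_exp: "has_cond_exp M (past (- 1)) (Y k) (Z k)"
  by (rule has_cond_exp_tower[OF past_mono Y_cond_exp Z_cond_exp]) simp

text \<open>Shifting by 1 turns \<open>past (- 1)\<close> into \<open>past 0\<close> and
  \<open>X k\<close> into \<open>X (k + 1)\<close>. As \<open>cond_exp\<close> is an arbitrary
  version, the two sides agree only almost everywhere.\<close>

lemma Z_shift_AE: "AE \<omega> in M. Z k (shift 1 \<omega>) = Y (Suc k) \<omega>"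
proof -
  have "has_cond_exp M (past 0) (\<lambda>\<omega>. X (int k) (shift 1 \<omega>)) (\<lambda>\<omega>. Z k (shift 1 \<omega>))"
    using has_cond_exp_shift[OF Z_cond_exp[of k], of 1] by simp
  moreover have "X (int k) (shift 1 \<omega>) = X (int (Suc k)) \<omega>" if "\<omega> \<in> space M" for \<omega>
    using that shift_space[OF that, of 1] shift_add[OF that, of "int k" 1]
    by (simp add: X_shift[of _ "int k"] X_shift[of _ "1 + int k"] add.commute)
  then have "AE \<omega> in M. X (int k) (shift 1 \<omega>) = X (int (Suc k)) \<omega>"
    by (rule AE_I2)
  ultimately have "has_cond_exp M (past 0) (X (int (Suc k))) (\<lambda>\<omega>. Z k (shift 1 \<omega>))"
    by (rule prob_subalgebra.has_cond_exp_cong_AE[OF prob_subalgebra_past _ Lp_space_measurable[OF X_Lp]])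
  then show ?thesis
    by (rule prob_subalgebra.has_cond_exp_unique[OF prob_subalgebra_past _ Y_cond_exp])
qed

text \<open>This is where adaptedness enters.\<close>

lemma Y_0_AE: "AE \<omega> in M. Y 0 \<omega> = X 0 \<omega>"
proof -
  have "X 0 \<in> borel_measurable F0"
    using X by (simp add: adapted_stationary_def)
  then have "X 0 \<in> borel_measurable (past 0)"
    using measurable_cong_sets[OF sets_past_0 refl, of borel] by blast
  then have "has_cond_exp M (past 0) (X 0) (X 0)"
    using X_integrable by (intro has_cond_exp_self)
  then show ?thesis
    using Y_cond_exp[of 0] prob_subalgebra.has_cond_exp_unique[OF prob_subalgebra_past] by simp
qed

lemma increment_martingale_difference: "martingale_difference p (increment k)"
proof -
  have Z: "Z k \<in> borel_measurable (past (- 1))"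
    using has_cond_expD(3)[OF Z_cond_exp] .
  have inc: "increment k = (\<lambda>\<omega>. Y k \<omega> - Z k \<omega>)"
    by (simp add: fun_eq_iff increment_eq)
  have ZZ: "has_cond_exp M (past (- 1)) (Z k) (Z k)"
    using has_cond_expD(2)[OF Z_cond_exp] Z by (rule has_cond_exp_self)
  have "has_cond_exp M (past (- 1)) (increment k) (\<lambda>_. 0)"
    unfolding inc using prob_subalgebra.has_cond_exp_diff[OF prob_subalgebra_past Y_Z_cond_exp[of k] ZZ] by simp
  moreover have "increment k \<in> borel_measurable (past 0)"
    unfolding inc using has_cond_expD(3)[OF Y_cond_exp] measurable_past_mono[OF Z, of 0]
    by (intro borel_measurable_diff) auto
  ultimately show ?thesis
    unfolding martingale_difference_def inc using Lp_space_diff(1)[OF p1 Y_Lp Z_Lp] by blast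
qed

lemma increment_Lp: "increment k \<in> Lp_space M p"
  using increment_martingale_difference by (simp add: martingale_difference_def)

text \<open>\<open>W 1 n\<close> is \<open>E\<^sub>0(S\<^sub>n)\<close>; in general
  \<open>W j n\<close> is, up to a shift, the conditional expectation of \<open>S\<^sub>n\<close>
  given \<open>past (1 - j)\<close>. Increasing j thus means projecting on an earlier past.\<close>

definition W :: "nat \<Rightarrow> nat \<Rightarrow> 'a \<Rightarrow> 'h" where
  "W j n = (\<lambda>\<omega>. \<Sum>i<n. Y (j + i) \<omega>)"

definition V :: "nat \<Rightarrow> nat \<Rightarrow> 'a \<Rightarrow> 'h" where
  "V j n = (\<lambda>\<omega>. \<Sum>i<n. Z (j + i) \<omega>)"

definition B :: "nat \<Rightarrow> nat \<Rightarrow> 'a \<Rightarrow> 'h" where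
  "B j n = (\<lambda>\<omega>. \<Sum>i<n. increment (j + i) \<omega>)"

definition s :: "nat \<Rightarrow> real" where
  "s n = Lp_norm M p (W 1 n)"

lemma W_Lp: "W j n \<in> Lp_space M p" and V_Lp: "V j n \<in> Lp_space M p" and B_Lp: "B j n \<in> Lp_space M p"
  unfolding W_def V_def B_def by (intro Lp_space_sum(1) p1 Y_Lp Z_Lp increment_Lp)+

lemma B_eq: "B j n = (\<lambda>\<omega>. W j n \<omega> - V j n \<omega>)"
  by (simp add: B_def W_def V_def increment_eq sum_subtractf)

lemma s_nonneg: "0 \<le> s n"
  by (simp add: s_def)

lemma V_shift_AE: "AE \<omega> in M. V j n (shift 1 \<omega>) = W (Suc j) n \<omega>"
proof -
  have "AE \<omega> in M. \<forall>k. Z k (shift 1 \<omega>) = Y (Suc k) \<omega>"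
    using Z_shift_AE by (simp add: AE_all_countable)
  then show ?thesis
    by eventually_elim (simp add: V_def W_def)
qed

lemma W_V_cond_exp: "has_cond_exp M (past (- 1)) (W j n) (V j n)"
  unfolding W_def V_def by (intro prob_subalgebra.has_cond_exp_sum[OF prob_subalgebra_past] Y_Z_cond_exp)

lemma norm_V: "Lp_norm M p (V j n) = Lp_norm M p (W (Suc j) n)"
proof -
  have "Lp_norm M p (V j n) = Lp_norm M p (\<lambda>\<omega>. V j n (shift 1 \<omega>))"
    by (rule Lp_norm_shift[symmetric]) (rule Lp_space_measurable[OF V_Lp])
  also have "\<dots> = Lp_norm M p (W (Suc j) n)"
  proof (rule Lp_norm_cong_AE)
    show "AE \<omega> in M. norm (V j n (shift 1 \<omega>)) = norm (W (Suc j) n \<omega>)"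
      using V_shift_AE[of j n] by eventually_elim simp
  qed (intro Lp_space_measurable[where p = p] Lp_space_shift V_Lp W_Lp)+
  finally show ?thesis .
qed

text \<open>Uniform convexity for the projection of \<open>W j n\<close> on
  \<open>past (- 1)\<close>: the projection is \<open>V j n\<close>, with the norm of
  \<open>W (Suc j) n\<close> by stationarity, and what is lost is \<open>B j n\<close>.\<close>

lemma norm_W_Suc:
  "Lp_norm M p (W (Suc j) n) powr max 2 p + convex_const p * Lp_norm M p (B j n) powr max 2 p
    \<le> Lp_norm M p (W j n) powr max 2 p"
  using prob_subalgebra.cond_exp_convex[OF prob_subalgebra_past p W_Lp W_V_cond_exp, of j n]
  by (simp add: norm_V B_eq)

lemma norm_W_le: "Lp_norm M p (W (Suc j) n) \<le> s n"
proof (induction j)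
  case (Suc j)
  have "Lp_norm M p (V (Suc j) n) \<le> Lp_norm M p (W (Suc j) n)"
    by (rule prob_subalgebra.has_cond_exp_Lp(2)[OF prob_subalgebra_past p1 W_V_cond_exp W_Lp])
  then show ?case
    using Suc by (simp add: norm_V)
qed (simp add: s_def)

text \<open>Constant of the martingale cotype inequality below; the root appears because the
  constant is placed inside the power.\<close>

definition cotype_const :: real where
  "cotype_const = (1 / convex_const p) powr (1 / max 2 p)"

lemma cotype_const_pos: "cotype_const > 0"
  using convex_const_pos[OF p] by (simp add: cotype_const_def)

text \<open>The one-step losses telescope from \<open>W 1 n\<close>, so only j \<ge> 1 is covered.
  The bound does not improve with N; all later decay in N comes from the weights.\<close>

lemma sum_norm_B: "(\<Sum>j\<in>{N<..L}. Lp_norm M p (B j n) powr max 2 p) \<le> (cotype_const * s n) powr max 2 p"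
proof -
  have c: "convex_const p > 0"
    using p by (rule convex_const_pos)
  have tele: "convex_const p * (\<Sum>j<J. Lp_norm M p (B (Suc j) n) powr max 2 p) + Lp_norm M p (W (Suc J) n) powr max 2 p
      \<le> s n powr max 2 p" for J
  proof (induction J)
    case (Suc J)
    then show ?case
      using norm_W_Suc[of "Suc J" n] by (simp add: distrib_left)
  qed (simp add: s_def)
  have "(\<Sum>j\<in>{N<..L}. Lp_norm M p (B j n) powr max 2 p) \<le> (\<Sum>j\<in>{0<..L}. Lp_norm M p (B j n) powr max 2 p)"
    by (intro sum_mono2) auto
  also have "\<dots> = (\<Sum>j<L. Lp_norm M p (B (Suc j) n) powr max 2 p)"
    by (rule sum.reindex_bij_witness[of _ Suc "\<lambda>j. j - 1"]) auto
  also have "\<dots> \<le> (1 / convex_const p) * s n powr max 2 p"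
  proof -
    have "convex_const p * (\<Sum>j<L. Lp_norm M p (B (Suc j) n) powr max 2 p) \<le> s n powr max 2 p"
      using tele[of L] powr_ge_zero[of "Lp_norm M p (W (Suc L) n)" "max 2 p"] by linarith
    then show ?thesis
      using c by (simp add: pos_le_divide_eq mult.commute)
  qed
  also have "1 / convex_const p = cotype_const powr max 2 p"
    using c p by (simp add: cotype_const_def powr_powr)
  finally show ?thesis
    by (simp only: powr_mult)
qed

lemma norm_B_le:
  assumes "j \<ge> 1"
  shows "Lp_norm M p (B j n) \<le> cotype_const * s n"
proof -
  have "{j - 1<..j} = {j}"
    using assms by auto
  then have "Lp_norm M p (B j n) powr max 2 p \<le> (cotype_const * s n) powr max 2 p"
    using sum_norm_B[of n "j - 1" j] by simp
  then show ?thesis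
    using p cotype_const_pos s_nonneg by (subst (asm) powr_le_powr_iff) auto
qed

text \<open>A sum of length i is one of length i + k minus a later one of length k, whose projection
  has norm at most \<open>s k\<close> because it is further from the past.\<close>

lemma s_subadditive: "s i \<le> s (i + k) + s k"
proof -
  have eq: "(\<lambda>\<omega>. W 1 (i + k) \<omega> - W (1 + i) k \<omega>) = W 1 i"
  proof
    fix \<omega>
    have "W 1 (i + k) \<omega> = W 1 i \<omega> + W (1 + i) k \<omega>"
      by (induction k) (simp_all add: W_def add.assoc)
    then show "W 1 (i + k) \<omega> - W (1 + i) k \<omega> = W 1 i \<omega>"
      by simp
  qed
  then show ?thesis
    using Lp_space_diff(2)[OF p1 W_Lp[of 1 "i + k"] W_Lp[of "1 + i" k]] norm_W_le[of i k]
    by (simp add: s_def)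
qed

text \<open>The hypothesis speaks of one version for the whole sum, \<open>W 1 n\<close> is a sum of
  versions; almost sure uniqueness identifies the norms.\<close>

lemma norm_cond_exp_sum: "Lp_norm M p (cond_exp M (past 0) (\<lambda>\<omega>. \<Sum>k=1..n. X (int k) \<omega>)) = s n"
proof -
  have "has_cond_exp M (past 0) (\<lambda>\<omega>. \<Sum>k=1..n. X (int k) \<omega>) (\<lambda>\<omega>. \<Sum>k=1..n. Y k \<omega>)"
    by (intro prob_subalgebra.has_cond_exp_sum[OF prob_subalgebra_past] Y_cond_exp)
  moreover have "(\<Sum>k=1..n. Y k \<omega>) = W 1 n \<omega>" for \<omega>
    unfolding W_def by (rule sum.reindex_bij_witness[of _ "\<lambda>i. 1 + i" "\<lambda>k. k - 1"]) auto
  ultimately have W: "has_cond_exp M (past 0) (\<lambda>\<omega>. \<Sum>k=1..n. X (int k) \<omega>) (W 1 n)"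
    by simp
  have ce: "has_cond_exp M (past 0) (\<lambda>\<omega>. \<Sum>k=1..n. X (int k) \<omega>) (cond_exp M (past 0) (\<lambda>\<omega>. \<Sum>k=1..n. X (int k) \<omega>))"
    using has_cond_expD(1)[OF W] by (rule prob_subalgebra.has_cond_exp_cond_exp[OF prob_subalgebra_past])
  have "AE \<omega> in M. cond_exp M (past 0) (\<lambda>\<omega>. \<Sum>k=1..n. X (int k) \<omega>) \<omega> = W 1 n \<omega>"
    by (rule prob_subalgebra.has_cond_exp_unique[OF prob_subalgebra_past ce W])
  then have "AE \<omega> in M. norm (cond_exp M (past 0) (\<lambda>\<omega>. \<Sum>k=1..n. X (int k) \<omega>) \<omega>) = norm (W 1 n \<omega>)"
    by eventually_elim simp
  then show ?thesis
    unfolding s_def using has_cond_expD(2)[OF ce] has_cond_expD(2)[OF W] by (intro Lp_norm_cong_AE) auto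
qed

end

section \<open>The martingale approximation\<close>

locale adapted_sequence_summable = adapted_sequence M \<theta> F0 p X
  for M :: "'a measure" and \<theta> :: "'a \<Rightarrow> 'a" and F0 :: "'a measure"
    and p :: real and X :: "int \<Rightarrow> 'a \<Rightarrow> 'h::{real_inner, banach, second_countable_topology}" +
  assumes summable_s: "summable (\<lambda>n. s n / real n powr (1 + 1 / max 2 p))"
begin

section \<open>Weights and tails of the hypothesis\<close>

definition weight :: "nat \<Rightarrow> real" where
  "weight n = s n / real n powr (1 + 1 / max 2 p)"

definition tail :: "nat \<Rightarrow> real" where
  "tail N = (\<Sum>j. weight (N + j))"

lemma weight_nonneg: "0 \<le> weight n"
  by (simp add: weight_def s_nonneg)

lemma summable_weight: "summable weight"
  using summable_s by (simp add: weight_def[abs_def])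

lemma tail_nonneg: "0 \<le> tail N"
proof -
  have "summable (\<lambda>j. weight (N + j))"
    using summable_weight by (subst add.commute) (simp add: summable_iff_shift)
  then show ?thesis
    unfolding tail_def by (intro suminf_nonneg weight_nonneg)
qed

lemma tail_tendsto: "tail \<longlonglongrightarrow> 0"
proof -
  have "tail = (\<lambda>N. (\<Sum>j. weight j) - (\<Sum>j<N. weight j))"
    unfolding tail_def[abs_def] using suminf_minus_initial_segment[OF summable_weight] by (simp add: add.commute fun_eq_iff)
  moreover have "(\<lambda>N. (\<Sum>j. weight j) - (\<Sum>j<N. weight j)) \<longlonglongrightarrow> (\<Sum>j. weight j) - (\<Sum>j. weight j)"
    using summable_LIMSEQ[OF summable_weight] by (intro tendsto_intros)
  ultimately show ?thesis
    by simp
qed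

lemma exponent_bounds: "0 < 1 / max 2 p" "1 / max 2 p \<le> 1 / 2"
  by (auto simp: field_simps)

lemma s_le_tail: "N \<ge> 1 \<Longrightarrow> i \<le> 2 * N \<Longrightarrow> s i \<le> 16 * real N powr (1 / max 2 p) * tail N"
  unfolding tail_def
  by (rule subadditive_le_tail[OF exponent_bounds s_nonneg s_subadditive weight_def summable_weight])

text \<open>Removes the boundary term of the Abel summation. It follows from the bound by the tail,
  as the power of n there is at most 1.\<close>

lemma s_over_n_tendsto: "(\<lambda>n. s n / real n) \<longlonglongrightarrow> 0"
proof (rule tendsto_sandwich[OF _ _ tendsto_const])
  show "(\<lambda>n. 16 * tail n) \<longlonglongrightarrow> 0"
    using tendsto_mult[OF tendsto_const[of 16] tail_tendsto] by simp
  show "eventually (\<lambda>n. s n / real n \<le> 16 * tail n) sequentially"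
    using eventually_ge_at_top[of 1]
  proof eventually_elim
    case (elim n)
    have "real n powr (1 / max 2 p) \<le> real n powr 1"
      using elim exponent_bounds by (intro powr_mono) auto
    then have "16 * real n powr (1 / max 2 p) * tail n \<le> 16 * real n * tail n"
      using elim tail_nonneg by (intro mult_right_mono mult_left_mono) auto
    then have "s n \<le> 16 * real n * tail n"
      using s_le_tail[of n n] elim by simp
    then show ?case
      using elim by (simp add: pos_divide_le_eq mult_ac)
  qed
qed (simp add: s_nonneg)

section \<open>The tails \<open>u n\<close> and their Abel summation\<close>

definition summand :: "nat \<Rightarrow> nat \<Rightarrow> 'a \<Rightarrow> 'h" where
  "summand n j = (\<lambda>\<omega>. increment (n + j) \<omega> /\<^sub>R real (n + j + 1))"

definition u :: "nat \<Rightarrow> 'a \<Rightarrow> 'h" where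
  "u n = Lp_suminf M p (summand n)"

text \<open>The weight is the difference of the reciprocals of n + i + 1 and n + i + 2.\<close>

definition abel_summand :: "nat \<Rightarrow> nat \<Rightarrow> 'a \<Rightarrow> 'h" where
  "abel_summand n i = (\<lambda>\<omega>. B n (i + 1) \<omega> /\<^sub>R (real (n + i + 1) * real (n + i + 2)))"

lemma summand_Lp: "summand n j \<in> Lp_space M p" and abel_summand_Lp: "abel_summand n i \<in> Lp_space M p"
  unfolding summand_def abel_summand_def by (intro Lp_space_scaleR increment_Lp B_Lp)+

lemma abel_summation:
  "(\<Sum>j<J. summand n j \<omega>) = (\<Sum>i<J. abel_summand n i \<omega>) + B n J \<omega> /\<^sub>R real (n + J + 1)"
proof (induction J)
  case 0
  then show ?case
    by (simp add: B_def)
next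
  case (Suc J)
  define c where "c = real (n + J + 1)"
  have c: "c > 0"
    by (simp add: c_def)
  have B: "B n (Suc J) \<omega> = B n J \<omega> + increment (n + J) \<omega>"
    by (simp add: B_def)
  have "inverse c = inverse (c * d) + inverse d" if "d = c + 1" for d
  proof -
    have "d > 0"
      using that c by simp
    then have "inverse (c * d) + inverse d = (1 + c) * inverse (c * d)"
      using c by (simp add: field_simps)
    also have "\<dots> = inverse c"
      using c \<open>d > 0\<close> that by (simp add: add.commute)
    finally show ?thesis ..
  qed
  from this[OF refl] have "inverse c = inverse (c * (c + 1)) + inverse (c + 1)" .
  then have split: "B n (Suc J) \<omega> /\<^sub>R c = B n (Suc J) \<omega> /\<^sub>R (c * (c + 1)) + B n (Suc J) \<omega> /\<^sub>R (c + 1)"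
    by (simp only: scaleR_left_distrib)
  have "(\<Sum>j<Suc J. summand n j \<omega>) = (\<Sum>i<J. abel_summand n i \<omega>) + (B n J \<omega> /\<^sub>R c + summand n J \<omega>)"
    using Suc.IH by (simp add: c_def)
  also have "B n J \<omega> /\<^sub>R c + summand n J \<omega> = B n (Suc J) \<omega> /\<^sub>R c"
    by (simp add: B summand_def c_def scaleR_right_distrib)
  also have "\<dots> = abel_summand n J \<omega> + B n (Suc J) \<omega> /\<^sub>R real (n + Suc J + 1)"
    unfolding split by (simp add: abel_summand_def c_def add_ac)
  finally show ?case
    by (simp add: add.assoc)
qed

lemma norm_abel_summand_le: "Lp_norm M p (abel_summand n i) \<le> Lp_norm M p (B n (i + 1)) / real (n + (i + 1)) ^ 2"
proof -
  have "Lp_norm M p (abel_summand n i) = Lp_norm M p (B n (i + 1)) / (real (n + i + 1) * real (n + i + 2))"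
    unfolding abel_summand_def using p by (subst Lp_norm_scaleR) (auto simp: divide_inverse)
  also have "\<dots> \<le> Lp_norm M p (B n (i + 1)) / (real (n + i + 1) * real (n + i + 1))"
    by (intro divide_left_mono mult_left_mono mult_pos_pos) auto
  finally show ?thesis
    by (simp add: power2_eq_square add.assoc)
qed

text \<open>Hoelder's inequality acts on the starting index n while the length i + 1 of the block
  stays fixed, as the cotype inequality sums over starting points.\<close>

lemma sum_norm_B_weighted:
  "(\<Sum>n\<in>{N<..L}. Lp_norm M p (B n (i + 1)) / real (n + (i + 1)) ^ 2)
    \<le> cotype_const * (s (i + 1) * real (N + i + 1) powr (- (1 + 1 / max 2 p)))"
proof -
  have "(\<Sum>n\<in>{N<..L}. Lp_norm M p (B n (i + 1)) / real (n + (i + 1)) ^ 2)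
      \<le> (cotype_const * s (i + 1)) * real (N + (i + 1)) powr (- (1 + 1 / max 2 p))"
    using cotype_const_pos s_nonneg by (intro weighted_sum_le sum_norm_B) auto
  then show ?thesis
    by (simp add: mult.assoc add.assoc)
qed

lemmas shifted_weight = suminf_shifted_weight_le[OF exponent_bounds s_nonneg s_subadditive weight_def summable_weight]

definition weighted_norm :: "nat \<Rightarrow> nat \<Rightarrow> real" where
  "weighted_norm n i = Lp_norm M p (B n (i + 1)) / real (n + (i + 1)) ^ 2"

lemma summable_weighted_norm:
  assumes "n \<ge> 1"
  shows "summable (weighted_norm n)"
proof (rule summable_comparison_test'[where N = 0])
  show "summable (\<lambda>i. cotype_const * (s (i + 1) * real ((n - 1) + i + 1) powr (- (1 + 1 / max 2 p))))"
    by (intro summable_mult shifted_weight(1))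
  show "norm (weighted_norm n i) \<le> cotype_const * (s (i + 1) * real ((n - 1) + i + 1) powr (- (1 + 1 / max 2 p)))" for i
  proof -
    \<comment> \<open>A single term is estimated as a sum over a range with one element, which is
      possible because n is positive.\<close>
    have "{n - 1<..n} = {n}"
      using assms by auto
    then show ?thesis
      using sum_norm_B_weighted[of i "n - 1" n] by (simp add: weighted_norm_def)
  qed
qed

lemma summable_norm_abel_summand: "n \<ge> 1 \<Longrightarrow> summable (\<lambda>i. Lp_norm M p (abel_summand n i))"
proof (rule summable_comparison_test'[where N = 0, OF summable_weighted_norm])
  show "norm (Lp_norm M p (abel_summand n i)) \<le> weighted_norm n i" for i
    using norm_abel_summand_le[of n i] by (simp add: weighted_norm_def)
qed

lemma abel_boundary_tendsto:
  assumes n: "n \<ge> 1"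
  shows "(\<lambda>J. Lp_norm M p (\<lambda>\<omega>. (\<Sum>j<J. summand n j \<omega>) - (\<Sum>i<J. abel_summand n i \<omega>))) \<longlonglongrightarrow> 0"
proof (rule tendsto_sandwich[OF _ _ tendsto_const])
  show "(\<lambda>J. cotype_const * (s J / real J)) \<longlonglongrightarrow> 0"
    using tendsto_mult[OF tendsto_const[of cotype_const] s_over_n_tendsto] by simp
  show "eventually (\<lambda>J. Lp_norm M p (\<lambda>\<omega>. (\<Sum>j<J. summand n j \<omega>) - (\<Sum>i<J. abel_summand n i \<omega>))
      \<le> cotype_const * (s J / real J)) sequentially"
    using eventually_ge_at_top[of 1]
  proof eventually_elim
    case (elim J)
    have "Lp_norm M p (\<lambda>\<omega>. (\<Sum>j<J. summand n j \<omega>) - (\<Sum>i<J. abel_summand n i \<omega>))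
        = Lp_norm M p (\<lambda>\<omega>. B n J \<omega> /\<^sub>R real (n + J + 1))"
      by (simp add: abel_summation)
    also have "\<dots> = Lp_norm M p (B n J) / real (n + J + 1)"
      using p by (subst Lp_norm_scaleR) (auto simp: divide_inverse)
    also have "\<dots> \<le> (cotype_const * s J) / real J"
      using norm_B_le[OF n, of J] elim cotype_const_pos s_nonneg[of J] by (intro frac_le) auto
    finally show ?case
      by simp
  qed
qed simp

lemma summable_u_pos:
  assumes n: "n \<ge> 1"
  shows "Lp_summable M p (summand n)" "Lp_norm M p (u n) \<le> (\<Sum>i. weighted_norm n i)"
proof -
  note perturb = Lp_summable_perturb[OF p1 abel_summand_Lp summand_Lp summable_norm_abel_summand[OF n] abel_boundary_tendsto[OF n]]
  show "Lp_summable M p (summand n)"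
    by (rule perturb(1))
  have "(\<Sum>i. Lp_norm M p (abel_summand n i)) \<le> (\<Sum>i. weighted_norm n i)"
    using norm_abel_summand_le
    by (intro suminf_le summable_weighted_norm summable_norm_abel_summand n) (auto simp: weighted_norm_def)
  then show "Lp_norm M p (u n) \<le> (\<Sum>i. weighted_norm n i)"
    unfolding u_def using perturb(2) by linarith
qed

lemma summand_Suc: "(\<lambda>j. summand n (Suc j)) = summand (Suc n)"
  by (simp add: summand_def fun_eq_iff)

text \<open>The estimates exclude n = 0, since \<open>B 0 i\<close> is not controlled by
  \<open>s\<close>; that series is the one for n = 1 with one term put in front.\<close>

lemma summable_u: "Lp_summable M p (summand n)"
proof (cases "n \<ge> 1")
  case False
  have "Lp_sums M p (\<lambda>j. summand n (Suc j)) (u (Suc n))"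
    unfolding summand_Suc u_def by (intro Lp_sums_suminf summable_u_pos(1)) simp
  from Lp_sums_Suc[OF p1 this summand_Lp] show ?thesis
    by (auto simp: Lp_summable_def)
qed (rule summable_u_pos(1))

lemma u_sums: "Lp_sums M p (summand n) (u n)"
  unfolding u_def by (rule Lp_sums_suminf[OF summable_u])

lemma u_Lp: "u n \<in> Lp_space M p"
  using u_sums by (simp add: Lp_sums_def)

lemma u_recursion: "AE \<omega> in M. u n \<omega> = increment n \<omega> /\<^sub>R real (n + 1) + u (Suc n) \<omega>"
proof -
  have "Lp_sums M p (\<lambda>j. summand n (Suc j)) (u (Suc n))"
    unfolding summand_Suc by (rule u_sums)
  from Lp_sums_Suc[OF p1 this summand_Lp]
  have "Lp_sums M p (summand n) (\<lambda>\<omega>. summand n 0 \<omega> + u (Suc n) \<omega>)" .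
  from Lp_sums_unique[OF p1 u_sums this] show ?thesis
    by (simp add: summand_def)
qed

text \<open>The bound is left as a series rather than estimated by \<open>tail N\<close>, so that N
  = 0 is included and absolute convergence of the series of the \<open>u n\<close> can be
  deduced.\<close>

lemma sum_norm_u_le:
  "(\<Sum>n\<in>{N<..L}. Lp_norm M p (u n))
    \<le> cotype_const * (\<Sum>i. s (i + 1) * real (N + i + 1) powr (- (1 + 1 / max 2 p)))"
proof -
  have "(\<Sum>n\<in>{N<..L}. Lp_norm M p (u n)) \<le> (\<Sum>n\<in>{N<..L}. \<Sum>i. weighted_norm n i)"
    by (intro sum_mono summable_u_pos(2)) auto
  also have "\<dots> = (\<Sum>i. \<Sum>n\<in>{N<..L}. weighted_norm n i)"
    by (intro suminf_sum[symmetric] summable_weighted_norm) auto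
  also have "\<dots> \<le> (\<Sum>i. cotype_const * (s (i + 1) * real (N + i + 1) powr (- (1 + 1 / max 2 p))))"
    using sum_norm_B_weighted
    by (intro suminf_le summable_sum summable_weighted_norm summable_mult shifted_weight(1)) (auto simp: weighted_norm_def)
  also have "\<dots> = cotype_const * (\<Sum>i. s (i + 1) * real (N + i + 1) powr (- (1 + 1 / max 2 p)))"
    by (intro suminf_mult shifted_weight(1))
  finally show ?thesis .
qed

lemma sum_norm_u_le_tail:
  assumes "N \<ge> 1"
  shows "(\<Sum>n\<in>{N<..L}. Lp_norm M p (u n)) \<le> 17 * cotype_const * tail N"
proof -
  have "cotype_const * (\<Sum>i. s (i + 1) * real (N + i + 1) powr (- (1 + 1 / max 2 p))) \<le> cotype_const * (17 * tail N)"
    unfolding tail_def using shifted_weight(2)[OF assms] cotype_const_pos by (intro mult_left_mono) auto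
  then show ?thesis
    using sum_norm_u_le[of N L] by simp
qed

lemma summable_norm_u: "summable (\<lambda>n. Lp_norm M p (u n))"
proof (rule bounded_imp_summable)
  fix n :: nat
  have "{..n} = insert 0 {0<..n}"
    by auto
  then show "(\<Sum>k\<le>n. Lp_norm M p (u k)) \<le> Lp_norm M p (u 0)
      + cotype_const * (\<Sum>i. s (i + 1) * real (0 + i + 1) powr (- (1 + 1 / max 2 p)))"
    using sum_norm_u_le[of 0 n] by simp
qed simp

section \<open>The limit D and its approximation by averages\<close>

definition D :: "'a \<Rightarrow> 'h" where
  "D = Lp_suminf M p u"

lemma D_sums: "Lp_sums M p u D"
  unfolding D_def by (rule Lp_sums_suminf[OF Lp_summable_norm[OF p1 u_Lp summable_norm_u]])

lemma D_Lp: "D \<in> Lp_space M p"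
  using D_sums by (simp add: Lp_sums_def)

text \<open>For k < i the term \<open>increment k / (k + 1)\<close> occurs in \<open>u 0\<close>,
  ..., \<open>u k\<close>, that is k + 1 times, so the weight cancels; for k \<ge> i it occurs in
  all i tails, which leaves i copies of \<open>u i\<close>.\<close>

lemma sum_u_AE: "AE \<omega> in M. (\<Sum>n<i. u n \<omega>) = B 0 i \<omega> + real i *\<^sub>R u i \<omega>"
proof -
  have "AE \<omega> in M. \<forall>n. u n \<omega> = increment n \<omega> /\<^sub>R real (n + 1) + u (Suc n) \<omega>"
    unfolding AE_all_countable using u_recursion by blast
  then show ?thesis
  proof eventually_elim
    case (elim \<omega>)
    show ?case
    proof (induction i)
      case 0
      then show ?case
        by (simp add: B_def)
    next
      case (Suc i)
      have "(\<Sum>n<Suc i. u n \<omega>) = B 0 i \<omega> + (real i *\<^sub>R u i \<omega> + u i \<omega>)"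
        using Suc.IH by simp
      also have "real i *\<^sub>R u i \<omega> + u i \<omega> = real (i + 1) *\<^sub>R u i \<omega>"
        by (simp add: scaleR_left_distrib)
      also have "\<dots> = real (i + 1) *\<^sub>R (increment i \<omega> /\<^sub>R real (i + 1) + u (Suc i) \<omega>)"
        using elim[rule_format, of i] by (rule arg_cong)
      also have "\<dots> = increment i \<omega> + real (Suc i) *\<^sub>R u (Suc i) \<omega>"
        by (simp add: scaleR_right_distrib)
      finally show ?case
        by (simp add: B_def add.assoc)
    qed
  qed
qed

text \<open>The partial sum of the first i tails lies between D and \<open>B 0 i\<close>: its
  distance to D is a tail of an absolutely convergent series, its distance to \<open>B 0 i\<close>
  is left for the averaging.\<close>

lemma norm_D_minus_partial:
  assumes N: "N \<ge> 1" "N < i"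
  shows "Lp_norm M p (\<lambda>\<omega>. D \<omega> - B 0 i \<omega>) \<le> 17 * cotype_const * tail N + real i * Lp_norm M p (u i)"
proof -
  have S: "(\<lambda>\<omega>. \<Sum>n<i. u n \<omega>) \<in> Lp_space M p"
    by (intro Lp_space_sum(1) p1 u_Lp)
  have iu: "(\<lambda>\<omega>. real i *\<^sub>R u i \<omega>) \<in> Lp_space M p"
    by (intro Lp_space_scaleR u_Lp)
  have "Lp_norm M p (\<lambda>\<omega>. D \<omega> - B 0 i \<omega>)
      \<le> Lp_norm M p (\<lambda>\<omega>. D \<omega> - (\<Sum>n<i. u n \<omega>)) + Lp_norm M p (\<lambda>\<omega>. (\<Sum>n<i. u n \<omega>) - B 0 i \<omega>)"
    by (intro Lp_norm_diff_triangle p1 D_Lp S B_Lp)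
  also have "Lp_norm M p (\<lambda>\<omega>. (\<Sum>n<i. u n \<omega>) - B 0 i \<omega>) = Lp_norm M p (\<lambda>\<omega>. real i *\<^sub>R u i \<omega>)"
  proof (rule Lp_norm_cong_AE)
    show "AE \<omega> in M. norm ((\<Sum>n<i. u n \<omega>) - B 0 i \<omega>) = norm (real i *\<^sub>R u i \<omega>)"
      using sum_u_AE[of i] by eventually_elim simp
  qed (rule Lp_space_measurable[OF Lp_space_diff(1)[OF p1 S B_Lp]], rule Lp_space_measurable[OF iu])
  also have "\<dots> = real i * Lp_norm M p (u i)"
    using p by (simp add: Lp_norm_scaleR)
  also have "Lp_norm M p (\<lambda>\<omega>. D \<omega> - (\<Sum>n<i. u n \<omega>)) \<le> 17 * cotype_const * tail N"
  proof (rule Lp_sums_tail_le[OF p1 D_sums])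
    fix J
    have "(\<Sum>n\<in>{i..<J}. Lp_norm M p (u n)) \<le> (\<Sum>n\<in>{N<..J}. Lp_norm M p (u n))"
      using N by (intro sum_mono2) auto
    also have "\<dots> \<le> 17 * cotype_const * tail N"
      by (rule sum_norm_u_le_tail[OF N(1)])
    finally show "(\<Sum>n\<in>{i..<J}. Lp_norm M p (u n)) \<le> 17 * cotype_const * tail N" .
  qed
  finally show ?thesis
    by simp
qed

text \<open>Only the averages over \<open>n\<close> of \<open>n * \<parallel>u n\<parallel>\<close> are under control, not the individual terms;
  hence the average of \<open>B 0 i\<close> instead of a single one.\<close>

definition D_avg :: "nat \<Rightarrow> 'a \<Rightarrow> 'h" where
  "D_avg N = (\<lambda>\<omega>. (1 / real N) *\<^sub>R (\<Sum>i\<in>{N<..2*N}. B 0 i \<omega>))"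

lemma D_avg_martingale_difference: "martingale_difference p (D_avg N)"
  unfolding D_avg_def B_def
  by (intro martingale_difference_scaleR martingale_difference_sum p1 increment_martingale_difference)

lemma D_avg_Lp: "D_avg N \<in> Lp_space M p"
  using D_avg_martingale_difference by (simp add: martingale_difference_def)

text \<open>As i is at most 2N, the average of \<open>i * Lp_norm M p (u i)\<close> over the N
  indices is at most twice the sum of the norms, which again is a tail. With the tail already
  present this makes three times 17.\<close>

lemma norm_D_minus_avg:
  assumes N: "N \<ge> 1"
  shows "Lp_norm M p (\<lambda>\<omega>. D \<omega> - D_avg N \<omega>) \<le> 51 * cotype_const * tail N"
proof -
  define t where "t = 17 * cotype_const * tail N"
  have "(\<lambda>\<omega>. D \<omega> - D_avg N \<omega>) = (\<lambda>\<omega>. (1 / real N) *\<^sub>R (\<Sum>i\<in>{N<..2*N}. D \<omega> - B 0 i \<omega>))"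
    using N by (simp add: D_avg_def fun_eq_iff sum_subtractf scaleR_right_diff_distrib sum_constant_scaleR)
  then have "Lp_norm M p (\<lambda>\<omega>. D \<omega> - D_avg N \<omega>)
      = (1 / real N) * Lp_norm M p (\<lambda>\<omega>. \<Sum>i\<in>{N<..2*N}. D \<omega> - B 0 i \<omega>)"
    using p by (simp add: Lp_norm_scaleR)
  also have "\<dots> \<le> (1 / real N) * (\<Sum>i\<in>{N<..2*N}. Lp_norm M p (\<lambda>\<omega>. D \<omega> - B 0 i \<omega>))"
    by (intro mult_left_mono Lp_space_sum(2) p1 Lp_space_diff(1) D_Lp B_Lp) auto
  also have "\<dots> \<le> (1 / real N) * (\<Sum>i\<in>{N<..2*N}. t + real (2 * N) * Lp_norm M p (u i))"
  proof (intro mult_left_mono sum_mono)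
    fix i assume i: "i \<in> {N<..2*N}"
    have "real i * Lp_norm M p (u i) \<le> real (2 * N) * Lp_norm M p (u i)"
      using i by (intro mult_right_mono) auto
    then show "Lp_norm M p (\<lambda>\<omega>. D \<omega> - B 0 i \<omega>) \<le> t + real (2 * N) * Lp_norm M p (u i)"
      using norm_D_minus_partial[OF N, of i] i by (simp add: t_def)
  qed simp
  also have "\<dots> = t + 2 * (\<Sum>i\<in>{N<..2*N}. Lp_norm M p (u i))"
    using N by (simp add: sum.distrib sum_distrib_left[symmetric] distrib_left)
  also have "\<dots> \<le> t + 2 * t"
    using sum_norm_u_le_tail[OF N, of "2 * N"] by (simp add: t_def)
  finally show ?thesis
    by (simp add: t_def)
qed

text \<open>D is known only as a limit in norm, so \<open>D_avg N - D\<close> is approximated by the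
  martingale differences \<open>D_avg N - D_avg K\<close> with large K, whose error tends to 0 with
  \<open>tail K\<close>.\<close>

lemma norm_sum_D_minus_avg:
  assumes N: "N \<ge> 1"
  shows "Lp_norm M p (\<lambda>\<omega>. \<Sum>k=1..n. D_avg N (shift (int k) \<omega>) - D (shift (int k) \<omega>))
    \<le> smooth_const p powr (1 / min 2 p) * real n powr (1 / min 2 p) * (51 * cotype_const * tail N)"
proof -
  have "Lp_norm M p (\<lambda>\<omega>. \<Sum>k=1..n. (\<lambda>\<omega>. D_avg N \<omega> - D \<omega>) (shift (int k) \<omega>))
    \<le> smooth_const p powr (1 / min 2 p) * real n powr (1 / min 2 p) * Lp_norm M p (\<lambda>\<omega>. D_avg N \<omega> - D \<omega>)"
  proof (rule stationary_martingale_norm_approx[OF p Lp_space_diff(1)[OF p1 D_avg_Lp D_Lp]])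
    fix \<epsilon> :: real assume \<epsilon>: "\<epsilon> > 0"
    have "(\<lambda>N. 51 * cotype_const * tail N) \<longlonglongrightarrow> 0"
      using tendsto_mult[OF tendsto_const[of "51 * cotype_const"] tail_tendsto] by simp
    then have "eventually (\<lambda>N. 51 * cotype_const * tail N < \<epsilon>) sequentially"
      using \<epsilon> by (rule order_tendstoD(2))
    then have "eventually (\<lambda>K. 51 * cotype_const * tail K < \<epsilon> \<and> K \<ge> 1) sequentially"
      using eventually_ge_at_top[of 1] by eventually_elim simp
    then obtain K where K: "51 * cotype_const * tail K < \<epsilon>" "K \<ge> 1"
      by (auto simp: eventually_sequentially)
    have "Lp_norm M p (\<lambda>\<omega>. (D_avg N \<omega> - D \<omega>) - (D_avg N \<omega> - D_avg K \<omega>)) \<le> \<epsilon>"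
      using norm_D_minus_avg[OF K(2)] K(1) by (simp add: Lp_norm_diff_commute[of M p D])
    moreover have "martingale_difference p (\<lambda>\<omega>. D_avg N \<omega> - D_avg K \<omega>)"
      by (intro martingale_difference_diff p1 D_avg_martingale_difference)
    ultimately show "\<exists>e. martingale_difference p e \<and> Lp_norm M p (\<lambda>\<omega>. (D_avg N \<omega> - D \<omega>) - e \<omega>) \<le> \<epsilon>"
      by blast
  qed
  also have "\<dots> \<le> smooth_const p powr (1 / min 2 p) * real n powr (1 / min 2 p) * (51 * cotype_const * tail N)"
    using norm_D_minus_avg[OF N] by (intro mult_left_mono) (auto simp: Lp_norm_diff_commute[of M p _ D])
  finally show ?thesis .
qed

text \<open>Since \<open>X 0\<close> is \<open>Y 0\<close>, subtracting \<open>B 0 (Suc l)\<close>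
  from it leaves \<open>V 0 (Suc l) - W 1 l\<close>. After a shift V becomes
  \<open>W 1 (Suc l)\<close> one step earlier, and splitting off its last term leaves a coboundary
  with transfer function \<open>W 1 l\<close>.\<close>

lemma coboundary_AE:
  "AE \<omega> in M. X i \<omega> - B 0 (Suc l) (shift i \<omega>)
    = W 1 l (shift (i - 1) \<omega>) - W 1 l (shift i \<omega>) + Y (Suc l) (shift (i - 1) \<omega>)"
proof -
  have W0: "W 0 (Suc l) \<omega> = Y 0 \<omega> + W 1 l \<omega>" for \<omega>
    unfolding W_def by (subst sum.lessThan_Suc_shift) simp
  have "AE \<omega> in M. X 0 \<omega> - B 0 (Suc l) \<omega> = V 0 (Suc l) \<omega> - W 1 l \<omega>"
    using Y_0_AE by eventually_elim (simp add: B_eq W0)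
  then have "AE \<omega> in M. X 0 (shift i \<omega>) - B 0 (Suc l) (shift i \<omega>) = V 0 (Suc l) (shift i \<omega>) - W 1 l (shift i \<omega>)"
    by (rule AE_shift)
  moreover have "AE \<omega> in M. V 0 (Suc l) (shift 1 (shift (i - 1) \<omega>)) = W (Suc 0) (Suc l) (shift (i - 1) \<omega>)"
    using V_shift_AE by (rule AE_shift)
  ultimately show ?thesis
    using AE_space
  proof eventually_elim
    case (elim \<omega>)
    have "shift 1 (shift (i - 1) \<omega>) = shift i \<omega>"
      using shift_add[OF elim(3), of 1 "i - 1"] by simp
    moreover have "W (Suc 0) (Suc l) (shift (i - 1) \<omega>) = W 1 l (shift (i - 1) \<omega>) + Y (Suc l) (shift (i - 1) \<omega>)"
      by (simp add: W_def)
    ultimately show ?case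
      using elim X_shift[OF elim(3), of i] by simp
  qed
qed

text \<open>Summation over k telescopes the coboundaries to the two end terms collected in R1, each
  of norm at most b. The remainder R2 consists of n \<le> N blocks. Division by N leaves 2b + b =
  3b, and 48 is three times 16.\<close>

lemma norm_sum_X_minus_avg:
  assumes N: "N \<ge> 1" and n: "n \<le> N"
  shows "Lp_norm M p (\<lambda>\<omega>. (\<Sum>k=1..n. X (int k) \<omega>) - (\<Sum>k=1..n. D_avg N (shift (int k) \<omega>)))
    \<le> 48 * real N powr (1 / max 2 p) * tail N"
proof -
  define b where "b = 16 * real N powr (1 / max 2 p) * tail N"
  define R1 where "R1 = (\<lambda>\<omega>. \<Sum>l\<in>{N..<2*N}. W 1 l \<omega> - W 1 l (shift (int n) \<omega>))"
  define R2 where "R2 = (\<lambda>\<omega>. \<Sum>m<n. W (N + 1) N (shift (int m) \<omega>))"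
  have W_shift: "(\<lambda>\<omega>. W j l (shift i \<omega>)) \<in> Lp_space M p" for i j l
    by (intro Lp_space_shift W_Lp)
  have R_Lp: "R1 \<in> Lp_space M p" "R2 \<in> Lp_space M p"
    unfolding R1_def R2_def by (intro Lp_space_sum(1) Lp_space_diff(1) p1 W_Lp W_shift)+
  have "AE \<omega> in M. \<forall>m l. X (int (Suc m)) \<omega> - B 0 (Suc l) (shift (int (Suc m)) \<omega>)
    = W 1 l (shift (int (Suc m) - 1) \<omega>) - W 1 l (shift (int (Suc m)) \<omega>) + Y (Suc l) (shift (int (Suc m) - 1) \<omega>)"
    unfolding AE_all_countable using coboundary_AE by blast
  then have eq: "AE \<omega> in M. (\<Sum>k=1..n. X (int k) \<omega>) - (\<Sum>k=1..n. D_avg N (shift (int k) \<omega>))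
      = (1 / real N) *\<^sub>R (R1 \<omega> + R2 \<omega>)"
  proof eventually_elim
    case (elim \<omega>)
    have one: "(\<Sum>m<n. X (int (Suc m)) \<omega>) - (\<Sum>m<n. B 0 (Suc l) (shift (int (Suc m)) \<omega>))
        = (W 1 l \<omega> - W 1 l (shift (int n) \<omega>)) + (\<Sum>m<n. Y (Suc l) (shift (int m) \<omega>))" for l
    proof -
      have "(\<Sum>m<n. X (int (Suc m)) \<omega>) - (\<Sum>m<n. B 0 (Suc l) (shift (int (Suc m)) \<omega>))
          = (\<Sum>m<n. X (int (Suc m)) \<omega> - B 0 (Suc l) (shift (int (Suc m)) \<omega>))"
        by (rule sum_subtractf[symmetric])
      also have "\<dots> = (\<Sum>m<n. W 1 l (shift (int m) \<omega>) - W 1 l (shift (int (Suc m)) \<omega>) + Y (Suc l) (shift (int m) \<omega>))"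
        by (intro sum.cong refl) (use elim in simp)
      also have "\<dots> = (\<Sum>m<n. W 1 l (shift (int m) \<omega>) - W 1 l (shift (int (Suc m)) \<omega>))
          + (\<Sum>m<n. Y (Suc l) (shift (int m) \<omega>))"
        by (rule sum.distrib)
      also have "(\<Sum>m<n. W 1 l (shift (int m) \<omega>) - W 1 l (shift (int (Suc m)) \<omega>))
          = W 1 l (shift (int 0) \<omega>) - W 1 l (shift (int n) \<omega>)"
        by (rule sum_lessThan_telescope')
      finally show ?thesis
        by simp
    qed
    have avg: "real N *\<^sub>R D_avg N \<omega>' = (\<Sum>l\<in>{N..<2*N}. B 0 (Suc l) \<omega>')" for \<omega>'
    proof -
      have "real N *\<^sub>R D_avg N \<omega>' = (\<Sum>i\<in>{N<..2*N}. B 0 i \<omega>')"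
        using N by (simp add: D_avg_def)
      also have "\<dots> = (\<Sum>l\<in>{N..<2*N}. B 0 (Suc l) \<omega>')"
        by (rule sum.reindex_bij_witness[of _ Suc "\<lambda>i. i - 1"]) auto
      finally show ?thesis .
    qed
    have Y_sum: "(\<Sum>l\<in>{N..<2*N}. Y (Suc l) \<omega>') = W (N + 1) N \<omega>'" for \<omega>'
      unfolding W_def by (rule sum.reindex_bij_witness[of _ "\<lambda>i. N + i" "\<lambda>l. l - N"]) auto
    have "real N *\<^sub>R ((\<Sum>m<n. X (int (Suc m)) \<omega>) - (\<Sum>m<n. D_avg N (shift (int (Suc m)) \<omega>)))
        = (\<Sum>l\<in>{N..<2*N}. \<Sum>m<n. X (int (Suc m)) \<omega>) - (\<Sum>m<n. \<Sum>l\<in>{N..<2*N}. B 0 (Suc l) (shift (int (Suc m)) \<omega>))"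
      by (simp add: scaleR_right_diff_distrib scaleR_sum_right avg sum_constant_scaleR)
    also have "(\<Sum>m<n. \<Sum>l\<in>{N..<2*N}. B 0 (Suc l) (shift (int (Suc m)) \<omega>))
        = (\<Sum>l\<in>{N..<2*N}. \<Sum>m<n. B 0 (Suc l) (shift (int (Suc m)) \<omega>))"
      by (rule sum.swap)
    also have "(\<Sum>l\<in>{N..<2*N}. \<Sum>m<n. X (int (Suc m)) \<omega>) - (\<Sum>l\<in>{N..<2*N}. \<Sum>m<n. B 0 (Suc l) (shift (int (Suc m)) \<omega>))
        = (\<Sum>l\<in>{N..<2*N}. (W 1 l \<omega> - W 1 l (shift (int n) \<omega>)) + (\<Sum>m<n. Y (Suc l) (shift (int m) \<omega>)))"
      by (subst sum_subtractf[symmetric]) (simp only: one)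
    also have "\<dots> = R1 \<omega> + (\<Sum>l\<in>{N..<2*N}. \<Sum>m<n. Y (Suc l) (shift (int m) \<omega>))"
      unfolding R1_def by (rule sum.distrib)
    \<comment> \<open>Summing over l first combines the single terms \<open>Y (Suc l)\<close> into
      the block \<open>W (N + 1) N\<close>, whose norm is at most \<open>s N\<close>; the individual
      terms need no estimate.\<close>
    also have "(\<Sum>l\<in>{N..<2*N}. \<Sum>m<n. Y (Suc l) (shift (int m) \<omega>)) = (\<Sum>m<n. \<Sum>l\<in>{N..<2*N}. Y (Suc l) (shift (int m) \<omega>))"
      by (rule sum.swap)
    also have "\<dots> = R2 \<omega>"
      by (simp only: R2_def Y_sum)
    finally have main: "real N *\<^sub>R ((\<Sum>m<n. X (int (Suc m)) \<omega>) - (\<Sum>m<n. D_avg N (shift (int (Suc m)) \<omega>))) = R1 \<omega> + R2 \<omega>" .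
    have "(\<Sum>m<n. X (int (Suc m)) \<omega>) - (\<Sum>m<n. D_avg N (shift (int (Suc m)) \<omega>)) = (1 / real N) *\<^sub>R (R1 \<omega> + R2 \<omega>)"
      unfolding main[symmetric] using N by simp
    then show ?case
      by (simp only: One_nat_def sum.atLeast1_atMost_eq)
  qed
  have s_le: "s l \<le> b" if "l \<le> 2 * N" for l
    unfolding b_def using N that by (rule s_le_tail)
  have "Lp_norm M p R1 \<le> (\<Sum>l\<in>{N..<2*N}. Lp_norm M p (\<lambda>\<omega>. W 1 l \<omega> - W 1 l (shift (int n) \<omega>)))"
    unfolding R1_def by (intro Lp_space_sum(2) Lp_space_diff(1) p1 W_Lp W_shift)
  also have "\<dots> \<le> (\<Sum>l\<in>{N..<2*N}. 2 * b)"
  proof (rule sum_mono)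
    fix l assume l: "l \<in> {N..<2*N}"
    have "Lp_norm M p (\<lambda>\<omega>. W 1 l \<omega> - W 1 l (shift (int n) \<omega>))
        \<le> Lp_norm M p (W 1 l) + Lp_norm M p (\<lambda>\<omega>. W 1 l (shift (int n) \<omega>))"
      by (intro Lp_space_diff(2) p1 W_Lp W_shift)
    also have "\<dots> = 2 * s l"
      using Lp_norm_shift[OF Lp_space_measurable[OF W_Lp[of 1 l]], where i = "int n" and p = p] by (simp add: s_def)
    also have "\<dots> \<le> 2 * b"
      using s_le[of l] l by simp
    finally show "Lp_norm M p (\<lambda>\<omega>. W 1 l \<omega> - W 1 l (shift (int n) \<omega>)) \<le> 2 * b" .
  qed
  finally have R1: "Lp_norm M p R1 \<le> real N * (2 * b)"
    by simp
  have "Lp_norm M p R2 \<le> real (card {..<n}) * Lp_norm M p (W (N + 1) N)"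
    unfolding R2_def by (rule Lp_norm_sum_shift_le[OF p1 W_Lp])
  also have "\<dots> \<le> real N * b"
    using norm_W_le[of N N] s_le[of N] n by (intro mult_mono) auto
  finally have R2: "Lp_norm M p R2 \<le> real N * b" .
  have "Lp_norm M p (\<lambda>\<omega>. (\<Sum>k=1..n. X (int k) \<omega>) - (\<Sum>k=1..n. D_avg N (shift (int k) \<omega>)))
      = Lp_norm M p (\<lambda>\<omega>. (1 / real N) *\<^sub>R (R1 \<omega> + R2 \<omega>))"
  proof (rule Lp_norm_cong_AE)
    show "AE \<omega> in M. norm ((\<Sum>k=1..n. X (int k) \<omega>) - (\<Sum>k=1..n. D_avg N (shift (int k) \<omega>)))
        = norm ((1 / real N) *\<^sub>R (R1 \<omega> + R2 \<omega>))"
      using eq by eventually_elim simp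
    show "(\<lambda>\<omega>. (1 / real N) *\<^sub>R (R1 \<omega> + R2 \<omega>)) \<in> borel_measurable M"
      by (intro Lp_space_measurable[where p = p] Lp_space_scaleR Lp_space_add(1) p1 R_Lp)
    show "(\<lambda>\<omega>. (\<Sum>k=1..n. X (int k) \<omega>) - (\<Sum>k=1..n. D_avg N (shift (int k) \<omega>))) \<in> borel_measurable M"
      by (intro Lp_space_measurable[where p = p] Lp_space_diff(1) Lp_space_sum(1) p1 X_Lp Lp_space_shift D_avg_Lp)
  qed
  also have "\<dots> = (1 / real N) * Lp_norm M p (\<lambda>\<omega>. R1 \<omega> + R2 \<omega>)"
    using p by (subst Lp_norm_scaleR) auto
  also have "\<dots> \<le> (1 / real N) * (real N * (2 * b) + real N * b)"
  proof (rule mult_left_mono)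
    show "Lp_norm M p (\<lambda>\<omega>. R1 \<omega> + R2 \<omega>) \<le> real N * (2 * b) + real N * b"
      using Lp_space_add(2)[OF p1 R_Lp] R1 R2 by linarith
  qed simp
  also have "\<dots> = 3 * b"
    using N by (simp add: field_simps)
  finally show ?thesis
    by (simp add: b_def)
qed

text \<open>The choice of N has two purposes: q \<ge> 1 gives n \<le> N, as the coboundary estimate
  requires, and \<open>N powr (1 / max 2 p)\<close> is at most
  \<open>n powr (1 / min 2 p)\<close>.\<close>

lemma martingale_approximation_rate:
  assumes n: "n \<ge> 1"
  shows "Lp_norm M p (\<lambda>\<omega>. (\<Sum>k=1..n. X (int k) \<omega>) - (\<Sum>k=1..n. D (shift (int k) \<omega>)))
    \<le> (48 + smooth_const p powr (1 / min 2 p) * (51 * cotype_const)) * real n powr (1 / min 2 p)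
      * tail (nat \<lfloor>real n powr (max 2 p / min 2 p)\<rfloor>)"
proof -
  define q where "q = max 2 p / min 2 p"
  define N where "N = nat \<lfloor>real n powr q\<rfloor>"
  have q: "q \<ge> 1"
    using p by (simp add: q_def)
  have "real n powr 1 \<le> real n powr q"
    using n q by (intro powr_mono) auto
  then have nN: "n \<le> N"
    using n by (simp add: N_def le_nat_floor)
  then have N: "N \<ge> 1"
    using n by simp
  have "real N \<le> real n powr q"
    unfolding N_def by (simp add: of_nat_floor)
  then have "real N powr (1 / max 2 p) \<le> (real n powr q) powr (1 / max 2 p)"
    by (intro powr_mono2) auto
  also have "\<dots> = real n powr (1 / min 2 p)"
    unfolding powr_powr by (simp add: q_def)
  finally have N_le: "48 * real N powr (1 / max 2 p) * tail N \<le> 48 * real n powr (1 / min 2 p) * tail N"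
    using tail_nonneg by (intro mult_right_mono mult_left_mono) auto
  have S: "(\<lambda>\<omega>. \<Sum>k=1..n. X (int k) \<omega>) \<in> Lp_space M p"
    "(\<lambda>\<omega>. \<Sum>k=1..n. D_avg N (shift (int k) \<omega>)) \<in> Lp_space M p"
    "(\<lambda>\<omega>. \<Sum>k=1..n. D (shift (int k) \<omega>)) \<in> Lp_space M p"
    by (intro Lp_space_sum(1) p1 X_Lp Lp_space_shift D_avg_Lp D_Lp)+
  have "Lp_norm M p (\<lambda>\<omega>. (\<Sum>k=1..n. X (int k) \<omega>) - (\<Sum>k=1..n. D (shift (int k) \<omega>)))
    \<le> Lp_norm M p (\<lambda>\<omega>. (\<Sum>k=1..n. X (int k) \<omega>) - (\<Sum>k=1..n. D_avg N (shift (int k) \<omega>)))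
      + Lp_norm M p (\<lambda>\<omega>. (\<Sum>k=1..n. D_avg N (shift (int k) \<omega>)) - (\<Sum>k=1..n. D (shift (int k) \<omega>)))"
    by (rule Lp_norm_diff_triangle[OF p1 S])
  also have "\<dots> \<le> 48 * real n powr (1 / min 2 p) * tail N
      + smooth_const p powr (1 / min 2 p) * real n powr (1 / min 2 p) * (51 * cotype_const * tail N)"
    using norm_sum_X_minus_avg[OF N nN] norm_sum_D_minus_avg[OF N, of n] N_le
    by (intro add_mono) (auto simp: sum_subtractf)
  also have "\<dots> = (48 + smooth_const p powr (1 / min 2 p) * (51 * cotype_const)) * real n powr (1 / min 2 p) * tail N"
    by (simp add: algebra_simps)
  finally show ?thesis
    by (simp add: N_def q_def)
qed

end

theorem theorem2p3:
  fixes M :: "'a measure" and \<theta> :: "'a \<Rightarrow> 'a" and F0 :: "'a measure"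
    and X :: "int \<Rightarrow> 'a \<Rightarrow> 'h::{real_inner, banach, second_countable_topology}"
    and P0X :: "int \<Rightarrow> 'a \<Rightarrow> 'h" and S T Mart :: "nat \<Rightarrow> 'a \<Rightarrow> 'h" and D :: "'a \<Rightarrow> 'h"
    and p p' p'' q :: real and a :: "nat \<Rightarrow> real"
  assumes "prob_space M"
    and "bimeasurable_mpt M \<theta>"
    and "subalgebra M F0"
    and "sets F0 \<subseteq> sets (vimage_algebra (space M) \<theta> F0)"
    and "p > 1"
    and "p' = min 2 p" and "p'' = max 2 p" and "q = p'' / p'"
    and "adapted_stationary M \<theta> F0 p X"
    and S: "\<And>n. S n = (\<lambda>\<omega>. \<Sum>k=1..n. X (int k) \<omega>)"
    and a: "\<And>n. a n = Lp_norm M p (cond_exp M (filt M \<theta> F0 0) (S n)) / real n powr (1 + 1 / p'')"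
    and "summable (\<lambda>n. a (n + 1))"
    and P0X: "\<And>k. P0X k = proj_op M \<theta> F0 0 (X k)"
    and T: "\<And>n. T n = Lp_suminf M p (\<lambda>j \<omega>. P0X (int (n + j) - 1) \<omega> /\<^sub>R real (n + j))"
    and D: "D = Lp_suminf M p
              (\<lambda>n. Lp_suminf M p (\<lambda>j \<omega>. P0X (int (n + j)) \<omega> /\<^sub>R real (n + j + 1)))"
    and Mart: "\<And>n. Mart n = (\<lambda>\<omega>. \<Sum>k=1..n. D (int_iterate M \<theta> (int k) \<omega>))"
  shows "(\<forall>n\<ge>1. Lp_summable M p (\<lambda>j \<omega>. P0X (int (n + j) - 1) \<omega> /\<^sub>R real (n + j))) \<and>
    Lp_summable M p (\<lambda>n \<omega>. norm (T (n + 1) \<omega>)) \<and>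
    Lp_summable M p
      (\<lambda>n. Lp_suminf M p (\<lambda>j \<omega>. P0X (int (n + j)) \<omega> /\<^sub>R real (n + j + 1))) \<and>
    (\<exists>C. \<forall>n\<ge>1. Lp_norm M p (\<lambda>\<omega>. S n \<omega> - Mart n \<omega>)
       \<le> C * real n powr (1 / p') * (\<Sum>j. a (nat \<lfloor>real n powr q\<rfloor> + j)))"
proof -
  have "1 < p"
    by fact
  interpret stationary_filtration M \<theta> F0
    using assms(1-4) by (simp add: stationary_filtration_def stationary_filtration_axioms_def)
  interpret adapted_sequence M \<theta> F0 p X
    using \<open>1 < p\<close> \<open>adapted_stationary M \<theta> F0 p X\<close> by unfold_locales
  have a_eq: "a n = s n / real n powr (1 + 1 / max 2 p)" for n
    using a[of n] \<open>p'' = max 2 p\<close> norm_cond_exp_sum[of n] by (simp add: S)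
  \<comment> \<open>The hypothesis starts at index 1; one initial term does not affect
    summability.\<close>
  have "summable a"
    using \<open>summable (\<lambda>n. a (n + 1))\<close> by (simp only: summable_iff_shift)
  then interpret adapted_sequence_summable M \<theta> F0 p X
    by unfold_locales (simp add: a_eq[abs_def])
  have summand_eq: "(\<lambda>j \<omega>. P0X (int (n + j)) \<omega> /\<^sub>R real (n + j + 1)) = summand n" for n
    by (simp add: fun_eq_iff summand_def increment_def P0X)
  \<comment> \<open>The statement indexes the tails from 1 with \<open>P0X\<close> lagging by one;
    shifting n makes them the tails \<open>u n\<close>.\<close>
  have T_summand: "(\<lambda>j \<omega>. P0X (int (Suc n + j) - 1) \<omega> /\<^sub>R real (Suc n + j)) = summand n" for n
    by (simp add: fun_eq_iff summand_def increment_def P0X add_ac)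
  have T_u: "T (Suc n) = u n" for n
    unfolding T u_def T_summand ..
  have D_eq: "D = adapted_sequence_summable.D M \<theta> F0 p X"
    unfolding assms(15) summand_eq by (simp add: D_def u_def[abs_def])
  show ?thesis
  proof (intro conjI)
    show "\<forall>n\<ge>1. Lp_summable M p (\<lambda>j \<omega>. P0X (int (n + j) - 1) \<omega> /\<^sub>R real (n + j))"
    proof (intro allI impI)
      fix n :: nat assume "n \<ge> 1"
      then obtain m where "n = Suc m"
        by (cases n) auto
      then show "Lp_summable M p (\<lambda>j \<omega>. P0X (int (n + j) - 1) \<omega> /\<^sub>R real (n + j))"
        using summable_u T_summand by simp
    qed
    show "Lp_summable M p (\<lambda>n \<omega>. norm (T (n + 1) \<omega>))"
      \<comment> \<open>Taking norms pointwise does not change the norm in \<open>L\<^sup>p\<close>,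
        so absolute convergence of the series of the \<open>u n\<close> is enough.\<close>
      using Lp_summable_norm[of p "\<lambda>n \<omega>. norm (u n \<omega>)"] p1 summable_norm_u u_Lp
      by (simp add: T_u Lp_norm_norm Lp_space_norm)
    show "Lp_summable M p (\<lambda>n. Lp_suminf M p (\<lambda>j \<omega>. P0X (int (n + j)) \<omega> /\<^sub>R real (n + j + 1)))"
      unfolding summand_eq u_def[symmetric] using p1 u_Lp summable_norm_u by (rule Lp_summable_norm)
    have tail_eq: "tail N = (\<Sum>j. a (N + j))" for N
      by (simp add: tail_def weight_def a_eq)
    show "\<exists>C. \<forall>n\<ge>1. Lp_norm M p (\<lambda>\<omega>. S n \<omega> - Mart n \<omega>)
       \<le> C * real n powr (1 / p') * (\<Sum>j. a (nat \<lfloor>real n powr q\<rfloor> + j))"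
      using martingale_approximation_rate
      by (intro exI[of _ "48 + smooth_const p powr (1 / min 2 p) * (51 * cotype_const)"])
        (simp add: S Mart D_eq \<open>q = p'' / p'\<close> \<open>p'' = max 2 p\<close> \<open>p' = min 2 p\<close> flip: tail_eq)
  qed
qed

end
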